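(* Suppose $((X_1,Y_1),\dots,(X_N,Y_N))$ is a sequence of i.i.d. random variables satisfying the linear Gaussian model described in the context, with $\Sigma$ and $\Gamma$ known and $\Sigma$ diagonal. Then a confidence region for $A^\star$ is given by $$P\big(\mathrm{vec}(A^\star)\in\widetilde{\mathcal R}_{\mathrm{vec}(A^\star),\alpha}\big)\;\underset{N\to+\infty}{\longrightarrow}\;1-\alpha,$$ where $$\widetilde{\mathcal R}_{\mathrm{vec}(A^\star),\alpha}=\Big\{a^\star\in\mathbb R^{L\times D}:\;\big(\mathrm{vec}(a^\star-\widehat A^\star)\big)^{T}\,\Theta(A)^{-1}\,\big(\mathrm{vec}(a^\star-\widehat A^\star)\big)\le\chi^2_{DL}(1-\alpha)\Big\},$$ with $\Theta(A)=\mathrm{Cov}\big(\mathrm{vec}(Dg(A).(\widehat A-A))\big)$ defined by $$ \begin{aligned} \Theta(A)=\;&\Big(\big(\Sigma^{-1}+(A^\star)^{T}A^{T}\Sigma^{-1}AA^\star-2\Sigma^{-1}AA^\star\big)\otimes\Sigma^\star\Gamma\Sigma^\star\Big)+\Big((A^\star)^{T}\Gamma A^\star\otimes A^\star\Sigma(A^\star)^{T}\Big)\\ &-2\Big((I\otimes\Sigma^\star\Gamma)+\big((A^\star)^{T}A^{T}\otimes\Sigma^\star\Gamma\big)\Big)\,T_{LD}^{-1}\,\big((A^\star)^{T}\otimes A^\star\big). \end{aligned} $$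
   Context: Model. $L,D$ are positive integers. The pairs $(X_i,Y_i)\in\mathbb R^D\times\mathbb R^L$ are i.i.d. with $X_i\sim\mathcal N_D(0,\Gamma^\star)$ and $Y_i=A^\star X_i+\varepsilon_i$, with Gaussian noise $\varepsilon_i\sim\mathcal N_L(0,\Sigma^\star)$ independent of $X_i$. Equivalently (inverse regression) $Y_i\sim\mathcal N_L(0,\Gamma)$ and $X_i=AY_i+e_i$ with $e_i\sim\mathcal N_D(0,\Sigma)$ independent of $Y_i$, where $A\in\mathbb R^{D\times L}$, $\Gamma$ is $L\times L$, $\Sigma$ is $D\times D$, and $$\Gamma^\star=\Sigma+A\Gamma A^{T},\quad \Sigma^\star=(\Gamma^{-1}+A^{T}\Sigma^{-1}A)^{-1},\quad A^\star=\Sigma^\star A^{T}\Sigma^{-1}.$$ $Y$ is the $N\times L$ matrix with rows $Y_i^{T}$ and $X$ the $N\times D$ matrix with rows $X_i^{T}$. Estimators: $\widehat A=X^{T}Y(Y^{T}Y)^{-1}$ and $\widehat A^\star=g(\widehat A)$, where $g(A)=(\Gamma^{-1}+A^{T}\Sigma^{-1}A)^{-1}A^{T}\Sigma^{-1}$ (so $A^\star=g(A)$). $\mathrm{vec}$ stacks the columns of a matrix, and a matrix is identified with its vectorized form when speaking of membership in the region; $\otimes$ is the Kronecker product; $I$ is the $D\times D$ identity; $T_{LD}$ is the commutation matrix, transforming the vectorized form of an $L\times D$ matrix into the vectorized form of its transpose. The differential of $g$ at $A$ applied to $\widehat A-A$ is $$Dg(A).(\widehat A-A)=\Sigma^\star(\widehat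 A-A)^{T}\Sigma^{-1}-\Sigma^\star(\widehat A-A)^{T}\Sigma^{-1}AA^\star-A^\star(\widehat A-A)A^\star .$$ $1-\alpha$ is the confidence level, $\alpha\in(0,1)$, and $\chi^2_k(1-\alpha)$ is the $(1-\alpha)$-quantile of the $\chi^2$ distribution with $k$ degrees of freedom.
   Formalization: Θ(A) is the covariance at sample size N, assumed invertible for large N; its closed form (N ≥ L+2) is corrected: displayed Γ becomes Γ⁻¹/(N−L−1), the plus in the cross term becomes minus, and the last factor is transposed to A*⊗(A* )ᵀ. As printed, Θ is independent of N and coverage tends to 1. *)

theory Defs
  imports "HOL-Probability.Probability"
begin

text \<open>Matrix conventions: an element of \<open>real^'c^'r\<close> has rows indexed by \<open>'r\<close> and columns
  indexed by \<open>'c\<close>. Throughout, \<open>'l\<close> and \<open>'d\<close> are the index types of the dimensions \<open>L\<close> and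
  \<open>D\<close>. The entry \<open>(i, j)\<close> of a matrix has index \<open>(j, i)\<close> in its vectorization: the column
  number comes first, so that the lexicographic order on the index type is the stacking of the
  columns and agrees with the block order of the Kronecker product.\<close>

definition vectorize :: "real^'c^'r \<Rightarrow> real^('c \<times> 'r)"
  where "vectorize B = (\<chi> p. B $ snd p $ fst p)"

definition kron :: "real^'b^'a \<Rightarrow> real^'f^'e \<Rightarrow> real^('b \<times> 'f)^('a \<times> 'e)" (infixr "\<otimes>\<^sub>k" 72)
  where "B \<otimes>\<^sub>k C = (\<chi> p q. B $ fst p $ fst q * C $ snd p $ snd q)"

text \<open>\<open>commutation *v vectorize B = vectorize (transpose B)\<close> for \<open>B :: real^'d^'l\<close>.\<close>

definition commutation :: "real^('d::finite \<times> 'l::finite)^('l \<times> 'd)"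
  where "commutation = (\<chi> p q. if fst p = snd q \<and> snd p = fst q then 1 else 0)"

definition outer :: "real^'m \<Rightarrow> real^'n \<Rightarrow> real^'n^'m"
  where "outer u v = (\<chi> i j. u $ i * v $ j)"

definition pos_def :: "real^'n^'n \<Rightarrow> bool"
  where "pos_def S \<longleftrightarrow> transpose S = S \<and> (\<forall>x. x \<noteq> 0 \<longrightarrow> x \<bullet> (S *v x) > 0)"

definition mvn_density :: "real^'n \<Rightarrow> real^'n^'n \<Rightarrow> real^'n \<Rightarrow> real"
  where "mvn_density \<mu> S x =
    exp (- ((x - \<mu>) \<bullet> (matrix_inv S *v (x - \<mu>))) / 2) / sqrt ((2 * pi) ^ CARD('n) * det S)"

definition covariance_matrix :: "'w measure \<Rightarrow> ('w \<Rightarrow> real^'n) \<Rightarrow> real^'n^'n"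
  where "covariance_matrix M Z = (\<chi> p q. \<integral>\<omega>.
    (Z \<omega> $ p - (\<integral>\<omega>'. Z \<omega>' $ p \<partial>M)) * (Z \<omega> $ q - (\<integral>\<omega>'. Z \<omega>' $ q \<partial>M)) \<partial>M)"

definition chi_square_density :: "nat \<Rightarrow> real \<Rightarrow> real"
  where "chi_square_density k x =
    (if x \<le> 0 then 0
     else x powr (real k / 2 - 1) * exp (- x / 2) / (2 powr (real k / 2) * Gamma (real k / 2)))"

definition chi_square :: "nat \<Rightarrow> real measure"
  where "chi_square k = density lborel (\<lambda>x. ennreal (chi_square_density k x))"

definition quantile :: "real measure \<Rightarrow> real \<Rightarrow> real"
  where "quantile \<mu> p = Inf {x. p \<le> cdf \<mu> x}"

text \<open>\<open>indep_var\<close> only relates random variables of equal type.\<close>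

definition independent_vectors :: "'w measure \<Rightarrow> ('w \<Rightarrow> real^'m) \<Rightarrow> ('w \<Rightarrow> real^'n) \<Rightarrow> bool"
  where "independent_vectors M U V \<longleftrightarrow>
    prob_space.indep_set M
      (sets (vimage_algebra (space M) U borel)) (sets (vimage_algebra (space M) V borel))"

text \<open>The model in its inverse regression form: \<open>Y i\<close> is centred Gaussian with covariance
  \<open>\<Gamma>\<close>, and \<open>X i = A Y i + e i\<close>, where the noise \<open>e i\<close> is centred Gaussian with covariance
  \<open>\<Sigma>\<close> and independent of \<open>Y i\<close>.\<close>

definition linear_gaussian_model ::
  "'w measure \<Rightarrow> real^'l^'l \<Rightarrow> real^'d^'d \<Rightarrow> real^'l^'d \<Rightarrow>
    (nat \<Rightarrow> 'w \<Rightarrow> real^'d) \<Rightarrow> (nat \<Rightarrow> 'w \<Rightarrow> real^'l) \<Rightarrow> bool"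
  where "linear_gaussian_model M \<Gamma> \<Sigma> A X Y \<longleftrightarrow>
    prob_space M \<and> pos_def \<Gamma> \<and> pos_def \<Sigma> \<and>
    prob_space.indep_vars M (\<lambda>_. borel) (\<lambda>i \<omega>. (X i \<omega>, Y i \<omega>)) UNIV \<and>
    (\<forall>i. distr M borel (\<lambda>\<omega>. (X i \<omega>, Y i \<omega>)) = distr M borel (\<lambda>\<omega>. (X 0 \<omega>, Y 0 \<omega>))) \<and>
    (\<forall>i. distributed M lborel (Y i) (\<lambda>y. ennreal (mvn_density 0 \<Gamma> y)) \<and>
         distributed M lborel (\<lambda>\<omega>. X i \<omega> - A *v Y i \<omega>) (\<lambda>e. ennreal (mvn_density 0 \<Sigma> e)) \<and>
         independent_vectors M (\<lambda>\<omega>. X i \<omega> - A *v Y i \<omega>) (Y i))"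

definition Sigma_star :: "real^'l^'l \<Rightarrow> real^'d^'d \<Rightarrow> real^'l^'d \<Rightarrow> real^'l^'l"
  where "Sigma_star \<Gamma> \<Sigma> A =
    matrix_inv (matrix_inv \<Gamma> + transpose A ** matrix_inv \<Sigma> ** A)"

definition A_star :: "real^'l^'l \<Rightarrow> real^'d^'d \<Rightarrow> real^'l^'d \<Rightarrow> real^'d^'l"
  where "A_star \<Gamma> \<Sigma> A = Sigma_star \<Gamma> \<Sigma> A ** transpose A ** matrix_inv \<Sigma>"

text \<open>With the data matrices whose rows are the first \<open>N\<close> observations, the two sums are the
  \<open>D \<times> L\<close> matrix \<open>X\<^sup>T Y\<close> and the \<open>L \<times> L\<close> matrix \<open>Y\<^sup>T Y\<close>.\<close>

definition A_hat ::
  "(nat \<Rightarrow> 'w \<Rightarrow> real^'d) \<Rightarrow> (nat \<Rightarrow> 'w \<Rightarrow> real^'l) \<Rightarrow> nat \<Rightarrow> 'w \<Rightarrow> real^'l^'d"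
  where "A_hat X Y N \<omega> =
    (\<Sum>i<N. outer (X i \<omega>) (Y i \<omega>)) ** matrix_inv (\<Sum>i<N. outer (Y i \<omega>) (Y i \<omega>))"

definition A_hat_star ::
  "real^'l^'l \<Rightarrow> real^'d^'d \<Rightarrow> (nat \<Rightarrow> 'w \<Rightarrow> real^'d) \<Rightarrow> (nat \<Rightarrow> 'w \<Rightarrow> real^'l) \<Rightarrow>
    nat \<Rightarrow> 'w \<Rightarrow> real^'d^'l"
  where "A_hat_star \<Gamma> \<Sigma> X Y N \<omega> = A_star \<Gamma> \<Sigma> (A_hat X Y N \<omega>)"

text \<open>The differential at \<open>A\<close> of the map \<open>A_star \<Gamma> \<Sigma>\<close>, applied to \<open>H\<close>.\<close>

definition D_A_star :: "real^'l^'l \<Rightarrow> real^'d^'d \<Rightarrow> real^'l^'d \<Rightarrow> real^'l^'d \<Rightarrow> real^'d^'l"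
  where "D_A_star \<Gamma> \<Sigma> A H =
    Sigma_star \<Gamma> \<Sigma> A ** transpose H ** matrix_inv \<Sigma>
    - Sigma_star \<Gamma> \<Sigma> A ** transpose H ** matrix_inv \<Sigma> ** A ** A_star \<Gamma> \<Sigma> A
    - A_star \<Gamma> \<Sigma> A ** H ** A_star \<Gamma> \<Sigma> A"

definition Theta ::
  "'w measure \<Rightarrow> real^'l^'l \<Rightarrow> real^'d^'d \<Rightarrow> real^'l^'d \<Rightarrow>
    (nat \<Rightarrow> 'w \<Rightarrow> real^'d) \<Rightarrow> (nat \<Rightarrow> 'w \<Rightarrow> real^'l) \<Rightarrow> nat \<Rightarrow> real^('d \<times> 'l)^('d \<times> 'l)"
  where "Theta M \<Gamma> \<Sigma> A X Y N =
    covariance_matrix M (\<lambda>\<omega>. vectorize (D_A_star \<Gamma> \<Sigma> A (A_hat X Y N \<omega> - A)))"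

text \<open>The covariance matrix of \<open>vectorize (D_A_star \<Gamma> \<Sigma> A H)\<close> for a random \<open>H\<close> such that
  \<open>vectorize H\<close> has covariance \<open>V \<otimes>\<^sub>k \<Sigma>\<close> with \<open>V\<close> a multiple of \<open>matrix_inv \<Gamma>\<close>. For such
  \<open>V\<close> the cross term is symmetric, whence the factor 2. The error \<open>H = A_hat X Y N \<omega> - A\<close> is of
  this kind for \<open>N \<ge> L + 2\<close>: given the \<open>Y i\<close>, its covariance is \<open>W \<otimes>\<^sub>k \<Sigma>\<close> with \<open>W\<close> the
  inverse of \<open>Y\<^sup>T Y\<close>, and the inverse Wishart matrix \<open>W\<close> has mean
  \<open>V = matrix_inv \<Gamma> / (N - L - 1)\<close>.\<close>

definition Theta_formula ::
  "real^'l^'l \<Rightarrow> real^'l^'l \<Rightarrow> real^'d^'d \<Rightarrow> real^'l^'d \<Rightarrow> real^('d \<times> 'l)^('d \<times> 'l)"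
  where "Theta_formula V \<Gamma> \<Sigma> A =
    (let S = Sigma_star \<Gamma> \<Sigma> A; B = A_star \<Gamma> \<Sigma> A; P = matrix_inv \<Sigma> in
      ((P + transpose B ** transpose A ** P ** A ** B - 2 *\<^sub>R (P ** A ** B)) \<otimes>\<^sub>k (S ** V ** S))
      + ((transpose B ** V ** B) \<otimes>\<^sub>k (B ** \<Sigma> ** transpose B))
      - 2 *\<^sub>R (((mat 1 \<otimes>\<^sub>k (S ** V)) - ((transpose B ** transpose A) \<otimes>\<^sub>k (S ** V)))
               ** matrix_inv commutation ** (B \<otimes>\<^sub>k transpose B)))"

definition confidence_region ::
  "'w measure \<Rightarrow> real^'l^'l \<Rightarrow> real^'d^'d \<Rightarrow> real^'l^'d \<Rightarrow>
    (nat \<Rightarrow> 'w \<Rightarrow> real^'d) \<Rightarrow> (nat \<Rightarrow> 'w \<Rightarrow> real^'l) \<Rightarrow> real \<Rightarrow> nat \<Rightarrow> 'w \<Rightarrow> (real^'d^'l) set"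
  where "confidence_region M \<Gamma> \<Sigma> A X Y \<alpha> N \<omega> =
    {a. vectorize (a - A_hat_star \<Gamma> \<Sigma> X Y N \<omega>) \<bullet>
          (matrix_inv (Theta M \<Gamma> \<Sigma> A X Y N) *v vectorize (a - A_hat_star \<Gamma> \<Sigma> X Y N \<omega>))
        \<le> quantile (chi_square (CARD('d) * CARD('l))) (1 - \<alpha>)}"

end

theory Submission
  imports Defs
begin

text \<open>The error \<open>H\<close> of the estimator is the sum of the \<open>outer (e i) (y i)\<close> times the inverse of
  \<open>G = Y\<^sup>T Y\<close>. Translating each \<open>e i\<close> by \<open>h *v y i\<close> translates \<open>H\<close> by \<open>h\<close> and fixes \<open>G\<close>, so
  the Cameron--Martin formula shows that \<open>H\<close> is, given \<open>G\<close>, Gaussian with density proportional to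
  \<open>exp (- (h \<bullet> (P ** h ** G)) / 2)\<close>, where \<open>P = matrix_inv \<Sigma>\<close>. Hence the pivot
  \<open>H \<bullet> (P ** H ** G)\<close> has exactly the chi-square law with \<open>D L\<close> degrees of freedom, and the
  covariance of \<open>H\<close> follows from the mean of \<open>matrix_inv G\<close>. This mean comes from Stein's identity,
  applied to the rows of \<open>Y\<close> and the regularized inverse of \<open>G + t I\<close>, as \<open>t\<close> tends to 0.
  Invertibility of \<open>Theta\<close> makes the differential of \<open>A_star\<close> bijective, so its inverse pulls back
  to \<open>h \<bullet> (P ** h ** \<Gamma>)\<close>. As \<open>H\<close> tends to 0 and \<open>G / N\<close> to \<open>\<Gamma>\<close> in probability, the ratio
  of the statistic to the pivot tends to 1.\<close>

section \<open>Matrices\<close>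

text \<open>\<open>Theta\<close> is an exact covariance for each N, so the mean of
  \<open>matrix_inv G\<close> has to be finite and known, not only its asymptotics. In the factor N
  - L - 1 the N counts the rows in Stein's identity, L is the trace of
  \<open>matrix_inv G ** G\<close>, and 1 comes from the squares
  \<open>(u \<bullet> (W *v y i))\<^sup>2\<close>, which sum to one copy of
  \<open>u \<bullet> (W *v u)\<close>. The regularization is forced by singular Gram matrices:
  Stein's identity differentiates in one row along whole lines, and these may meet points where the
  inverse blows up. The obstacle with \<open>H\<close> is that it is a quotient of two dependent
  matrices. Averaging the translation formula over the translations, by Fubini, gives its law given
  \<open>G\<close> up to a factor, which the normalization of the Gaussian removes. The conditional
  probability of the event that the pivot is at most r is then the same for all \<open>G\<close>, so
  the pivot has its limit law already for each N with N \<ge> L + 2. The limit in N only has to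
  compare statistic and pivot, and continuity of the chi-square distribution function absorbs the
  difference.\<close>

lemmas bochner_sum = Bochner_Integration.integrable_sum Bochner_Integration.integral_sum

section \<open>Matrix operations as bounded bilinear maps\<close>

lemma bilinear_matrix_mult:
  "bounded_bilinear (\<lambda>(A::real^'m^'n) (B::real^'k^'m). A ** B)"
  unfolding bilinear_conv_bounded_bilinear[symmetric] bilinear_def
  by (auto intro!: linearI simp: vec_eq_iff matrix_matrix_mult_def algebra_simps sum.distrib sum_distrib_left)

lemma bilinear_matrix_vector_mult:
  "bounded_bilinear (\<lambda>(A::real^'m^'n) (x::real^'m). A *v x)"
  unfolding bilinear_conv_bounded_bilinear[symmetric] bilinear_def
  by (auto intro!: linearI simp: algebra_simps scaleR_matrix_vector_assoc)

lemma bilinear_outer: "bounded_bilinear (outer :: real^'m \<Rightarrow> real^'n \<Rightarrow> real^'n^'m)"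
  unfolding bilinear_conv_bounded_bilinear[symmetric] bilinear_def
  by (auto intro!: linearI simp: outer_def vec_eq_iff algebra_simps)

lemma bounded_linear_transpose: "bounded_linear (transpose :: real^'m^'n \<Rightarrow> real^'n^'m)"
  unfolding linear_conv_bounded_linear[symmetric]
  by (auto intro!: linearI simp: transpose_def vec_eq_iff)

lemmas linear_transpose = bounded_linear.linear[OF bounded_linear_transpose]

lemmas matrix_mult_simps =
  bounded_bilinear.add_left[OF bilinear_matrix_mult]
  bounded_bilinear.add_right[OF bilinear_matrix_mult]
  bounded_bilinear.diff_left[OF bilinear_matrix_mult]
  bounded_bilinear.diff_right[OF bilinear_matrix_mult]
  bounded_bilinear.minus_left[OF bilinear_matrix_mult]
  bounded_bilinear.minus_right[OF bilinear_matrix_mult]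
  bounded_bilinear.scaleR_left[OF bilinear_matrix_mult]
  bounded_bilinear.scaleR_right[OF bilinear_matrix_mult]

lemmas continuous_on_matrix_mult [continuous_intros] =
  bounded_bilinear.continuous_on[OF bilinear_matrix_mult]
lemmas continuous_on_matrix_vector_mult [continuous_intros] =
  bounded_bilinear.continuous_on[OF bilinear_matrix_vector_mult]
lemmas continuous_on_outer [continuous_intros] =
  bounded_bilinear.continuous_on[OF bilinear_outer]
lemmas continuous_on_transpose [continuous_intros] =
  bounded_linear.continuous_on[OF bounded_linear_transpose]
lemmas tendsto_matrix_mult [tendsto_intros] =
  bounded_bilinear.tendsto[OF bilinear_matrix_mult]
lemmas tendsto_matrix_vector_mult [tendsto_intros] =
  bounded_bilinear.tendsto[OF bilinear_matrix_vector_mult]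
lemmas tendsto_transpose [tendsto_intros] =
  bounded_linear.tendsto[OF bounded_linear_transpose]

lemma borel_measurable_bounded_bilinear:
  fixes h :: "'a::{second_countable_topology, real_normed_vector} \<Rightarrow>
    'b::{second_countable_topology, real_normed_vector} \<Rightarrow> 'c::real_normed_vector"
  assumes "bounded_bilinear h" "f \<in> borel_measurable M" "g \<in> borel_measurable M"
  shows "(\<lambda>x. h (f x) (g x)) \<in> borel_measurable M"
  using assms(2,3)
  by (rule borel_measurable_continuous_Pair)
    (intro bounded_bilinear.continuous_on[OF assms(1)] continuous_intros)

lemmas borel_measurable_matrix_mult [measurable] =
  borel_measurable_bounded_bilinear[OF bilinear_matrix_mult]
lemmas borel_measurable_matrix_vector_mult [measurable] =
  borel_measurable_bounded_bilinear[OF bilinear_matrix_vector_mult]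
lemmas borel_measurable_outer [measurable] =
  borel_measurable_bounded_bilinear[OF bilinear_outer]

lemma borel_measurable_transpose [measurable]:
  fixes f :: "'a \<Rightarrow> real^'m^'n"
  assumes "f \<in> borel_measurable M"
  shows "(\<lambda>x. transpose (f x)) \<in> borel_measurable M"
  by (rule borel_measurable_continuous_on[OF _ assms]) (intro continuous_intros)

lemma borel_measurable_vec_nth [measurable]:
  fixes f :: "'a \<Rightarrow> ('b::real_normed_vector)^'n"
  assumes "f \<in> borel_measurable M"
  shows "(\<lambda>x. f x $ i) \<in> borel_measurable M"
  by (rule borel_measurable_continuous_on[OF _ assms]) (intro continuous_intros)

section \<open>The Frobenius inner product and rank-one matrices\<close>

lemma inner_matrix_mult_left:
  fixes A :: "real^'m^'n" and B :: "real^'k^'m"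
  shows "(A ** B) \<bullet> C = B \<bullet> (transpose A ** C)"
proof -
  have "(A ** B) \<bullet> C = (\<Sum>i\<in>UNIV. \<Sum>j\<in>UNIV. \<Sum>k\<in>UNIV. A $ i $ k * B $ k $ j * C $ i $ j)"
    by (simp add: inner_vec_def matrix_matrix_mult_def sum_distrib_right)
  also have "\<dots> = (\<Sum>i\<in>UNIV. \<Sum>k\<in>UNIV. \<Sum>j\<in>UNIV. A $ i $ k * B $ k $ j * C $ i $ j)"
    by (intro sum.cong refl sum.swap)
  also have "\<dots> = (\<Sum>k\<in>UNIV. \<Sum>i\<in>UNIV. \<Sum>j\<in>UNIV. A $ i $ k * B $ k $ j * C $ i $ j)" by (rule sum.swap)
  also have "\<dots> = (\<Sum>k\<in>UNIV. \<Sum>j\<in>UNIV. \<Sum>i\<in>UNIV. A $ i $ k * B $ k $ j * C $ i $ j)"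
    by (intro sum.cong refl sum.swap)
  also have "\<dots> = B \<bullet> (transpose A ** C)"
    by (simp add: inner_vec_def matrix_matrix_mult_def transpose_def sum_distrib_left mult_ac)
  finally show ?thesis .
qed

lemma inner_transpose: "transpose A \<bullet> transpose B = A \<bullet> (B :: real^'m^'n)"
  unfolding inner_vec_def transpose_def by (simp, rule sum.swap)

lemma inner_matrix_mult_right:
  fixes A :: "real^'m^'n" and B :: "real^'k^'m"
  shows "(A ** B) \<bullet> C = A \<bullet> (C ** transpose B)"
proof -
  have "(A ** B) \<bullet> C = (transpose B ** transpose A) \<bullet> transpose C"
    by (simp flip: matrix_transpose_mul add: inner_transpose)
  also have "\<dots> = transpose A \<bullet> transpose (C ** transpose B)"
    by (simp add: inner_matrix_mult_left matrix_transpose_mul)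
  finally show ?thesis by (simp only: inner_transpose)
qed

lemma inner_matrix_vector_mult:
  fixes A :: "real^'m^'n"
  shows "(A *v x) \<bullet> y = x \<bullet> (transpose A *v y)"
  using dot_lmul_matrix[of y A x] by (simp add: inner_commute)

lemma matrix_mult_outer: "A ** outer u v = outer (A *v u) v"
  by (simp add: outer_def matrix_matrix_mult_def matrix_vector_mult_def vec_eq_iff sum_distrib_left mult_ac)

lemma outer_matrix_mult: "outer u v ** A = outer u (transpose A *v v)"
  by (simp add: outer_def matrix_matrix_mult_def matrix_vector_mult_def transpose_def vec_eq_iff
      sum_distrib_left mult_ac)

lemma outer_matrix_vector_mult: "outer u v *v x = (v \<bullet> x) *\<^sub>R u"
  by (simp add: outer_def matrix_vector_mult_def vec_eq_iff inner_vec_def sum_distrib_left mult_ac)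

lemma inner_outer: "A \<bullet> outer u v = (A *v v) \<bullet> u"
  by (simp add: outer_def matrix_vector_mult_def inner_vec_def sum_distrib_right sum_distrib_left mult_ac)

lemma transpose_outer: "transpose (outer u v) = outer v u"
  by (simp add: outer_def transpose_def vec_eq_iff mult.commute)

section \<open>The matrix inverse: algebra, continuity, derivative, measurability\<close>

lemma
  fixes A :: "real^'n^'n"
  assumes "invertible A"
  shows matrix_inv_right: "A ** matrix_inv A = mat 1"
    and matrix_inv_left: "matrix_inv A ** A = mat 1"
  using someI_ex[OF assms[unfolded invertible_def]] unfolding matrix_inv_def by auto

lemma invertibleI: "A ** B = mat 1 \<Longrightarrow> invertible (A :: real^'n^'n)"
  unfolding invertible_right_inverse by blast

lemma matrix_inv_eqI:
  fixes C :: "real^'m^'n"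
  assumes "C ** C' = mat 1" "C' ** C = mat 1"
  shows "matrix_inv C = C'"
proof -
  have "C ** matrix_inv C = mat 1 \<and> matrix_inv C ** C = mat 1"
    unfolding matrix_inv_def by (rule someI[of _ C']) (use assms in simp)
  then have "matrix_inv C ** (C ** C') = C'" by (simp add: matrix_mul_assoc)
  then show ?thesis by (simp add: assms)
qed

lemma matrix_inv_unique: "A ** B = mat 1 \<Longrightarrow> matrix_inv A = (B :: real^'n^'n)"
  by (rule matrix_inv_eqI) (simp_all add: matrix_left_right_inverse)

lemma transpose_matrix_inv:
  fixes A :: "real^'n^'n"
  assumes "invertible A"
  shows "transpose (matrix_inv A) = matrix_inv (transpose A)"
  by (rule sym, rule matrix_inv_unique)
    (simp flip: matrix_transpose_mul add: assms matrix_inv_left)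

lemma matrix_inv_scaleR:
  fixes A :: "real^'n^'n"
  assumes "invertible A" "c \<noteq> 0"
  shows "matrix_inv (c *\<^sub>R A) = (1 / c) *\<^sub>R matrix_inv A"
  by (rule matrix_inv_unique) (simp add: matrix_mult_simps assms matrix_inv_right)

text \<open>On singular matrices the choice operator is applied to one and the same empty predicate,
  so \<open>matrix_inv\<close> is constant there. Together with continuity on the open set of
  invertible matrices this makes it Borel measurable everywhere.\<close>

lemma matrix_inv_singular:
  fixes A :: "real^'n^'n"
  assumes "\<not> invertible A"
  shows "matrix_inv A = (SOME B. False)"
  unfolding matrix_inv_def using assms unfolding invertible_def by (intro arg_cong[where f=Eps]) blast

lemma continuous_on_det [continuous_intros]:
  fixes f :: "'a::topological_space \<Rightarrow> real^'n^'n"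
  shows "continuous_on S f \<Longrightarrow> continuous_on S (\<lambda>x. det (f x))"
  unfolding det_def by (intro continuous_intros)

lemma continuous_on_if_const:
  "(P \<Longrightarrow> continuous_on S f) \<Longrightarrow> (\<not> P \<Longrightarrow> continuous_on S g) \<Longrightarrow>
    continuous_on S (\<lambda>x. if P then f x else g x)"
  by (cases P) simp_all

text \<open>Cramer's rule for the column \<open>matrix_inv A *v axis j 1\<close>. The entries are
  quotients of determinants, which is where the continuity of the inverse comes from.\<close>

lemma matrix_inv_nth:
  fixes A :: "real^'n^'n"
  assumes "invertible A"
  shows "matrix_inv A $ k $ j = det (\<chi> r s. if s = k then axis j 1 $ r else A $ r $ s) / det A"
proof -
  have "A *v (matrix_inv A *v axis j 1) = axis j 1"
    by (simp add: matrix_vector_mul_assoc matrix_inv_right assms)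
  then have "matrix_inv A *v axis j 1 =
      (\<chi> k. det (\<chi> r s. if s = k then axis j 1 $ r else A $ r $ s) / det A)"
    using assms by (subst (asm) cramer) (auto simp: invertible_det_nz)
  then have "(matrix_inv A *v axis j 1) $ k =
      det (\<chi> r s. if s = k then axis j 1 $ r else A $ r $ s) / det A"
    by simp
  then show ?thesis by (simp add: matrix_vector_mul_component inner_axis row_def)
qed

lemma continuous_on_matrix_inv: "continuous_on {A :: real^'n^'n. invertible A} matrix_inv"
proof -
  have "continuous_on {A :: real^'n^'n. invertible A}
      (\<lambda>A. \<chi> k j. det (\<chi> r s. if s = k then axis j 1 $ r else A $ r $ s) / det A)"
    by (intro continuous_on_vec_lambda continuous_on_divide continuous_on_det ballI)
      (simp_all add: invertible_det_nz if_distrib cong: if_cong,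
        auto intro!: continuous_on_if_const continuous_on_component continuous_intros)
  then show ?thesis by (rule continuous_on_eq) (simp add: vec_eq_iff matrix_inv_nth)
qed

lemma open_invertible: "open {A :: real^'n^'n. invertible A}"
  unfolding invertible_det_nz by (intro open_Collect_neq continuous_intros)

lemma tendsto_matrix_inv:
  fixes f :: "'a \<Rightarrow> real^'n^'n"
  assumes "(f \<longlongrightarrow> A) F" "invertible A"
  shows "((\<lambda>x. matrix_inv (f x)) \<longlongrightarrow> matrix_inv A) F"
proof -
  have "isCont matrix_inv A" using continuous_on_matrix_inv open_invertible assms(2)
    by (subst (asm) continuous_on_eq_continuous_at) auto
  then show ?thesis using assms(1) by (rule isCont_tendsto_compose)
qed

text \<open>With S the inverse of B, the difference of the inverses of X and B is
  \<open>- (matrix_inv X ** (X - B) ** S)\<close>. The remainder of the linearization is therefore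
  \<open>(S - matrix_inv X) ** (X - B) ** S\<close>, and continuity of the inverse makes it small
  relative to \<open>norm (X - B)\<close>.\<close>

lemma has_derivative_matrix_inv:
  fixes B :: "real^'n^'n"
  assumes B: "invertible B"
  shows "(matrix_inv has_derivative (\<lambda>E. - (matrix_inv B ** E ** matrix_inv B))) (at B)"
  unfolding has_derivative_at_within
proof
  let ?S = "matrix_inv B"
  show "bounded_linear (\<lambda>E. - (?S ** E ** ?S))"
    by (intro bounded_linear_minus
        bounded_linear_compose[OF bounded_bilinear.bounded_linear_left[OF bilinear_matrix_mult]
          bounded_bilinear.bounded_linear_right[OF bilinear_matrix_mult]])
  obtain K where K: "\<And>(X :: real^'n^'n) (Y :: real^'n^'n). norm (X ** Y) \<le> norm X * norm Y * K" "K \<ge> 0"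
    using bounded_bilinear.nonneg_bounded[OF bilinear_matrix_mult] by blast
  have inv: "\<forall>\<^sub>F X in at B. invertible X"
    using open_invertible B by (auto simp: eventually_at_topological)
  show "((\<lambda>X. (matrix_inv X - ?S - - (?S ** (X - B) ** ?S)) /\<^sub>R norm (X - B)) \<longlongrightarrow> 0) (at B)"
  proof (rule Lim_null_comparison)
    show "\<forall>\<^sub>F X in at B. norm ((matrix_inv X - ?S - - (?S ** (X - B) ** ?S)) /\<^sub>R norm (X - B)) \<le>
        norm (?S - matrix_inv X) * (K * K * norm ?S)"
      using inv
    proof eventually_elim
      case (elim X)
      have 1: "matrix_inv X ** X ** ?S = ?S" "matrix_inv X ** B ** ?S = matrix_inv X"
        using elim B by (simp_all add: matrix_inv_left matrix_inv_right flip: matrix_mul_assoc[of _ B])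
      have 2: "?S ** X ** ?S - ?S ** B ** ?S = ?S ** (X - B) ** ?S" by (simp add: matrix_mult_simps)
      have "matrix_inv X - ?S = - (matrix_inv X ** (X - B) ** ?S)"
        by (simp add: matrix_mult_simps 1)
      then have "matrix_inv X - ?S - - (?S ** (X - B) ** ?S) = (?S - matrix_inv X) ** (X - B) ** ?S"
        by (simp add: matrix_mult_simps)
      also have "norm \<dots> \<le> norm ((?S - matrix_inv X) ** (X - B)) * norm ?S * K"
        using K(1)[of "(?S - matrix_inv X) ** (X - B)" ?S] .
      also have "\<dots> \<le> (norm (?S - matrix_inv X) * norm (X - B) * K) * norm ?S * K"
        by (intro mult_right_mono K) auto
      finally have "norm (matrix_inv X - ?S - - (?S ** (X - B) ** ?S)) \<le>
          norm (X - B) * (norm (?S - matrix_inv X) * (K * K * norm ?S))"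
        by (simp add: mult_ac)
      note * = this
      show ?case
      proof (cases "X = B")
        case False
        have **: "norm (x /\<^sub>R n) \<le> b" if "norm x \<le> n * b" "n > 0" for x :: "real^'n^'n" and n b :: real
          using that by (simp add: field_simps)
        show ?thesis by (rule **[OF *]) (use False in simp)
      qed simp
    qed
    have "((\<lambda>X. norm (?S - matrix_inv X) * (K * K * norm ?S)) \<longlongrightarrow>
        norm (?S - ?S) * (K * K * norm ?S)) (at B)"
      by (intro tendsto_intros tendsto_matrix_inv B)
    then show "((\<lambda>X. norm (?S - matrix_inv X) * (K * K * norm ?S)) \<longlongrightarrow> 0) (at B)" by simp
  qed
qed

lemma borel_measurable_matrix_inv [measurable]:
  fixes f :: "'a \<Rightarrow> real^'n^'n"
  assumes "f \<in> borel_measurable M"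
  shows "(\<lambda>x. matrix_inv (f x)) \<in> borel_measurable M"
proof -
  have "(\<lambda>A :: real^'n^'n. if A \<in> {A. invertible A} then matrix_inv A else (SOME B. False))
      \<in> borel_measurable borel"
    by (intro borel_measurable_continuous_on_if continuous_on_matrix_inv continuous_intros
        borel_open open_invertible)
  also have "(\<lambda>A :: real^'n^'n. if A \<in> {A. invertible A} then matrix_inv A else (SOME B. False))
      = matrix_inv"
    by (auto simp: matrix_inv_singular)
  finally show ?thesis using assms by (rule measurable_compose_rev)
qed

section \<open>Positive definite matrices\<close>

lemma pos_def_invertible:
  assumes "pos_def S" shows "invertible S"
proof -
  have "x = 0" if "S *v x = 0" for x using assms that unfolding pos_def_def by fastforce
  then show ?thesis unfolding invertible_left_inverse matrix_left_invertible_ker by blast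
qed

lemma pos_def_matrix_inv:
  assumes "pos_def S" shows "pos_def (matrix_inv S)"
  unfolding pos_def_def
proof (intro conjI allI impI)
  note inv = pos_def_invertible[OF assms]
  show "transpose (matrix_inv S) = matrix_inv S"
    using assms by (simp add: transpose_matrix_inv[OF inv] pos_def_def)
  fix x :: "real^'a" assume "x \<noteq> 0"
  have x: "S *v (matrix_inv S *v x) = x" by (simp add: matrix_vector_mul_assoc matrix_inv_right inv)
  with \<open>x \<noteq> 0\<close> have "matrix_inv S *v x \<noteq> 0" by auto
  then show "x \<bullet> (matrix_inv S *v x) > 0"
    using assms x unfolding pos_def_def by (metis inner_commute)
qed

section \<open>Gaussian integrals\<close>

lemma nn_integral_translate:
  fixes f :: "'a::euclidean_space \<Rightarrow> ennreal"
  assumes [measurable]: "f \<in> borel_measurable borel"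
  shows "(\<integral>\<^sup>+x. f (x + t) \<partial>lborel) = (\<integral>\<^sup>+x. f x \<partial>lborel)"
  by (subst lborel_distr_plus[of t, symmetric], subst nn_integral_distr) (auto simp: add.commute)

lemma nn_integral_lborel_uminus:
  fixes f :: "'a::euclidean_space \<Rightarrow> ennreal"
  assumes [measurable]: "f \<in> borel_measurable borel"
  shows "(\<integral>\<^sup>+x. f (- x) \<partial>lborel) = (\<integral>\<^sup>+x. f x \<partial>lborel)"
  by (subst (2) lborel_affine[of "- 1" 0]) (simp_all add: nn_integral_density nn_integral_distr)

lemma integral_translate:
  fixes f :: "'a::euclidean_space \<Rightarrow> real"
  assumes [measurable]: "f \<in> borel_measurable borel"
  shows "(\<integral>x. f (x + t) \<partial>lborel) = (\<integral>x. f x \<partial>lborel)"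
  by (subst (2) lborel_distr_plus[of t, symmetric], subst integral_distr) (auto simp: add.commute)

lemma integrable_translate:
  fixes f :: "'a::euclidean_space \<Rightarrow> real"
  assumes "integrable lborel f"
  shows "integrable lborel (\<lambda>x. f (x + t))"
proof -
  have "integrable (distr lborel borel ((+) t)) f" using assms by (simp add: lborel_distr_plus)
  then have "integrable lborel (\<lambda>x. f (t + x))"
    by (subst (asm) integrable_distr_eq) (use assms in \<open>auto dest: borel_measurable_integrable\<close>)
  then show ?thesis by (simp add: add.commute)
qed

text \<open>Integrate \<open>F (x + v) - F x\<close>, written as the integral of F' over the segment
  from x to \<open>x + v\<close>. Translation invariance gives 0 on one side and, after Fubini, the
  integral of F' on the other. Integrability of F stands in for decay at infinity.\<close>

lemma integral_derivative_eq_0: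
  fixes F F' :: "'a::euclidean_space \<Rightarrow> real"
  assumes F: "integrable lborel F" and F': "integrable lborel F'"
    and cont: "continuous_on UNIV F'"
    and deriv: "\<And>x s. ((\<lambda>s. F (x + s *\<^sub>R v)) has_real_derivative F' (x + s *\<^sub>R v)) (at s)"
  shows "(\<integral>x. F' x \<partial>lborel) = 0"
proof -
  have [measurable]: "F' \<in> borel_measurable borel" "F \<in> borel_measurable borel"
    using F F' by (auto dest: borel_measurable_integrable)
  define G :: "'a \<Rightarrow> real \<Rightarrow> real" where "G = (\<lambda>x s. indicator {0..1} s * F' (x + s *\<^sub>R v))"
  have [measurable]: "case_prod G \<in> borel_measurable (lborel \<Otimes>\<^sub>M lborel)"
    unfolding G_def by measurable
  note intF' = integrable_translate[OF F']
  have absF': "(\<integral>x. \<bar>F' (x + t)\<bar> \<partial>lborel) = (\<integral>x. \<bar>F' x\<bar> \<partial>lborel)" for t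
    by (rule integral_translate[where f="\<lambda>x. \<bar>F' x\<bar>"]) measurable
  have "integrable (lborel \<Otimes>\<^sub>M lborel) (\<lambda>(s, x). G x s)"
  proof (rule lborel_pair.Fubini_integrable)
    show "(\<lambda>(s, x). G x s) \<in> borel_measurable (lborel \<Otimes>\<^sub>M lborel)"
      unfolding G_def by measurable
    show "integrable lborel (\<lambda>s. LINT x|lborel. norm (case (s, x) of (s, x) \<Rightarrow> G x s))"
      by (auto simp: G_def abs_mult absF')
    show "AE s in lborel. integrable lborel (\<lambda>x. case (s, x) of (s, x) \<Rightarrow> G x s)"
      using intF' by (auto simp: G_def)
  qed
  then have "(\<integral>x. (\<integral>s. G x s \<partial>lborel) \<partial>lborel) = (\<integral>s. (\<integral>x. G x s \<partial>lborel) \<partial>lborel)"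
    by (rule lborel_pair.Fubini_integral)
  also have "\<dots> = (\<integral>s. indicator {0..1::real} s * (\<integral>x. F' x \<partial>lborel) \<partial>lborel)"
    by (simp add: G_def integral_translate)
  also have "\<dots> = (\<integral>x. F' x \<partial>lborel)" by simp
  also have "(\<lambda>x. \<integral>s. G x s \<partial>lborel) = (\<lambda>x. F (x + v) - F x)"
  proof
    fix x
    have "(\<integral>s. indicator {0..1} s *\<^sub>R F' (x + s *\<^sub>R v) \<partial>lborel) =
        (\<lambda>s. F (x + s *\<^sub>R v)) 1 - (\<lambda>s. F (x + s *\<^sub>R v)) 0"
      by (rule integral_FTC_Icc) (auto intro!: has_vector_derivative_at_within
        continuous_on_compose2[OF cont] continuous_intros
        deriv[unfolded has_real_derivative_iff_has_vector_derivative])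
    then show "(\<integral>s. G x s \<partial>lborel) = F (x + v) - F x" by (simp add: G_def)
  qed
  also have "(\<integral>x. F (x + v) - F x \<partial>lborel) = 0"
    using F integrable_translate[OF F] by (simp add: integral_translate)
  finally show ?thesis by simp
qed

text \<open>The function is a product over the coordinates of multiples of the normal density with
  variance 1 / (2 c).\<close>

lemma integrable_exp_neg_norm_square:
  assumes "c > 0"
  shows "integrable lborel (\<lambda>x::'a::euclidean_space. exp (- c * (norm x)\<^sup>2))"
proof (rule integrableI_nonneg)
  have "(\<integral>\<^sup>+(x::real). ennreal (exp (- c * x\<^sup>2)) \<partial>lborel) < \<infinity>"
  proof -
    have "integrable lborel (\<lambda>x. normal_density 0 (sqrt (1 / (2 * c))) x * sqrt (2 * pi * (1 / (2 * c))))"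
      using assms by (intro integrable_mult_left integrable_normal_density) auto
    also have "(\<lambda>x. normal_density 0 (sqrt (1 / (2 * c))) x * sqrt (2 * pi * (1 / (2 * c)))) =
        (\<lambda>x. exp (- c * x\<^sup>2))"
      using assms by (auto simp: normal_density_def)
    finally show ?thesis by (auto simp: integrable_iff_bounded)
  qed
  then have "(\<Prod>b\<in>(Basis :: 'a set). \<integral>\<^sup>+(x::real). ennreal (exp (- c * x\<^sup>2)) \<partial>lborel) < \<infinity>"
    by (simp add: power_less_top_ennreal)
  also have "(\<Prod>b\<in>(Basis :: 'a set). \<integral>\<^sup>+(x::real). ennreal (exp (- c * x\<^sup>2)) \<partial>lborel) =
      (\<integral>\<^sup>+(x::'a). (\<Prod>b\<in>Basis. ennreal (exp (- c * (x \<bullet> b)\<^sup>2))) \<partial>lborel)"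
    by (rule nn_integral_lborel_prod[symmetric]) auto
  also have "\<dots> = (\<integral>\<^sup>+(x::'a). ennreal (exp (- c * (norm x)\<^sup>2)) \<partial>lborel)"
  proof (rule nn_integral_cong)
    fix x :: 'a
    have "(norm x)\<^sup>2 = (\<Sum>b\<in>Basis. (x \<bullet> b)\<^sup>2)"
      by (subst norm_eq_sqrt_inner, subst euclidean_inner) (simp add: power2_eq_square sum_nonneg)
    then show "(\<Prod>b\<in>Basis. ennreal (exp (- c * (x \<bullet> b)\<^sup>2))) = ennreal (exp (- c * (norm x)\<^sup>2))"
      by (simp add: prod_ennreal sum_distrib_left sum_negf exp_sum flip: exp_sum)
  qed
  finally show "(\<integral>\<^sup>+(x::'a). ennreal (exp (- c * (norm x)\<^sup>2)) \<partial>lborel) < \<infinity>" .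
qed auto

text \<open>The quadratic Taylor polynomial of the exponential at \<open>a * s\<close> dominates
  both 1 and \<open>(a * s)\<^sup>2 / 2\<close>; the constant 2 + 4 / a^2 comes from
  \<open>(1 + s)\<^sup>2 \<le> 2 + 2 * s\<^sup>2\<close>.\<close>

lemma square_one_plus_le_exp:
  assumes "a > (0::real)"
  obtains C where "\<And>s. s \<ge> 0 \<Longrightarrow> (1 + s)\<^sup>2 \<le> C * exp (a * s)"
proof
  fix s :: real assume s: "s \<ge> 0"
  have "(1 + s)\<^sup>2 \<le> 2 + 2 * s\<^sup>2"
    using zero_le_power2[of "1 - s"] by (simp add: power2_eq_square algebra_simps)
  also have "\<dots> = 2 * 1 + 4 / a\<^sup>2 * ((a * s)\<^sup>2 / 2)" using assms by (simp add: power_mult_distrib)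
  also have "\<dots> \<le> 2 * (1 + a * s + (a * s)\<^sup>2 / 2) + 4 / a\<^sup>2 * (1 + a * s + (a * s)\<^sup>2 / 2)"
    using assms s by (intro add_mono mult_left_mono) auto
  also have "\<dots> \<le> (2 + 4 / a\<^sup>2) * exp (a * s)" unfolding distrib_right[symmetric] using assms s
    by (intro mult_left_mono exp_lower_Taylor_quadratic) auto
  finally show "(1 + s)\<^sup>2 \<le> (2 + 4 / a\<^sup>2) * exp (a * s)" .
qed

lemma le_one_plus_square: "s \<le> 1 + (s::real)\<^sup>2"
proof -
  have "2 * s \<le> 1 + s\<^sup>2"
    using zero_le_power2[of "s - 1"] by (simp add: power2_eq_square algebra_simps)
  then show ?thesis using zero_le_power2[of s] by linarith
qed

text \<open>Growth is measured throughout in powers of \<open>1 + (norm x)\<^sup>2\<close>: such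
  bounds multiply, and a lower power is bounded by a higher one.\<close>

lemma abs_inner_le: "\<bar>x \<bullet> v\<bar> \<le> norm v * (1 + (norm x)\<^sup>2)"
proof -
  have "norm x * norm v \<le> (1 + (norm x)\<^sup>2) * norm v"
    by (intro mult_right_mono le_one_plus_square) auto
  then show ?thesis
    using Cauchy_Schwarz_ineq2[of x v] by (simp add: mult.commute)
qed

locale positive_form =
  fixes T :: "'a::euclidean_space \<Rightarrow> 'a"
  assumes lin: "linear T"
    and selfadj: "\<And>x y. T x \<bullet> y = x \<bullet> T y"
    and pos: "\<And>x. x \<noteq> 0 \<Longrightarrow> x \<bullet> T x > 0"
begin

definition weight :: "'a \<Rightarrow> real" where "weight x = exp (- (x \<bullet> T x) / 2)"

lemma continuous_on_T [continuous_intros]: "continuous_on S f \<Longrightarrow> continuous_on S (\<lambda>x. T (f x))"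
  by (rule bounded_linear.continuous_on[OF lin[unfolded linear_conv_bounded_linear]])

lemma measurable_T [measurable]: "T \<in> borel_measurable borel"
  by (intro borel_measurable_continuous_onI continuous_intros)

lemma weight_pos: "weight x > 0"
  by (simp add: weight_def)

lemma continuous_on_weight [continuous_intros]:
  "continuous_on S f \<Longrightarrow> continuous_on S (\<lambda>x. weight (f x))"
  unfolding weight_def by (intro continuous_intros) auto

lemma measurable_weight [measurable]: "weight \<in> borel_measurable borel"
  by (intro borel_measurable_continuous_onI continuous_intros)

text \<open>c is the minimum of the form on the unit sphere, positive by compactness; homogeneity
  does the rest.\<close>

lemma coercive:
  obtains c where "c > 0" "\<And>x. c * (norm x)\<^sup>2 \<le> x \<bullet> T x"
proof -
  have "compact (sphere (0::'a) 1)" "sphere (0::'a) 1 \<noteq> {}" by auto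
  moreover have "continuous_on (sphere 0 1) (\<lambda>x. x \<bullet> T x)" by (intro continuous_intros)
  ultimately obtain z where z: "z \<in> sphere 0 1" "\<And>y. y \<in> sphere 0 1 \<Longrightarrow> z \<bullet> T z \<le> y \<bullet> T y"
    using continuous_attains_inf by metis
  show thesis
  proof
    show "z \<bullet> T z > 0" using z(1) by (intro pos) auto
    fix x
    show "(z \<bullet> T z) * (norm x)\<^sup>2 \<le> x \<bullet> T x"
    proof (cases "x = 0")
      case False
      then have "z \<bullet> T z \<le> (x /\<^sub>R norm x) \<bullet> T (x /\<^sub>R norm x)" by (intro z) auto
      also have "\<dots> = (x \<bullet> T x) / (norm x)\<^sup>2"
        by (simp add: linear_cmul[OF lin] power2_eq_square divide_simps)
      finally show ?thesis using False by (simp add: divide_simps)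
    qed simp
  qed
qed

lemma form_nonneg: "x \<bullet> T x \<ge> 0"
  using pos[of x] by (cases "x = 0") auto

text \<open>If the form is at least \<open>c * (norm x)\<^sup>2\<close>, the weight decays at rate c
  / 2. Half of this rate absorbs the polynomial and the other half remains integrable.\<close>

lemma integrable_weight_mult:
  fixes f :: "'a \<Rightarrow> real"
  assumes [measurable]: "f \<in> borel_measurable borel"
    and f: "\<And>x. \<bar>f x\<bar> \<le> C * (1 + (norm x)\<^sup>2)\<^sup>2"
  shows "integrable lborel (\<lambda>x. f x * weight x)"
proof -
  obtain c where c: "c > 0" "\<And>x. c * (norm x)\<^sup>2 \<le> x \<bullet> T x"
    using coercive by blast
  obtain K where K: "\<And>s. s \<ge> 0 \<Longrightarrow> (1 + s)\<^sup>2 \<le> K * exp (c / 4 * s)"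
    using square_one_plus_le_exp[of "c / 4"] c(1) by auto
  show ?thesis
  proof (rule Bochner_Integration.integrable_bound)
    show "integrable lborel (\<lambda>x::'a. \<bar>C\<bar> * K * exp (- (c / 4) * (norm x)\<^sup>2))"
      using c by (intro integrable_mult_right integrable_exp_neg_norm_square) auto
    show "AE x in lborel. norm (f x * weight x) \<le> norm (\<bar>C\<bar> * K * exp (- (c / 4) * (norm x)\<^sup>2))"
    proof (rule AE_I2)
      fix x :: 'a
      have "\<bar>f x\<bar> \<le> \<bar>C\<bar> * (1 + (norm x)\<^sup>2)\<^sup>2"
        by (rule order.trans[OF f]) (intro mult_right_mono; simp)
      also have "\<dots> \<le> \<bar>C\<bar> * (K * exp (c / 4 * (norm x)\<^sup>2))" by (intro mult_left_mono K) auto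
      finally have 1: "\<bar>f x\<bar> \<le> \<bar>C\<bar> * (K * exp (c / 4 * (norm x)\<^sup>2))" .
      have 2: "weight x \<le> exp (- (c / 2) * (norm x)\<^sup>2)" using c(2)[of x] by (simp add: weight_def)
      have "\<bar>f x\<bar> * weight x \<le> \<bar>C\<bar> * (K * exp (c / 4 * (norm x)\<^sup>2)) * exp (- (c / 2) * (norm x)\<^sup>2)"
        using 1 2 weight_pos[of x] by (intro mult_mono) auto
      also have "\<dots> = \<bar>C\<bar> * K * exp (- (c / 4) * (norm x)\<^sup>2)" by (simp add: mult.assoc flip: exp_add)
      finally show "norm (f x * weight x) \<le> norm (\<bar>C\<bar> * K * exp (- (c / 4) * (norm x)\<^sup>2))"
        using weight_pos[of x] abs_ge_self[of "\<bar>C\<bar> * K * exp (- (c / 4) * (norm x)\<^sup>2)"]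
        unfolding real_norm_def abs_mult[of "f x"] abs_of_pos[OF weight_pos] by linarith
    qed
  qed measurable
qed

lemma integrable_weight: "integrable lborel weight"
  using integrable_weight_mult[of "\<lambda>_. 1" 1] by (simp add: power2_eq_square algebra_simps add_nonneg_nonneg)

definition mass :: real where "mass = (\<integral>x. weight x \<partial>lborel)"

lemma mass_pos: "mass > 0"
proof -
  have "mass \<noteq> 0"
  proof
    assume "mass = 0"
    then have "AE x in lborel. weight x = 0"
      using integral_nonneg_eq_0_iff_AE[OF integrable_weight] weight_pos
      by (auto simp: mass_def less_imp_le)
    then have "AE x in (lborel :: 'a measure). False"
      by (rule AE_mp) (use weight_pos in \<open>auto simp: less_le\<close>)
    then show False by (simp add: eventually_False ae_filter_eq_bot_iff)
  qed
  moreover have "mass \<ge> 0"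
    unfolding mass_def by (intro Bochner_Integration.integral_nonneg) (auto simp: weight_pos less_imp_le)
  ultimately show ?thesis by simp
qed

text \<open>The derivative of \<open>g x * weight x\<close> along v is
  \<open>(g' x - g x * (T x \<bullet> v)) * weight x\<close>, and its integral vanishes by
  \<open>integral_derivative_eq_0\<close>. The growth conditions keep both terms below degree
  four.\<close>

lemma stein:
  fixes g g' :: "'a \<Rightarrow> real"
  assumes g: "continuous_on UNIV g" "\<And>x. \<bar>g x\<bar> \<le> C * (1 + (norm x)\<^sup>2)"
    and g': "continuous_on UNIV g'" "\<And>x. \<bar>g' x\<bar> \<le> C * (1 + (norm x)\<^sup>2)\<^sup>2"
    and deriv: "\<And>x s. ((\<lambda>s. g (x + s *\<^sub>R v)) has_real_derivative g' (x + s *\<^sub>R v)) (at s)"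
  shows "integrable lborel (\<lambda>x. g x * (T x \<bullet> v) * weight x)"
    and "integrable lborel (\<lambda>x. g' x * weight x)"
    and "(\<integral>x. g x * (T x \<bullet> v) * weight x \<partial>lborel) = (\<integral>x. g' x * weight x \<partial>lborel)"
proof -
  have [measurable]: "g \<in> borel_measurable borel" "g' \<in> borel_measurable borel"
    using g(1) g'(1) by (auto intro: borel_measurable_continuous_onI)
  have C: "C \<ge> 0" using order.trans[OF abs_ge_zero g(2)[of 0]] by simp
  have Tv: "\<bar>T x \<bullet> v\<bar> \<le> norm (T v) * (1 + (norm x)\<^sup>2)" for x
    unfolding selfadj by (rule abs_inner_le)
  show 1: "integrable lborel (\<lambda>x. g x * (T x \<bullet> v) * weight x)"
  proof (rule integrable_weight_mult)
    fix x
    have "\<bar>g x * (T x \<bullet> v)\<bar> \<le> (C * (1 + (norm x)\<^sup>2)) * (norm (T v) * (1 + (norm x)\<^sup>2))"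
      unfolding abs_mult by (intro mult_mono g Tv) (auto simp: C)
    then show "\<bar>g x * (T x \<bullet> v)\<bar> \<le> (C * norm (T v)) * (1 + (norm x)\<^sup>2)\<^sup>2"
      by (simp add: power2_eq_square mult_ac)
  qed measurable
  show 2: "integrable lborel (\<lambda>x. g' x * weight x)"
    by (rule integrable_weight_mult[OF _ g'(2)]) measurable
  have 3: "integrable lborel (\<lambda>x. g x * weight x)"
  proof (rule integrable_weight_mult)
    fix x
    have "\<bar>g x\<bar> \<le> C * (1 + (norm x)\<^sup>2) * 1" using g(2) by simp
    also have "\<dots> \<le> C * (1 + (norm x)\<^sup>2) * (1 + (norm x)\<^sup>2)"
      using C by (intro mult_left_mono) auto
    finally show "\<bar>g x\<bar> \<le> C * (1 + (norm x)\<^sup>2)\<^sup>2" by (simp add: power2_eq_square mult_ac)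
  qed measurable
  have "(\<integral>x. g' x * weight x - g x * (T x \<bullet> v) * weight x \<partial>lborel) = 0"
  proof (rule integral_derivative_eq_0[where v = v])
    show "integrable lborel (\<lambda>x. g x * weight x)" by fact
    show "integrable lborel (\<lambda>x. g' x * weight x - g x * (T x \<bullet> v) * weight x)"
      using 1 2 by auto
    show "continuous_on UNIV (\<lambda>x. g' x * weight x - g x * (T x \<bullet> v) * weight x)"
      using g(1) g'(1) by (intro continuous_intros)
    fix x s
    have eq: "(x + s *\<^sub>R v) \<bullet> T (x + s *\<^sub>R v) = x \<bullet> T x + 2 * s * (T x \<bullet> v) + s\<^sup>2 * (T v \<bullet> v)" for s
      using selfadj[of x v]
      by (simp add: linear_add[OF lin] linear_cmul[OF lin] algebra_simps inner_commute power2_eq_square)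
    have "((\<lambda>s. exp (- (x \<bullet> T x + 2 * s * (T x \<bullet> v) + s\<^sup>2 * (T v \<bullet> v)) / 2))
        has_real_derivative - (T (x + s *\<^sub>R v) \<bullet> v) * weight (x + s *\<^sub>R v)) (at s)"
    proof -
      have "((\<lambda>s. - (x \<bullet> T x + 2 * s * (T x \<bullet> v) + s\<^sup>2 * (T v \<bullet> v)) / 2)
          has_real_derivative - (T (x + s *\<^sub>R v) \<bullet> v)) (at s)"
        by (auto intro!: derivative_eq_intros
            simp: linear_add[OF lin] linear_cmul[OF lin] inner_add_left field_simps)
      from DERIV_fun_exp[OF this] show ?thesis
        unfolding weight_def eq by (simp add: mult.commute)
    qed
    then have "((\<lambda>s. weight (x + s *\<^sub>R v)) has_real_derivative
        - (T (x + s *\<^sub>R v) \<bullet> v) * weight (x + s *\<^sub>R v)) (at s)"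
      by (simp add: weight_def eq)
    from DERIV_mult[OF deriv this] show "((\<lambda>s. g (x + s *\<^sub>R v) * weight (x + s *\<^sub>R v)) has_real_derivative
        g' (x + s *\<^sub>R v) * weight (x + s *\<^sub>R v) -
          g (x + s *\<^sub>R v) * (T (x + s *\<^sub>R v) \<bullet> v) * weight (x + s *\<^sub>R v)) (at s)"
      by (rule DERIV_cong) (simp add: algebra_simps)
  qed
  with 1 2 show "(\<integral>x. g x * (T x \<bullet> v) * weight x \<partial>lborel) = (\<integral>x. g' x * weight x \<partial>lborel)"
    by simp
qed

text \<open>Stein's identity for the linear function \<open>x \<bullet> u\<close>, whose derivative
  is constant. The second factor \<open>x \<bullet> T v\<close> expresses that the covariance is the
  inverse of T without naming the inverse.\<close>

lemma
  shows integrable_second_moment: "integrable lborel (\<lambda>x. (x \<bullet> u) * (x \<bullet> T v) * weight x)"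
    and second_moment: "(\<integral>x. (x \<bullet> u) * (x \<bullet> T v) * weight x \<partial>lborel) = (u \<bullet> v) * mass"
proof -
  have b: "\<bar>u \<bullet> v\<bar> \<le> (norm u + \<bar>u \<bullet> v\<bar>) * (1 + (norm x)\<^sup>2)\<^sup>2" for x :: 'a
    using mult_mono[of "\<bar>u \<bullet> v\<bar>" "norm u + \<bar>u \<bullet> v\<bar>" 1 "(1 + (norm x)\<^sup>2)\<^sup>2"]
    by (simp add: one_le_power)
  have a: "\<bar>x \<bullet> u\<bar> \<le> (norm u + \<bar>u \<bullet> v\<bar>) * (1 + (norm x)\<^sup>2)" for x
    by (rule order.trans[OF abs_inner_le]) (intro mult_right_mono; simp)
  have d: "((\<lambda>s. (x + s *\<^sub>R v) \<bullet> u) has_real_derivative u \<bullet> v) (at s)" for x s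
    by (auto simp: inner_add_left inner_commute[of v] intro!: derivative_eq_intros)
  have "integrable lborel (\<lambda>x. (x \<bullet> u) * (T x \<bullet> v) * weight x)"
    "(\<integral>x. (x \<bullet> u) * (T x \<bullet> v) * weight x \<partial>lborel) = (\<integral>x. (u \<bullet> v) * weight x \<partial>lborel)"
    by (rule stein[where g="\<lambda>x. x \<bullet> u" and g'="\<lambda>_. u \<bullet> v", OF _ a _ b d];
      intro continuous_intros)+
  then show "integrable lborel (\<lambda>x. (x \<bullet> u) * (x \<bullet> T v) * weight x)"
    "(\<integral>x. (x \<bullet> u) * (x \<bullet> T v) * weight x \<partial>lborel) = (u \<bullet> v) * mass"
    by (auto simp: selfadj mass_def)
qed

end

section \<open>The chi-square distribution\<close>

lemma measurable_chi_square_density [measurable]: "chi_square_density k \<in> borel_measurable borel"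
  unfolding chi_square_density_def[abs_def] by measurable

lemma chi_square_density_nonneg: "chi_square_density k x \<ge> 0"
  by (cases "k = 0") (auto simp: chi_square_density_def Gamma_real_pos intro!: divide_nonneg_pos)

lemma sets_chi_square [simp, measurable_cong]: "sets (chi_square k) = sets borel"
  by (simp add: chi_square_def)

lemma space_chi_square [simp]: "space (chi_square k) = UNIV"
  by (simp add: chi_square_def)

text \<open>The substitution t = x / 2 turns Euler's integral for \<open>Gamma (k / 2)\<close> into
  the total mass of the density.\<close>

lemma real_distribution_chi_square:
  assumes "k > 0"
  shows "real_distribution (chi_square k)"
proof -
  define s where "s = real k / 2"
  have s: "s > 0" using assms by (simp add: s_def)
  have Z: "2 powr s * Gamma s > 0" using s by (simp add: Gamma_real_pos)
  let ?f = "\<lambda>t. indicator {0..} t * t powr (s - 1) / exp t"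
  have "ennreal (Gamma s) = (\<integral>\<^sup>+t. ennreal (?f t) \<partial>lborel)"
    by (rule Gamma_conv_nn_integral_real[OF s])
  also have "\<dots> = ennreal \<bar>1 / 2\<bar> * (\<integral>\<^sup>+x. ennreal (?f (0 + 1/2 * x)) \<partial>lborel)"
    by (rule nn_integral_real_affine) auto
  also have "\<dots> = (\<integral>\<^sup>+x. ennreal \<bar>1 / 2\<bar> * ennreal (?f (0 + 1/2 * x)) \<partial>lborel)"
    by (rule nn_integral_cmult[symmetric]) auto
  also have "\<dots> = (\<integral>\<^sup>+x. ennreal (Gamma s) * ennreal (chi_square_density k x) \<partial>lborel)"
  proof (rule nn_integral_cong)
    fix x :: real
    have "\<bar>1 / 2\<bar> * ?f (0 + 1/2 * x) = Gamma s * chi_square_density k x"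
    proof (cases "x > 0")
      case True
      have "(x / 2) powr (s - 1) = x powr (s - 1) * 2 / 2 powr s"
        using True by (simp add: powr_divide powr_diff)
      then show ?thesis
        using True Gamma_real_pos[OF s] by (simp add: chi_square_density_def s_def[symmetric] exp_minus field_simps)
    qed (auto simp: chi_square_density_def indicator_def)
    then show "ennreal \<bar>1 / 2\<bar> * ennreal (?f (0 + 1/2 * x)) =
        ennreal (Gamma s) * ennreal (chi_square_density k x)"
      using chi_square_density_nonneg[of k x] Gamma_real_pos[OF s]
      by (subst (1 2) ennreal_mult[symmetric]) auto
  qed
  also have "\<dots> = ennreal (Gamma s) * emeasure (chi_square k) UNIV"
    by (simp add: chi_square_def emeasure_density nn_integral_cmult)
  finally have "ennreal (Gamma s) * emeasure (chi_square k) UNIV = ennreal (Gamma s) * 1" by simp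
  then have "emeasure (chi_square k) (space (chi_square k)) = 1"
    using Gamma_real_pos[OF s] by (subst (asm) ennreal_mult_cancel_left) auto
  then interpret prob_space "chi_square k" by (rule prob_spaceI)
  show ?thesis by unfold_locales simp_all
qed

lemma isCont_cdf_chi_square:
  assumes "k > 0"
  shows "isCont (cdf (chi_square k)) x"
proof -
  interpret real_distribution "chi_square k"
    by (rule real_distribution_chi_square[OF assms])
  have "emeasure (chi_square k) {x} = 0"
    by (simp add: chi_square_def emeasure_density nn_integral_cmult_indicator mult.commute)
  then show ?thesis by (simp add: isCont_cdf measure_def)
qed

text \<open>Continuity makes the set under the infimum closed, so the value at the infimum is at
  least p. A point with value exactly p, from the intermediate value theorem, bounds it from
  above.\<close>

lemma cdf_quantile:
  assumes "real_distribution M" "\<And>x. isCont (cdf M) x" "0 < p" "p < 1"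
  shows "cdf M (quantile M p) = p"
proof -
  interpret real_distribution M by fact
  have "eventually (\<lambda>x. cdf M x > p) at_top"
    using order_tendstoD(1)[OF cdf_lim_at_top_prob \<open>p < 1\<close>] .
  then obtain b where b: "cdf M b > p"
    by (metis eventually_at_top_linorder order_refl)
  have "eventually (\<lambda>x. cdf M x < p) at_bot" using order_tendstoD(2)[OF cdf_lim_at_bot \<open>0 < p\<close>] .
  then obtain a where a: "cdf M a < p"
    by (metis eventually_at_bot_linorder order_refl)
  have ab: "a \<le> b" using a b cdf_nondecreasing[of b a] by linarith
  define S where "S = {x. p \<le> cdf M x}"
  have "continuous_on UNIV (cdf M)" using assms(2) by (simp add: continuous_at_imp_continuous_on)
  then have "closed S"
    unfolding S_def by (intro closed_Collect_le continuous_intros)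
  have bdd: "bdd_below S"
  proof (rule bdd_belowI)
    fix x assume "x \<in> S"
    then show "a \<le> x" using a cdf_nondecreasing[of x a] by (force simp: S_def)
  qed
  have "S \<noteq> {}" using b by (auto simp: S_def intro: less_imp_le)
  then have 1: "p \<le> cdf M (Inf S)"
    using closed_contains_Inf[OF _ bdd \<open>closed S\<close>] by (auto simp: S_def)
  obtain x where x: "cdf M x = p"
    using IVT[of "cdf M" a p b] a b ab assms(2) by (auto simp: less_imp_le)
  then have "Inf S \<le> x" by (intro cInf_lower bdd) (simp add: S_def)
  then have "cdf M (Inf S) \<le> p" using cdf_nondecreasing x by metis
  with 1 show ?thesis
    by (simp add: quantile_def S_def)
qed

section \<open>The law of a positive form under its Gaussian weight\<close>

context positive_form
begin

lemma measurable_form [measurable]: "(\<lambda>x. x \<bullet> T x) \<in> borel_measurable borel"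
  by (intro borel_measurable_continuous_onI continuous_intros)

text \<open>The volume of the unit ellipsoid of T. It stays a symbol until
  \<open>chi_square_level\<close>, where the comparison of total masses eliminates it.\<close>

definition level_volume :: ennreal where
  "level_volume = emeasure lborel {x. x \<bullet> T x \<le> 1}"

lemma level_volume_finite: "level_volume < \<infinity>"
proof -
  obtain c where c: "c > 0" "\<And>x. c * (norm x)\<^sup>2 \<le> x \<bullet> T x"
    using coercive by blast
  have "norm x \<le> sqrt (1 / c)" if "x \<bullet> T x \<le> 1" for x
    using c(2)[of x] that c(1) by (intro real_le_rsqrt) (simp add: field_simps)
  then have "bounded {x. x \<bullet> T x \<le> 1}" by (auto simp: bounded_iff)
  then show ?thesis unfolding level_volume_def using emeasure_bounded_finite by auto
qed

text \<open>Scaling by \<open>sqrt r\<close> maps the unit ellipsoid onto the level set and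
  multiplies volumes by \<open>r powr (DIM('a) / 2)\<close>. For \<open>r \<le> 0\<close> at most
  the origin remains.\<close>

lemma emeasure_level_set:
  "emeasure lborel {x. x \<bullet> T x \<le> r} =
    level_volume * ennreal (if r \<le> 0 then 0 else r powr (DIM('a) / 2))"
proof (cases "r \<le> 0")
  case True
  then have "{x. x \<bullet> T x \<le> r} \<subseteq> {0}" using pos form_nonneg by (force simp: not_less)
  then have "emeasure lborel {x. x \<bullet> T x \<le> r} \<le> emeasure lborel {0::'a}"
    by (intro emeasure_mono) auto
  with True show ?thesis by simp
next
  case False
  define c where "c = sqrt r"
  have c: "c > 0" "c\<^sup>2 = r" using False by (auto simp: c_def)
  let ?S = "{x. x \<bullet> T x \<le> r}"
  have "emeasure lborel ?S =
      emeasure (density (distr lborel borel (\<lambda>x. 0 + c *\<^sub>R x)) (\<lambda>_. ennreal (\<bar>c\<bar> ^ DIM('a)))) ?S"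
    using lborel_affine[of c "0::'a"] c by simp
  also have "\<dots> = ennreal (\<bar>c\<bar> ^ DIM('a)) * emeasure lborel ((\<lambda>x. 0 + c *\<^sub>R x) -` ?S \<inter> space lborel)"
    by (subst emeasure_density) (auto simp: nn_integral_cmult_indicator emeasure_distr)
  also have "(\<lambda>x. 0 + c *\<^sub>R x) -` ?S \<inter> space lborel = {x. x \<bullet> T x \<le> 1}"
    using c False by (auto simp: linear_cmul[OF lin] power2_eq_square[symmetric] mult.assoc[symmetric])
  also have "\<bar>c\<bar> ^ DIM('a) = r powr (DIM('a) / 2)"
  proof -
    have "\<bar>c\<bar> ^ DIM('a) = (r powr (1/2)) powr real DIM('a)"
      using c(1) False by (simp add: powr_realpow powr_half_sqrt flip: c_def)
    then show ?thesis by (simp add: powr_powr)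
  qed
  finally show ?thesis
    using False by (simp add: level_volume_def mult.commute)
qed

text \<open>The density is the derivative of the volume of the level sets, and the two measures are
  compared on half-lines. This takes the place of polar coordinates.\<close>

lemma distr_form:
  "distr lborel borel (\<lambda>x. x \<bullet> T x) = density lborel
    (\<lambda>t. level_volume * ennreal (DIM('a) / 2 * t powr (DIM('a) / 2 - 1)) * indicator {0<..} t)"
    (is "?M = ?N")
proof (rule measure_eqI_generator_eq)
  let ?E = "range (\<lambda>a::real. {..a})"
  show "Int_stable ?E" by (auto simp: Int_stable_def)
  show "?E \<subseteq> Pow UNIV" by auto
  show "sets ?M = sigma_sets UNIV ?E" "sets ?N = sigma_sets UNIV ?E"
    by (simp_all add: borel_eq_atMost)
  show "range (\<lambda>n. {..real n}) \<subseteq> ?E" by auto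
  show "(\<Union>n. {..real n}) = UNIV" using real_arch_simple by auto
  have M: "emeasure ?M {..r} = level_volume * ennreal (if r \<le> 0 then 0 else r powr (DIM('a) / 2))" for r
    by (simp add: emeasure_distr emeasure_level_set[symmetric] vimage_def)
  show "emeasure ?M {..real n} \<noteq> \<infinity>" for n
    unfolding M using level_volume_finite by (auto simp: ennreal_mult_eq_top_iff)
  fix X assume "X \<in> ?E"
  then obtain r where X: "X = {..r}" by auto
  show "emeasure ?M X = emeasure ?N X"
  proof (cases "r \<le> 0")
    case True
    have "emeasure ?N X = (\<integral>\<^sup>+(t::real). 0 \<partial>lborel)"
      unfolding X
    proof (subst emeasure_density, measurable, rule nn_integral_cong)
      fix t :: real
      show "level_volume * ennreal (DIM('a) / 2 * t powr (DIM('a) / 2 - 1)) *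
          indicator {0<..} t * indicator {..r} t = 0"
        using True by (cases "0 < t") auto
    qed
    with True show ?thesis unfolding X M by simp
  next
    case False
    let ?d = "real DIM('a)"
    have d: "?d > 0" by simp
    have "((\<lambda>t. ?d / 2 * t powr (?d / 2 - 1)) has_integral
        ?d / 2 * (r powr (?d / 2 - 1 + 1) / (?d / 2 - 1 + 1))) {0..r}"
      using False d by (intro has_integral_mult_right has_integral_powr_from_0) auto
    then have I: "((\<lambda>t. ?d / 2 * t powr (?d / 2 - 1)) has_integral r powr (?d / 2)) {0..r}"
      using d by simp
    have "emeasure ?N X = (\<integral>\<^sup>+t. level_volume *
        (ennreal (?d / 2 * t powr (?d / 2 - 1)) * indicator {0..r} t) \<partial>lborel)"
      unfolding X
    proof (subst emeasure_density, measurable, rule nn_integral_cong_AE)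
      \<comment> \<open>The indicators of \<open>{0<..}\<close> and \<open>{0..r}\<close> disagree
        at 0, a null set.\<close>
      have "AE t in lborel. t \<noteq> (0::real)" by (rule AE_lborel_singleton)
      then show "AE t in lborel. level_volume * ennreal (?d / 2 * t powr (?d / 2 - 1)) *
          indicator {0<..} t * indicator {..r} t =
          level_volume * (ennreal (?d / 2 * t powr (?d / 2 - 1)) * indicator {0..r} t)"
        by eventually_elim (auto simp: indicator_def)
    qed
    also have "\<dots> = level_volume * ennreal (r powr (?d / 2))" by (subst nn_integral_cmult)
        (use nn_integral_has_integral_lebesgue'[OF _ I] in \<open>auto\<close>)
    finally show ?thesis
      unfolding X M using False by simp
  qed
qed

text \<open>The quotient of the image density times \<open>exp (- t / 2)\<close> by the chi-square
  density; it turns out to be the total mass of the weight.\<close>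

definition chi_factor :: ennreal where
  "chi_factor = level_volume * ennreal (DIM('a) / 2 * (2 powr (DIM('a) / 2) * Gamma (DIM('a) / 2)))"

lemma nn_integral_weight_form:
  fixes r :: real
  assumes [measurable]: "B \<in> sets borel"
  shows "(\<integral>\<^sup>+x. indicator B (x \<bullet> T x) * ennreal (weight x) \<partial>lborel) =
    chi_factor * emeasure (chi_square DIM('a)) B"
proof -
  let ?d = "real DIM('a)"
  let ?z = "2 powr (?d / 2) * Gamma (?d / 2)"
  have Z: "?z > 0" by (simp add: Gamma_real_pos)
  have "(\<integral>\<^sup>+x. indicator B (x \<bullet> T x) * ennreal (weight x) \<partial>lborel) =
      (\<integral>\<^sup>+t. indicator B t * ennreal (exp (- t / 2)) \<partial>distr lborel borel (\<lambda>x. x \<bullet> T x))"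
    by (subst nn_integral_distr) (auto simp: weight_def)
  also have "\<dots> = (\<integral>\<^sup>+t. chi_factor * (ennreal (chi_square_density DIM('a) t) * indicator B t) \<partial>lborel)"
    unfolding distr_form
  proof (subst nn_integral_density, measurable, rule nn_integral_cong)
    fix t :: real
    have "Gamma (?d / 2) \<noteq> 0" by (intro order.strict_implies_not_eq[symmetric] Gamma_real_pos) simp
    then have eq: "?d / 2 * t powr (?d / 2 - 1) * exp (- t / 2) =
        (?d / 2 * ?z) * chi_square_density DIM('a) t" if "t > 0"
      using that by (simp add: chi_square_density_def)
    show "level_volume * ennreal (?d / 2 * t powr (?d / 2 - 1)) * indicator {0<..} t *
        (indicator B t * ennreal (exp (- t / 2))) =
        chi_factor * (ennreal (chi_square_density DIM('a) t) * indicator B t)"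
    proof (cases "t > 0")
      case True
      have "ennreal (?d / 2 * t powr (?d / 2 - 1)) * ennreal (exp (- t / 2)) =
          ennreal (?d / 2 * ?z) * ennreal (chi_square_density DIM('a) t)"
        using chi_square_density_nonneg[of "DIM('a)" t] Gamma_real_pos[of "?d / 2"]
        by (subst (1 2) ennreal_mult[symmetric]) (use eq[OF True] in simp_all)
      with True show ?thesis
        by (simp add: chi_factor_def mult_ac)
    qed (simp add: chi_square_density_def)
  qed
  also have "\<dots> = chi_factor * emeasure (chi_square DIM('a)) B"
    by (subst nn_integral_cmult) (auto simp: chi_square_def emeasure_density)
  finally show ?thesis .
qed

text \<open>Taking \<open>B = UNIV\<close> in \<open>nn_integral_weight_form\<close> identifies
  \<open>chi_factor\<close> with \<open>mass\<close>.\<close>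

lemma chi_square_level:
  "(\<integral>\<^sup>+x. indicator {x. x \<bullet> T x \<le> r} x * ennreal (weight x) \<partial>lborel) =
    ennreal mass * ennreal (cdf (chi_square DIM('a)) r)"
proof -
  interpret real_distribution "chi_square DIM('a)"
    by (rule real_distribution_chi_square) simp
  have "ennreal mass = (\<integral>\<^sup>+x. ennreal (weight x) \<partial>lborel)"
    unfolding mass_def by (rule nn_integral_eq_integral[symmetric, OF integrable_weight])
      (simp add: weight_pos less_imp_le)
  also have "\<dots> = chi_factor" using nn_integral_weight_form[of UNIV] emeasure_space_1 by simp
  finally have m: "chi_factor = ennreal mass" ..
  have "(\<integral>\<^sup>+x. indicator {x. x \<bullet> T x \<le> r} x * ennreal (weight x) \<partial>lborel) =
      (\<integral>\<^sup>+x. indicator {..r} (x \<bullet> T x) * ennreal (weight x) \<partial>lborel)"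
    by (intro nn_integral_cong) (simp add: indicator_def)
  also have "\<dots> = chi_factor * emeasure (chi_square DIM('a)) {..r}"
    by (rule nn_integral_weight_form) simp
  finally show ?thesis by (simp add: m cdf_def2 emeasure_eq_measure)
qed

end

section \<open>The mean of the inverse Wishart distribution\<close>

lemma positive_form_matrix:
  assumes "pos_def P"
  shows "positive_form ((*v) P)"
  using assms by (intro positive_form.intro matrix_vector_mul_linear)
    (simp_all add: inner_matrix_vector_mult pos_def_def)

text \<open>Normalization of \<open>mvn_density\<close> is an assumption here because the model
  supplies it: there the function is the density of a random vector, see
  \<open>gaussianI\<close>.\<close>

locale gaussian =
  fixes S :: "real^'n^'n"
  assumes pos_def: "pos_def S"
    and prob_density: "prob_space (density lborel (\<lambda>x. ennreal (mvn_density 0 S x)))"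
begin

abbreviation R :: "real^'n^'n" where "R \<equiv> matrix_inv S"

sublocale positive_form "(*v) R"
  by (rule positive_form_matrix[OF pos_def_matrix_inv[OF pos_def]])

definition law :: "(real^'n) measure" where
  "law = density lborel (\<lambda>x. ennreal (mvn_density 0 S x))"

sublocale law: prob_space law
  unfolding law_def by (rule prob_density)

lemma sets_law [simp, measurable_cong]: "sets law = sets borel"
  by (simp add: law_def)

lemma space_law [simp]: "space law = UNIV"
  by (simp add: law_def)

text \<open>Both sides are multiples of \<open>weight\<close> with total mass 1. The factor K is
  positive, since otherwise \<open>ennreal\<close> would truncate the density to 0 and the law would
  have mass 0.\<close>

lemma mvn_density_eq: "mvn_density 0 S x = weight x / mass"
proof -
  define K where "K = 1 / sqrt ((2 * pi) ^ CARD('n) * det S)"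
  have K: "mvn_density 0 S x = K * weight x" for x by (simp add: mvn_density_def weight_def K_def)
  have [simp]: "K > 0"
  proof (rule ccontr)
    assume "\<not> K > 0"
    then have "ennreal (mvn_density 0 S x) = 0" for x
      using weight_pos[of x] by (auto simp: K ennreal_eq_0_iff mult_nonpos_nonneg)
    then show False using law.emeasure_space_1 by (simp add: law_def emeasure_density)
  qed
  have "1 = (\<integral>\<^sup>+x. ennreal (K * weight x) \<partial>lborel)"
    using law.emeasure_space_1 by (simp add: law_def emeasure_density K)
  also have "\<dots> = ennreal (\<integral>x. K * weight x \<partial>lborel)"
    by (rule nn_integral_eq_integral) (auto intro: integrable_weight simp: weight_pos less_imp_le)
  also have "(\<integral>x. K * weight x \<partial>lborel) = K * mass" by (simp add: mass_def)
  finally have "K * mass = 1" by simp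
  then show ?thesis using mass_pos by (simp add: K field_simps)
qed

lemma law_eq: "law = density lborel (\<lambda>x. ennreal (weight x / mass))"
  by (simp add: law_def mvn_density_eq)

lemma weight_div_mass_nonneg: "weight x / mass \<ge> 0"
  using weight_pos[of x] mass_pos by simp

lemma integral_law:
  fixes f :: "real^'n \<Rightarrow> real"
  assumes [measurable]: "f \<in> borel_measurable borel"
  shows "(\<integral>x. f x \<partial>law) = (\<integral>x. f x * weight x \<partial>lborel) / mass"
proof -
  have "(\<integral>x. f x \<partial>law) = (\<integral>x. weight x / mass * f x \<partial>lborel)"
    unfolding law_eq by (subst integral_real_density) (auto simp: weight_div_mass_nonneg)
  also have "(\<lambda>x. weight x / mass * f x) = (\<lambda>x. (f x * weight x) / mass)"
    by (auto simp: mult.commute)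
  finally show ?thesis by simp
qed

lemma integrable_law_bound:
  fixes f :: "real^'n \<Rightarrow> real"
  assumes [measurable]: "f \<in> borel_measurable borel"
    and f: "\<And>x. \<bar>f x\<bar> \<le> C * (1 + (norm x)\<^sup>2)\<^sup>2"
  shows "integrable law f"
proof -
  have "integrable lborel (\<lambda>x. f x * weight x / mass)"
    by (intro integrable_divide integrable_weight_mult[OF assms])
  then show ?thesis
    unfolding law_eq by (subst integrable_real_density) (auto simp: weight_div_mass_nonneg mult.commute)
qed

lemma law_second_moment: "(\<integral>x. x $ i * x $ j \<partial>law) = S $ i $ j"
proof -
  have inv: "invertible S" by (rule pos_def_invertible[OF pos_def])
  have x: "x $ j = x \<bullet> (R *v (S *v axis j 1))" for x :: "real^'n"
    by (simp add: matrix_vector_mul_assoc matrix_inv_left inv inner_axis)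
  have "(\<integral>x. x $ i * x $ j \<partial>law) =
      (\<integral>x. (x \<bullet> axis i 1) * (x \<bullet> (R *v (S *v axis j 1))) * weight x \<partial>lborel) / mass"
    by (subst integral_law) (auto simp: x[symmetric] inner_axis)
  also have "\<dots> = axis i 1 \<bullet> (S *v axis j 1)" unfolding second_moment using mass_pos by simp
  also have "\<dots> = S $ i $ j" by (simp add: inner_axis' matrix_vector_mul_component inner_axis)
  finally show ?thesis .
qed

end

section \<open>Gram matrices and their regularized inverses\<close>

definition psd :: "real^'n^'n \<Rightarrow> bool" where
  "psd M \<longleftrightarrow> transpose M = M \<and> (\<forall>x. x \<bullet> (M *v x) \<ge> 0)"

definition gram :: "'i set \<Rightarrow> ('i \<Rightarrow> real^'n) \<Rightarrow> real^'n^'n" where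
  "gram I y = (\<Sum>i\<in>I. outer (y i) (y i))"

lemma sum_matrix_vector_mult: "(\<Sum>i\<in>I. f i) *v x = (\<Sum>i\<in>I. f i *v x)" for x :: "real^'n"
  by (rule bounded_bilinear.sum_left[OF bilinear_matrix_vector_mult])

lemma gram_inner: "u \<bullet> (gram I y *v v) = (\<Sum>i\<in>I. (y i \<bullet> u) * (y i \<bullet> v))"
  by (simp add: gram_def sum_matrix_vector_mult outer_matrix_vector_mult inner_sum_right
      inner_commute mult.commute)

lemma transpose_gram: "transpose (gram I y) = gram I y"
  by (simp add: gram_def linear_sum[OF linear_transpose] transpose_outer)

lemma psd_gram: "psd (gram I y)"
  by (auto simp: psd_def transpose_gram gram_inner intro: sum_nonneg)

lemma measurable_gram [measurable (raw)]:
  assumes "\<And>i. i \<in> I \<Longrightarrow> (\<lambda>x. f x i) \<in> borel_measurable M"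
  shows "(\<lambda>x. gram I (f x)) \<in> borel_measurable M"
  unfolding gram_def by (intro borel_measurable_sum borel_measurable_outer assms)

text \<open>For t > 0 a genuine inverse at every positive semidefinite M, of operator norm at most 1
  / t. Hence it is smooth in each row of a Gram matrix, also where the Gram matrix is
  singular.\<close>

definition ridge_inv :: "real \<Rightarrow> real^'n^'n \<Rightarrow> real^'n^'n" where
  "ridge_inv t M = matrix_inv (M + t *\<^sub>R mat 1)"

lemma scaleR_mat_vector_mult: "(t *\<^sub>R mat 1) *v x = t *\<^sub>R (x :: real^'n)"
  by (simp flip: scaleR_matrix_vector_assoc)

context
  fixes M :: "real^'n^'n" and t :: real
  assumes M: "psd M" and t: "t > 0"
begin

lemma ridge_pos_def: "pos_def (M + t *\<^sub>R mat 1)"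
proof -
  have "transpose (M + t *\<^sub>R mat 1) = M + t *\<^sub>R mat 1"
    using M by (simp add: psd_def linear_add[OF linear_transpose] transpose_scalar transpose_mat)
  moreover have "x \<bullet> ((M + t *\<^sub>R mat 1) *v x) > 0" if "x \<noteq> 0" for x
    using M t that by (auto simp: psd_def matrix_vector_mult_add_rdistrib scaleR_mat_vector_mult
        inner_add_right intro!: add_nonneg_pos)
  ultimately show ?thesis by (simp add: pos_def_def)
qed

text \<open>The substitute for \<open>M ** matrix_inv M = mat 1\<close>. Its correction carries the
  factor t and is the source of the error terms in \<open>ridge_identity\<close>.\<close>

lemma ridge_inv_apply: "M *v (ridge_inv t M *v x) = x - t *\<^sub>R (ridge_inv t M *v x)"
proof -
  have "(M + t *\<^sub>R mat 1) *v (ridge_inv t M *v x) = x" unfolding ridge_inv_def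
    by (simp add: matrix_vector_mul_assoc matrix_inv_right pos_def_invertible ridge_pos_def)
  then show ?thesis
    by (simp add: matrix_vector_mult_add_rdistrib scaleR_mat_vector_mult algebra_simps)
qed

lemma pos_def_ridge_inv: "pos_def (ridge_inv t M)"
  unfolding ridge_inv_def by (rule pos_def_matrix_inv[OF ridge_pos_def])

lemma ridge_inv_selfadj: "(ridge_inv t M *v x) \<bullet> y = x \<bullet> (ridge_inv t M *v y)"
  using pos_def_ridge_inv by (simp add: inner_matrix_vector_mult pos_def_def)

lemma ridge_inv_nonneg: "x \<bullet> (ridge_inv t M *v x) \<ge> 0"
  using pos_def_ridge_inv unfolding pos_def_def by (cases "x = 0") (auto intro: less_imp_le)

text \<open>With z the image of x, pair \<open>x = M *v z + t *\<^sub>R z\<close> with z: the two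
  sides differ by the nonnegative \<open>z \<bullet> (M *v z)\<close>.\<close>

lemma ridge_inv_square_le: "t * (norm (ridge_inv t M *v x))\<^sup>2 \<le> x \<bullet> (ridge_inv t M *v x)"
proof -
  let ?z = "ridge_inv t M *v x"
  have "x = M *v ?z + t *\<^sub>R ?z" by (simp add: ridge_inv_apply)
  then have "x \<bullet> ?z = (M *v ?z + t *\<^sub>R ?z) \<bullet> ?z" by (rule arg_cong)
  also have "\<dots> = ?z \<bullet> (M *v ?z) + t * (norm ?z)\<^sup>2"
    by (simp add: inner_add_left inner_add_right power2_norm_eq_inner inner_commute)
  finally show ?thesis using M by (simp add: psd_def)
qed

lemma norm_ridge_inv_le: "norm (ridge_inv t M *v x) \<le> norm x / t"
proof -
  let ?z = "ridge_inv t M *v x"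
  have "t * (norm ?z)\<^sup>2 \<le> norm x * norm ?z"
    using ridge_inv_square_le[of x] norm_cauchy_schwarz[of x ?z] by linarith
  then have "t * norm ?z \<le> norm x"
    by (cases "norm ?z = 0") (auto simp: power2_eq_square mult.assoc[symmetric])
  then show ?thesis using t by (simp add: field_simps)
qed

text \<open>With z the image of x and V the inverse of M, the difference of the two sides is
  \<open>t * (z \<bullet> z + t * (z \<bullet> (V *v z)))\<close>. This makes the limit for t to 0
  an upper bound of all regularized forms, as dominated convergence requires.\<close>

lemma ridge_inv_le_inv:
  assumes "invertible M"
  shows "x \<bullet> (ridge_inv t M *v x) \<le> x \<bullet> (matrix_inv M *v x)"
proof -
  let ?z = "ridge_inv t M *v x" and ?V = "matrix_inv M"
  have V: "M *v (?V *v u) = u" "?V *v (M *v u) = u" for u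
    by (simp_all add: matrix_vector_mul_assoc matrix_inv_left matrix_inv_right assms)
  have sym: "(M *v u) \<bullet> w = u \<bullet> (M *v w)" for u w
    using M by (simp add: inner_matrix_vector_mult psd_def)
  have pos: "u \<bullet> (?V *v u) \<ge> 0" for u
  proof -
    have "(?V *v u) \<bullet> (M *v (?V *v u)) \<ge> 0" using M by (simp add: psd_def)
    then show ?thesis by (simp add: V inner_commute)
  qed
  have x: "x = M *v ?z + t *\<^sub>R ?z" by (simp add: ridge_inv_apply)
  then have "?V *v x = ?V *v (M *v ?z + t *\<^sub>R ?z)" by (rule arg_cong)
  then have Vx: "?V *v x = ?z + t *\<^sub>R (?V *v ?z)"
    by (simp add: matrix_vector_right_distrib matrix_vector_mult_scaleR V)
  have "x \<bullet> (?V *v x) = x \<bullet> ?z + t * (x \<bullet> (?V *v ?z))" by (simp add: Vx inner_add_right)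
  also have "x \<bullet> (?V *v ?z) = (M *v ?z + t *\<^sub>R ?z) \<bullet> (?V *v ?z)" using x by (rule arg_cong)
  also have "\<dots> = ?z \<bullet> ?z + t * (?z \<bullet> (?V *v ?z))" by (simp add: inner_add_left sym V)
  finally show ?thesis using t pos[of ?z] by (simp add: add_nonneg_nonneg)
qed

text \<open>\<open>mat 1 \<bullet> W\<close> is the trace of W; the equation is the trace of
  \<open>W ** M = mat 1 - t *\<^sub>R W\<close>.\<close>

lemma ridge_inv_trace:
  "t * (mat 1 \<bullet> ridge_inv t M) = real CARD('n) - ridge_inv t M \<bullet> M"
proof -
  have "ridge_inv t M ** (M + t *\<^sub>R mat 1) = mat 1"
    unfolding ridge_inv_def by (rule matrix_inv_left[OF pos_def_invertible[OF ridge_pos_def]])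
  then have "ridge_inv t M ** M = mat 1 - t *\<^sub>R ridge_inv t M"
    by (simp add: matrix_mult_simps algebra_simps)
  moreover have "ridge_inv t M \<bullet> M = mat 1 \<bullet> (ridge_inv t M ** M)"
    using inner_matrix_mult_left[of "ridge_inv t M" "mat 1" M] pos_def_ridge_inv
    by (simp add: pos_def_def)
  moreover have "mat 1 \<bullet> (mat 1 :: real^'n^'n) = real CARD('n)"
    by (simp add: inner_vec_def mat_def if_distrib cong: if_cong)
  ultimately show ?thesis by (simp add: inner_diff_right)
qed

end

lemma mat_1_inner: "mat 1 \<bullet> (W :: real^'n^'n) = (\<Sum>j\<in>UNIV. W $ j $ j)"
  by (simp add: inner_vec_def mat_def if_distrib[where f="\<lambda>c. c * _"] cong: if_cong)

lemma axis_inner_mult: "axis i 1 \<bullet> (W *v axis j 1) = (W $ i $ j :: real)"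
  by (simp add: inner_axis' matrix_vector_mul_component inner_axis)

text \<open>If W is the inverse of \<open>M + outer y y + t *\<^sub>R mat 1\<close>, this is the
  derivative of \<open>u \<bullet> (W *v y)\<close> in y along u. The first term differentiates the
  argument y, the other two differentiate the inverse.\<close>

definition stein_deriv :: "real^'n^'n \<Rightarrow> real^'n \<Rightarrow> real^'n \<Rightarrow> real" where
  "stein_deriv W u y = u \<bullet> (W *v u) - (u \<bullet> (W *v y))\<^sup>2 - (y \<bullet> (W *v y)) * (u \<bullet> (W *v u))"

text \<open>The constant depends on u and t but not on M, because M will contain the other rows of
  the sample and the moving row itself. The uniformity comes from
  \<open>norm_ridge_inv_le\<close>.\<close>

lemma ridge_inv_bounds:
  fixes u :: "real^'n"
  assumes t: "t > 0"
  obtains C where "C \<ge> 0" "\<forall>M y. psd M \<longrightarrow> \<bar>u \<bullet> (ridge_inv t M *v y)\<bar> \<le> C * (1 + (norm y)\<^sup>2) \<and>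
    \<bar>stein_deriv (ridge_inv t M) u y\<bar> \<le> C * (1 + (norm y)\<^sup>2)\<^sup>2"
proof
  let ?a = "norm u / t" and ?b = "norm u * (norm u / t)"
  let ?C = "?a + (?b + 2 * (norm u / t)\<^sup>2)"
  show C: "?C \<ge> 0" using t by simp
  show "\<forall>M y. psd M \<longrightarrow> \<bar>u \<bullet> (ridge_inv t M *v y)\<bar> \<le> ?C * (1 + (norm y)\<^sup>2) \<and>
    \<bar>stein_deriv (ridge_inv t M) u y\<bar> \<le> ?C * (1 + (norm y)\<^sup>2)\<^sup>2"
  proof (intro allI impI conjI)
    fix M :: "real^'n^'n" and y :: "real^'n" assume M: "psd M"
    let ?W = "ridge_inv t M"
    have W: "\<bar>v \<bullet> (?W *v w)\<bar> \<le> norm v * (norm w / t)" for v w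
      by (rule order.trans[OF Cauchy_Schwarz_ineq2 mult_left_mono[OF norm_ridge_inv_le[OF M t]]]) simp
    have "\<bar>u \<bullet> (?W *v y)\<bar> \<le> ?a * norm y" using W[of u y] by simp
    also have "\<dots> \<le> ?C * (1 + (norm y)\<^sup>2)" using t by (intro mult_mono le_one_plus_square) auto
    finally show "\<bar>u \<bullet> (?W *v y)\<bar> \<le> ?C * (1 + (norm y)\<^sup>2)" .
    have 1: "\<bar>u \<bullet> (?W *v u)\<bar> \<le> ?b" by (rule W)
    have "(u \<bullet> (?W *v y))\<^sup>2 \<le> (norm u * (norm y / t))\<^sup>2"
      using power_mono[OF W[of u y], of 2] by simp
    then have 2: "(u \<bullet> (?W *v y))\<^sup>2 \<le> (norm u / t)\<^sup>2 * (norm y)\<^sup>2"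
      by (simp add: power_mult_distrib power_divide)
    have "\<bar>(y \<bullet> (?W *v y)) * (u \<bullet> (?W *v u))\<bar> \<le> (norm y * (norm y / t)) * ?b"
      unfolding abs_mult using t by (intro mult_mono W) auto
    also have "\<dots> = (norm u / t)\<^sup>2 * (norm y)\<^sup>2" by (simp add: power2_eq_square)
    finally have "\<bar>stein_deriv ?W u y\<bar> \<le> ?b * 1 + 2 * (norm u / t)\<^sup>2 * (norm y)\<^sup>2"
      using 1 2 zero_le_power2[of "u \<bullet> (?W *v y)"] unfolding stein_deriv_def by linarith
    also have "\<dots> \<le> ?b * (1 + (norm y)\<^sup>2)\<^sup>2 + 2 * (norm u / t)\<^sup>2 * (1 + (norm y)\<^sup>2)\<^sup>2"
      using t by (intro add_mono mult_left_mono) (auto simp: power2_eq_square algebra_simps)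
    also have "\<dots> \<le> ?C * (1 + (norm y)\<^sup>2)\<^sup>2"
      unfolding distrib_right[symmetric] using t by (intro mult_right_mono) auto
    finally show "\<bar>stein_deriv ?W u y\<bar> \<le> ?C * (1 + (norm y)\<^sup>2)\<^sup>2" .
  qed
qed

section \<open>Stein's identity in the rows of the sample\<close>

context gaussian
begin

lemma stein_rank_one:
  fixes u :: "real^'n"
  assumes M: "psd M" and t: "t > 0"
  defines "V \<equiv> (\<lambda>y. ridge_inv t (M + outer y y))"
  shows "(\<integral>y. (y \<bullet> (R *v u)) * (u \<bullet> (V y *v y)) \<partial>law) = (\<integral>y. stein_deriv (V y) u y \<partial>law)"
proof -
  have psd: "psd (M + outer y y)" for y
    using M by (auto simp: psd_def linear_add[OF linear_transpose]
        transpose_outer matrix_vector_mult_add_rdistrib outer_matrix_vector_mult inner_add_right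
        inner_commute[of y])
  let ?B = "\<lambda>y. M + outer y y + t *\<^sub>R mat 1"
  have inv: "invertible (?B y)" for y by (rule pos_def_invertible[OF ridge_pos_def[OF psd t]])
  have V: "V y = matrix_inv (?B y)" for y by (simp add: V_def ridge_inv_def)
  have cV [continuous_intros]: "continuous_on UNIV V"
    unfolding V by (rule continuous_on_compose2[OF continuous_on_matrix_inv])
      (auto intro!: continuous_intros inv)
  let ?g = "\<lambda>y. u \<bullet> (V y *v y)" and ?g' = "\<lambda>y. stein_deriv (V y) u y"
  have cont: "continuous_on UNIV ?g" "continuous_on UNIV ?g'"
    unfolding stein_deriv_def by (intro continuous_intros)+
  then have [measurable]: "?g \<in> borel_measurable borel" "?g' \<in> borel_measurable borel"
    by (auto intro: borel_measurable_continuous_onI)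
  obtain C where C0: "C \<ge> 0" and "\<forall>M y. psd M \<longrightarrow> \<bar>u \<bullet> (ridge_inv t M *v y)\<bar> \<le> C * (1 + (norm y)\<^sup>2) \<and>
      \<bar>stein_deriv (ridge_inv t M) u y\<bar> \<le> C * (1 + (norm y)\<^sup>2)\<^sup>2"
    using ridge_inv_bounds[OF t] by blast
  then have C: "\<bar>u \<bullet> (ridge_inv t M *v y)\<bar> \<le> C * (1 + (norm y)\<^sup>2)"
    "\<bar>stein_deriv (ridge_inv t M) u y\<bar> \<le> C * (1 + (norm y)\<^sup>2)\<^sup>2"
    if "psd M" for M y
    using that by simp_all
  have bound: "\<bar>?g y\<bar> \<le> C * (1 + (norm y)\<^sup>2)" "\<bar>?g' y\<bar> \<le> C * (1 + (norm y)\<^sup>2)\<^sup>2" for y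
    unfolding V_def by (rule C[OF psd])+
  \<comment> \<open>The left side is what the product rule and the derivative of the inverse
    produce; the rank-one matrices reduce it to scalars.\<close>
  have expand: "u \<bullet> (W *v (h *\<^sub>R u) + - (W ** (outer z (h *\<^sub>R u) + outer (h *\<^sub>R u) z) ** W) *v z) =
      stein_deriv W u z * h" for W z h
  proof -
    have "(W ** (outer z (h *\<^sub>R u) + outer (h *\<^sub>R u) z) ** W) *v z =
        h *\<^sub>R ((u \<bullet> (W *v z)) *\<^sub>R (W *v z) + (z \<bullet> (W *v z)) *\<^sub>R (W *v u))"
      by (simp only: matrix_vector_mul_assoc[symmetric] matrix_vector_mult_add_rdistrib
          outer_matrix_vector_mult matrix_vector_right_distrib matrix_vector_mult_scaleR
          inner_scaleR_left scaleR_add_right scaleR_scaleR mult_ac)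
    then show ?thesis
      by (simp add: stein_deriv_def inner_add_right inner_diff_right matrix_vector_mult_scaleR
          bounded_bilinear.minus_left[OF bilinear_matrix_vector_mult] power2_eq_square algebra_simps)
  qed
  have deriv: "((\<lambda>s. ?g (y + s *\<^sub>R u)) has_real_derivative ?g' (y + s *\<^sub>R u)) (at s)" for y s
  proof -
    let ?z = "y + s *\<^sub>R u"
    have z: "((\<lambda>s. y + s *\<^sub>R u) has_derivative (\<lambda>h. h *\<^sub>R u)) (at s)"
      by (auto intro!: derivative_eq_intros)
    have B: "((\<lambda>s. ?B (y + s *\<^sub>R u)) has_derivative (\<lambda>h. outer ?z (h *\<^sub>R u) + outer (h *\<^sub>R u) ?z)) (at s)"
      by (auto intro!: derivative_eq_intros bounded_bilinear.FDERIV[OF bilinear_outer z z])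
    have "((\<lambda>s. V (y + s *\<^sub>R u)) has_derivative
        (\<lambda>h. - (V ?z ** (outer ?z (h *\<^sub>R u) + outer (h *\<^sub>R u) ?z) ** V ?z))) (at s)"
      unfolding V by (rule has_derivative_compose[OF B has_derivative_matrix_inv[OF inv]])
    from bounded_bilinear.FDERIV[OF bilinear_matrix_vector_mult this z]
    have "((\<lambda>s. ?g (y + s *\<^sub>R u)) has_derivative (\<lambda>h. u \<bullet> (V ?z *v (h *\<^sub>R u) +
        - (V ?z ** (outer ?z (h *\<^sub>R u) + outer (h *\<^sub>R u) ?z) ** V ?z) *v ?z))) (at s)"
      by (rule bounded_linear.has_derivative[OF bounded_linear_inner_right])
    then show ?thesis unfolding expand by (rule has_derivative_imp_has_field_derivative) simp
  qed
  have "(\<integral>y. (y \<bullet> (R *v u)) * ?g y \<partial>law) = (\<integral>y. ?g y * ((R *v y) \<bullet> u) * weight y \<partial>lborel) / mass"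
    by (subst integral_law) (auto simp: selfadj mult_ac)
  also have "\<dots> = (\<integral>y. ?g' y * weight y \<partial>lborel) / mass"
    by (subst stein(3)[OF cont(1) bound(1) cont(2) bound(2) deriv]) simp
  also have "\<dots> = (\<integral>y. ?g' y \<partial>law)" by (subst integral_law) auto
  finally show ?thesis .
qed

abbreviation sample :: "'i set \<Rightarrow> ('i \<Rightarrow> real^'n) measure" where
  "sample I \<equiv> PiM I (\<lambda>_. law)"

lemma prob_space_sample: "prob_space (sample I)"
  by (intro prob_space_PiM law.prob_space_axioms)

lemma measurable_row: "i \<in> I \<Longrightarrow> (\<lambda>x. x i) \<in> borel_measurable (sample I)"
  using measurable_component_singleton[of i I "\<lambda>_. law"] by simp

lemma measurable_sample_gram [measurable]: "(\<lambda>x. gram I x) \<in> borel_measurable (sample I)"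
  by (intro measurable_gram measurable_row)

lemma integrable_row_bound:
  fixes f :: "('i \<Rightarrow> real^'n) \<Rightarrow> real"
  assumes i: "i \<in> I" and f: "f \<in> borel_measurable (sample I)" "\<And>x. \<bar>f x\<bar> \<le> C * (1 + (norm (x i))\<^sup>2)\<^sup>2"
  shows "integrable (sample I) f"
proof -
  let ?n = "\<lambda>y :: real^'n. C * (1 + (norm y)\<^sup>2)\<^sup>2"
  have "integrable law ?n" by (rule integrable_law_bound[where C = "\<bar>C\<bar>"]) (auto simp: abs_mult)
  also have "law = distr (sample I) law (\<lambda>x. x i)"
    using distr_PiM_component[of I "\<lambda>_. law" i] i law.prob_space_axioms by simp
  finally have "integrable (sample I) (\<lambda>x. ?n (x i))"
    by (subst (asm) integrable_distr_eq) (use i measurable_component_singleton in auto)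
  then show ?thesis by (rule Bochner_Integration.integrable_bound[OF _ f(1)])
      (use order.trans[OF f(2) abs_ge_self] in simp)
qed

text \<open>Fubini with all rows but the i-th frozen: the Gram matrix is then a constant matrix plus
  \<open>outer y y\<close>, as in \<open>stein_rank_one\<close>.\<close>

lemma stein_row:
  fixes u :: "real^'n" and I :: "'i set"
  assumes I: "finite I" "i \<in> I" and t: "t > 0"
  defines "W \<equiv> (\<lambda>x. ridge_inv t (gram I x))"
  shows "integrable (sample I) (\<lambda>x. (x i \<bullet> (R *v u)) * (u \<bullet> (W x *v x i)))" (is "integrable _ ?l")
    and "integrable (sample I) (\<lambda>x. stein_deriv (W x) u (x i))" (is "integrable _ ?r")
    and "(\<integral>x. (x i \<bullet> (R *v u)) * (u \<bullet> (W x *v x i)) \<partial>sample I) =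
      (\<integral>x. stein_deriv (W x) u (x i) \<partial>sample I)"
proof -
  note [measurable] = measurable_row[OF I(2)]
  have [measurable]: "W \<in> borel_measurable (sample I)"
    unfolding W_def ridge_inv_def by measurable
  obtain C where C0: "C \<ge> 0" and "\<forall>M y. psd M \<longrightarrow> \<bar>u \<bullet> (ridge_inv t M *v y)\<bar> \<le> C * (1 + (norm y)\<^sup>2) \<and>
      \<bar>stein_deriv (ridge_inv t M) u y\<bar> \<le> C * (1 + (norm y)\<^sup>2)\<^sup>2"
    using ridge_inv_bounds[OF t] by blast
  then have C: "\<bar>u \<bullet> (ridge_inv t M *v y)\<bar> \<le> C * (1 + (norm y)\<^sup>2)"
    "\<bar>stein_deriv (ridge_inv t M) u y\<bar> \<le> C * (1 + (norm y)\<^sup>2)\<^sup>2"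
    if "psd M" for M y
    using that by simp_all
  show i1: "integrable (sample I) ?l"
  proof (rule integrable_row_bound[OF I(2)])
    fix x :: "'i \<Rightarrow> real^'n"
    let ?n = "1 + (norm (x i))\<^sup>2"
    have "\<bar>?l x\<bar> \<le> (norm (R *v u) * ?n) * (C * ?n)"
      unfolding abs_mult W_def by (intro mult_mono abs_inner_le C psd_gram) auto
    then show "\<bar>?l x\<bar> \<le> (norm (R *v u) * C) * ?n\<^sup>2" by (simp add: power2_eq_square mult_ac)
  qed measurable
  show i2: "integrable (sample I) ?r"
  proof (rule integrable_row_bound[OF I(2)])
    show "?r \<in> borel_measurable (sample I)" unfolding stein_deriv_def by measurable
    show "\<bar>?r x\<bar> \<le> C * (1 + (norm (x i))\<^sup>2)\<^sup>2" for x
      unfolding W_def by (rule C(2)[OF psd_gram])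
  qed
  show "integral\<^sup>L (sample I) ?l = integral\<^sup>L (sample I) ?r"
  proof -
    interpret product_sigma_finite "\<lambda>_::'i. law" by standard
    define J where "J = I - {i}"
    have J: "finite J" "i \<notin> J" and IJ: "I = insert i J"
      using I by (auto simp: J_def)
    have W: "W (x(i := y)) = ridge_inv t (gram J x + outer y y)" for x y
    proof -
      have "gram I (x(i := y)) = gram J x + outer y y"
        unfolding IJ gram_def using J by (auto simp: add.commute intro!: sum.cong)
      then show ?thesis by (simp add: W_def)
    qed
    show ?thesis by (subst (1 2) IJ, subst (1 2) product_integral_insert[OF J])
        (use i1 i2 in \<open>simp_all add: IJ[symmetric] W stein_rank_one[OF psd_gram t]\<close>)
  qed
qed

end

context gaussian
begin

text \<open>Summed over the rows, both sides of \<open>stein_row\<close> depend on the sample only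
  through the Gram matrix. At t = 0 with an invertible Gram matrix the sums would be
  \<open>u \<bullet> (R *v u)\<close> and (N - 1 - n) times \<open>u \<bullet> (W *v u)\<close>,
  with N rows in dimension n; all other terms carry the factor t.\<close>

lemma ridge_identity:
  fixes u :: "real^'n" and I :: "'i set"
  assumes I: "finite I" and t: "t > 0"
  defines "W \<equiv> (\<lambda>x. ridge_inv t (gram I x))"
  shows "integrable (sample I) (\<lambda>x. u \<bullet> (W x *v u))"
    and "(\<integral>x. (real (card I) - real CARD('n) - 1) * (u \<bullet> (W x *v u)) + t * (norm (W x *v u))\<^sup>2 +
        t * (mat 1 \<bullet> W x) * (u \<bullet> (W x *v u)) +
        t * ((R *v u) \<bullet> (W x *v u)) \<partial>sample I) = u \<bullet> (R *v u)"
proof -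
  interpret sample: prob_space "sample I" by (rule prob_space_sample)
  have [measurable]: "W \<in> borel_measurable (sample I)"
    unfolding W_def ridge_inv_def by measurable
  note R = psd_gram[of I] t
  have "\<bar>u \<bullet> (W x *v u)\<bar> \<le> norm u * (norm u / t)" for x
    unfolding W_def
    by (rule order.trans[OF Cauchy_Schwarz_ineq2 mult_left_mono[OF norm_ridge_inv_le[OF R]]]) simp
  then show "integrable (sample I) (\<lambda>x. u \<bullet> (W x *v u))"
    by (intro sample.integrable_const_bound[where B = "norm u * (norm u / t)"]) simp_all
  let ?l = "\<lambda>x. (\<Sum>i\<in>I. (x i \<bullet> (R *v u)) * (u \<bullet> (W x *v x i)))"
  let ?r = "\<lambda>x. \<Sum>i\<in>I. stein_deriv (W x) u (x i)"
  have sym: "(W x *v v) \<bullet> w = v \<bullet> (W x *v w)" for x v w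
    unfolding W_def by (rule ridge_inv_selfadj[OF R])
  have sym': "v \<bullet> (W x *v w) = w \<bullet> (W x *v v)" for x v w
    using sym[of x v w] by (simp only: inner_commute)
  have G: "v \<bullet> (gram I x *v (W x *v w)) = v \<bullet> w - t * (v \<bullet> (W x *v w))" for x v w
    unfolding W_def ridge_inv_apply[OF R] by (simp add: inner_diff_right)
  have l: "?l x = (R *v u) \<bullet> u - t * ((R *v u) \<bullet> (W x *v u))" for x
    using G[of "R *v u" x u] by (simp add: gram_inner sym')
  have r: "?r x = real (card I) * (u \<bullet> (W x *v u)) - (u \<bullet> (W x *v u) - t * (norm (W x *v u))\<^sup>2) -
      (real CARD('n) - t * (mat 1 \<bullet> W x)) * (u \<bullet> (W x *v u))" for x
  proof -
    have "(\<Sum>i\<in>I. (u \<bullet> (W x *v x i))\<^sup>2) = (W x *v u) \<bullet> (gram I x *v (W x *v u))"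
      by (simp add: gram_inner sym'[of u] power2_eq_square)
    also have "\<dots> = u \<bullet> (W x *v u) - t * (norm (W x *v u))\<^sup>2"
      unfolding G by (simp add: power2_norm_eq_inner inner_commute)
    finally have 1: "(\<Sum>i\<in>I. (u \<bullet> (W x *v x i))\<^sup>2) = u \<bullet> (W x *v u) - t * (norm (W x *v u))\<^sup>2" .
    have "(\<Sum>i\<in>I. x i \<bullet> (W x *v x i)) = W x \<bullet> gram I x"
      by (simp add: gram_def inner_sum_right inner_outer inner_commute)
    also have "\<dots> = real CARD('n) - t * (mat 1 \<bullet> W x)"
      unfolding W_def ridge_inv_trace[OF R] by simp
    finally show ?thesis by (simp add: stein_deriv_def sum_subtractf 1 flip: sum_distrib_right)
  qed
  have i: "integrable (sample I) ?l" "integrable (sample I) ?r"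
    unfolding W_def by (intro bochner_sum(1) stein_row(1,2)[OF I _ t]; assumption)+
  have "(\<integral>x. ?l x \<partial>sample I) = (\<integral>x. ?r x \<partial>sample I)"
    unfolding W_def using stein_row[OF I _ t, where u = u]
    by (subst (1 2) bochner_sum(2)) (auto intro: sum.cong)
  then have "0 = (\<integral>x. ?r x - ?l x \<partial>sample I)" using i by simp
  also have "(\<lambda>x. ?r x - ?l x) = (\<lambda>x. ((real (card I) - real CARD('n) - 1) * (u \<bullet> (W x *v u)) +
      t * (norm (W x *v u))\<^sup>2 + t * (mat 1 \<bullet> W x) * (u \<bullet> (W x *v u)) +
      t * ((R *v u) \<bullet> (W x *v u))) - u \<bullet> (R *v u))" (is "_ = (\<lambda>x. ?s x - ?c)")
    unfolding l r by (auto simp: inner_commute[of u] algebra_simps)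
  also have "(\<integral>x. ?s x - ?c \<partial>sample I) = (\<integral>x. ?s x \<partial>sample I) - ?c"
  proof -
    have "integrable (sample I) (\<lambda>x. (?r x - ?l x) + ?c)" using i by auto
    also have "(\<lambda>x. (?r x - ?l x) + ?c) = ?s"
      unfolding l r by (auto simp: inner_commute[of u] algebra_simps)
    finally show ?thesis by (subst Bochner_Integration.integral_diff) (auto simp: sample.prob_space)
  qed
  finally show "(\<integral>x. ?s x \<partial>sample I) = ?c" by simp
qed

text \<open>The regularization tends to 0. Fatou's lemma bounds the expected trace of the limit, which
  is infinite where the Gram matrix is singular.\<close>

theorem inverse_wishart_mean:
  fixes I :: "'i set"
  assumes I: "finite I" "card I \<ge> CARD('n) + 2"
  shows AE_invertible_gram: "AE x in sample I. invertible (gram I x)"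
    and integrable_inv_gram: "integrable (sample I) (\<lambda>x. w \<bullet> (matrix_inv (gram I x) *v w))"
    and inv_gram_mean: "(\<integral>x. w \<bullet> (matrix_inv (gram I x) *v w) \<partial>sample I) =
      w \<bullet> (R *v w) / (real (card I) - real CARD('n) - 1)"
proof -
  let ?M = "sample I"
  interpret E: prob_space "sample I" by (rule prob_space_sample)
  define e where "e = (\<lambda>n. 1 / real (Suc n))"
  have e: "e n > 0" "e n \<le> 1" for n by (auto simp: e_def)
  have e0: "e \<longlonglongrightarrow> 0" unfolding e_def by (rule LIMSEQ_Suc[OF lim_1_over_n])
  define W where "W = (\<lambda>n (x :: 'i \<Rightarrow> real^'n). ridge_inv (e n) (gram I x))"
  define k where "k = real (card I) - real CARD('n) - 1"
  \<comment> \<open>This is where the number of rows matters: with a factor of at least 1 the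
    identity bounds the expected quadratic form uniformly in n.\<close>
  have k: "k \<ge> 1" using I(2) by (simp add: k_def)
  have [measurable]: "W n \<in> borel_measurable ?M" for n
    unfolding W_def ridge_inv_def by measurable
  note R = psd_gram[of I] e(1)
  let ?a = "\<lambda>u n x. u \<bullet> (W n x *v u)" and ?b = "\<lambda>u x. u \<bullet> (matrix_inv (gram I x) *v u)"
  let ?t = "\<lambda>n x. mat 1 \<bullet> W n x" and ?c = "\<lambda>u. norm (R *v u) * norm u"
  have nn: "?a u n x \<ge> 0" for n x u
    unfolding W_def by (rule ridge_inv_nonneg[OF R])
  have tr: "?t n x = (\<Sum>j\<in>UNIV. ?a (axis j 1) n x)" for n x
    by (simp add: mat_1_inner axis_inner_mult)
  have tr_nn: "?t n x \<ge> 0" for n x unfolding tr by (intro sum_nonneg nn)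
  have int: "integrable ?M (?a u n)" for n u
    unfolding W_def by (rule ridge_identity(1)[OF I(1) e(1)])
  let ?rest = "\<lambda>u n x. e n * (norm (W n x *v u))\<^sup>2 + e n * ?t n x * ?a u n x +
      e n * ((R *v u) \<bullet> (W n x *v u))"
  have eW: "norm (e n *\<^sub>R (W n x *v u)) \<le> norm u" for n x u
    using norm_ridge_inv_le[OF R, of n x u] e(1)[of n] by (simp add: W_def field_simps)
  have cross: "\<bar>e n * ((R *v u) \<bullet> (W n x *v u))\<bar> \<le> ?c u" for n x u
  proof -
    have "\<bar>(R *v u) \<bullet> (e n *\<^sub>R (W n x *v u))\<bar> \<le> ?c u"
      by (rule order.trans[OF Cauchy_Schwarz_ineq2 mult_left_mono[OF eW]]) simp
    then show ?thesis by simp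
  qed
  have sq: "0 \<le> e n * (norm (W n x *v u))\<^sup>2" "e n * (norm (W n x *v u))\<^sup>2 \<le> ?a u n x" for n x u
    using e(1)[of n] ridge_inv_square_le[OF R] by (simp_all add: W_def)
  have etr: "0 \<le> e n * ?t n x" "e n * ?t n x \<le> CARD('n)" for n x
  proof -
    show "0 \<le> e n * ?t n x" using tr_nn e(1)[of n] by simp
    have "W n x \<bullet> gram I x = (\<Sum>i\<in>I. x i \<bullet> (W n x *v x i))"
      by (simp add: gram_def inner_sum_right inner_outer inner_commute)
    then have "W n x \<bullet> gram I x \<ge> 0" by (simp add: sum_nonneg nn)
    then show "e n * ?t n x \<le> CARD('n)"
      unfolding W_def ridge_inv_trace[OF R] by simp
  qed
  \<comment> \<open>The lower bound does not depend on n and yields the bound on expectations; the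
    bound on the absolute value serves domination.\<close>
  have rest: "- ?c u \<le> ?rest u n x" "\<bar>?rest u n x\<bar> \<le> (1 + CARD('n)) * ?a u n x + ?c u" for u n x
  proof -
    have "0 \<le> e n * ?t n x * ?a u n x" by (intro mult_nonneg_nonneg etr nn)
    moreover have "e n * ?t n x * ?a u n x \<le> CARD('n) * ?a u n x" by (intro mult_right_mono etr nn)
    ultimately show "- ?c u \<le> ?rest u n x" "\<bar>?rest u n x\<bar> \<le> (1 + CARD('n)) * ?a u n x + ?c u"
      using sq[of n x u] cross[of n u x] by (simp_all add: abs_le_iff algebra_simps)
  qed
  have int_rest: "integrable ?M (?rest u n)" for u n
  proof (rule Bochner_Integration.integrable_bound)
    show "integrable ?M (\<lambda>x. (1 + CARD('n)) * ?a u n x + ?c u)" using int by auto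
    show "AE x in ?M. norm (?rest u n x) \<le> norm ((1 + CARD('n)) * ?a u n x + ?c u)"
      using order.trans[OF rest(2) abs_ge_self] by (intro AE_I2) (simp only: real_norm_def)
  qed measurable
  have identity: "k * E.expectation (?a u n) + E.expectation (?rest u n) = u \<bullet> (R *v u)" for u n
  proof -
    have "(\<integral>x. k * ?a u n x + ?rest u n x \<partial>?M) = u \<bullet> (R *v u)"
      using ridge_identity(2)[OF I(1) e(1)[of n], of u] unfolding W_def k_def by (simp add: add.assoc)
    then show ?thesis using int int_rest by (subst (asm) Bochner_Integration.integral_add) auto
  qed
  define K where "K u = u \<bullet> (R *v u) + ?c u" for u
  have bound: "E.expectation (?a u n) \<le> K u" for u n
  proof -
    have "(\<integral>x. - ?c u \<partial>?M) \<le> E.expectation (?rest u n)"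
      using rest(1) by (intro integral_mono int_rest) auto
    then have "k * E.expectation (?a u n) \<le> K u"
      using identity[of u n] by (simp add: K_def E.prob_space)
    moreover have "0 \<le> E.expectation (?a u n)" by (intro Bochner_Integration.integral_nonneg nn)
    ultimately show ?thesis using mult_right_mono[OF k, of "E.expectation (?a u n)"] by linarith
  qed
  \<comment> \<open>Used for the diagonal entries, to exclude singular Gram matrices, and for the
    form at w, to make its limit integrable.\<close>
  have fatou: "(\<integral>\<^sup>+x. liminf (\<lambda>n. ennreal (f n x)) \<partial>?M) < \<infinity>"
    if f: "\<And>n. integrable ?M (f n)" "\<And>n x. f n x \<ge> 0" "\<And>n. E.expectation (f n) \<le> C" for f C
  proof -
    have "(\<integral>\<^sup>+x. liminf (\<lambda>n. ennreal (f n x)) \<partial>?M) \<le> liminf (\<lambda>n. \<integral>\<^sup>+x. ennreal (f n x) \<partial>?M)"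
      using f(1) by (intro nn_integral_liminf) simp
    also have "\<dots> \<le> liminf (\<lambda>n. ennreal C)"
      using f by (intro Liminf_mono always_eventually allI) (simp add: nn_integral_eq_integral ennreal_leI)
    also have "\<dots> < \<infinity>" by (simp add: Liminf_const)
    finally show ?thesis .
  qed
  show AE: "AE x in ?M. invertible (gram I x)"
  proof -
    have "AE x in ?M. \<forall>j\<in>UNIV. liminf (\<lambda>n. ennreal (?a (axis j 1) n x)) \<noteq> \<infinity>"
    proof (rule AE_finite_allI)
      fix j
      have "(\<integral>\<^sup>+x. liminf (\<lambda>n. ennreal (?a (axis j 1) n x)) \<partial>?M) < \<infinity>"
        by (rule fatou[OF int nn bound])
      then show "AE x in ?M. liminf (\<lambda>n. ennreal (?a (axis j 1) n x)) \<noteq> \<infinity>"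
        by (intro nn_integral_PInf_AE) auto
    qed simp
    then show ?thesis
    proof eventually_elim
      case (elim x)
      show "invertible (gram I x)"
      proof (rule ccontr)
        assume "\<not> invertible (gram I x)"
        then obtain v where v: "gram I x *v v = 0" "v \<noteq> 0"
          unfolding invertible_left_inverse matrix_left_invertible_ker by blast
        then obtain j where j: "v $ j \<noteq> 0" by (auto simp: vec_eq_iff)
        \<comment> \<open>A kernel vector v of the Gram matrix is an eigenvector of
          \<open>W n\<close> with eigenvalue \<open>real (Suc n)\<close>, which makes a diagonal
          entry grow at least linearly.\<close>
        have ge: "(v $ j)\<^sup>2 / (norm v)\<^sup>2 * real (Suc n) \<le> ?a (axis j 1) n x" for n
        proof -
          have "W n x *v ((gram I x + e n *\<^sub>R mat 1) *v v) = v"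
            unfolding W_def ridge_inv_def
            by (simp only: matrix_vector_mul_assoc matrix_vector_mul_lid
                matrix_inv_left[OF pos_def_invertible[OF ridge_pos_def[OF R]]])
          then have "e n *\<^sub>R (W n x *v v) = v"
            by (simp add: matrix_vector_mult_add_rdistrib scaleR_mat_vector_mult v
                matrix_vector_mult_scaleR)
          then have "v $ j = axis j 1 \<bullet> (e n *\<^sub>R (W n x *v v))" by (simp add: inner_axis')
          also have "\<dots> = e n * ((W n x *v axis j 1) \<bullet> v)"
            by (simp add: W_def ridge_inv_selfadj[OF R])
          finally have "\<bar>v $ j\<bar> = e n * \<bar>(W n x *v axis j 1) \<bullet> v\<bar>"
            using e(1)[of n] by (simp only: abs_mult abs_of_pos)
          also have "\<dots> \<le> e n * (norm (W n x *v axis j 1) * norm v)"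
            using e(1)[of n] by (intro mult_left_mono Cauchy_Schwarz_ineq2) simp
          finally have "(v $ j)\<^sup>2 \<le> (e n * (norm (W n x *v axis j 1) * norm v))\<^sup>2"
            using power_mono[of "\<bar>v $ j\<bar>" _ 2] by simp
          also have "\<dots> = (e n * (norm v)\<^sup>2) * (e n * (norm (W n x *v axis j 1))\<^sup>2)"
            by (simp add: power2_eq_square mult_ac)
          also have "\<dots> \<le> (e n * (norm v)\<^sup>2) * ?a (axis j 1) n x"
            using e(1)[of n] by (intro mult_left_mono sq) simp
          finally show ?thesis using v(2) by (simp add: e_def field_simps)
        qed
        have "filterlim (\<lambda>n. (v $ j)\<^sup>2 / (norm v)\<^sup>2 * real (Suc n)) at_top sequentially"
          by (rule filterlim_tendsto_pos_mult_at_top[OF tendsto_const _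
              filterlim_compose[OF filterlim_real_sequentially filterlim_Suc]]) (use j v in simp)
        then have "filterlim (\<lambda>n. ?a (axis j 1) n x) at_top sequentially"
          by (rule filterlim_at_top_mono) (intro always_eventually allI ge)
        then have "(\<lambda>n. ennreal (?a (axis j 1) n x)) \<longlonglongrightarrow> \<infinity>"
          by (simp add: ennreal_tendsto_top_eq_at_top)
        then show False using elim lim_imp_Liminf[OF sequentially_bot] by blast
      qed
    qed
  qed
  have lim: "AE x in ?M. (\<lambda>n. W n x) \<longlonglongrightarrow> matrix_inv (gram I x)"
    using AE
  proof eventually_elim
    case (elim x)
    have "(\<lambda>n. gram I x + e n *\<^sub>R mat 1) \<longlonglongrightarrow> gram I x + 0 *\<^sub>R mat 1" by (intro tendsto_intros e0)
    with elim show ?case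
      unfolding W_def ridge_inv_def by (intro tendsto_matrix_inv) auto
  qed
  show int_inv: "integrable ?M (?b w)"
  proof (rule integrableI_bounded)
    have "AE x in ?M. ennreal (norm (?b w x)) = liminf (\<lambda>n. ennreal (?a w n x))" using lim
    proof eventually_elim
      case (elim x)
      then have *: "(\<lambda>n. ?a w n x) \<longlonglongrightarrow> ?b w x" by (intro tendsto_intros)
      then have "?b w x \<ge> 0" by (rule LIMSEQ_le_const) (use nn in auto)
      with * show ?case
        by (simp add: lim_imp_Liminf[OF sequentially_bot tendsto_ennrealI])
    qed
    then have "(\<integral>\<^sup>+x. ennreal (norm (?b w x)) \<partial>?M) = (\<integral>\<^sup>+x. liminf (\<lambda>n. ennreal (?a w n x)) \<partial>?M)"
      by (rule nn_integral_cong_AE)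
    also have "\<dots> < \<infinity>" by (rule fatou[OF int nn bound])
    finally show "(\<integral>\<^sup>+x. ennreal (norm (?b w x)) \<partial>?M) < \<infinity>" .
  qed measurable
  \<comment> \<open>The dominating function is the limit itself, so its integrability has to be
    known before dominated convergence applies.\<close>
  have dom: "AE x in ?M. ?a w n x \<le> ?b w x" for n
    using AE by eventually_elim (simp add: W_def ridge_inv_le_inv[OF R])
  have conv1: "(\<lambda>n. E.expectation (?a w n)) \<longlonglongrightarrow> E.expectation (?b w)"
  proof (rule integral_dominated_convergence[OF _ _ int_inv])
    show "AE x in ?M. (\<lambda>n. ?a w n x) \<longlonglongrightarrow> ?b w x" using lim by eventually_elim (intro tendsto_intros)
    show "AE x in ?M. norm (?a w n x) \<le> ?b w x" for n
      using dom[of n] by eventually_elim (simp add: nn)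
  qed measurable
  have conv2: "(\<lambda>n. E.expectation (?rest w n)) \<longlonglongrightarrow> (\<integral>x. 0 \<partial>?M)"
  proof (rule integral_dominated_convergence)
    show "integrable ?M (\<lambda>x. (1 + CARD('n)) * ?b w x + ?c w)" using int_inv by auto
    show "AE x in ?M. norm (?rest w n x) \<le> (1 + CARD('n)) * ?b w x + ?c w" for n using dom[of n]
    proof eventually_elim
      case (elim x)
      have "(1 + CARD('n)) * ?a w n x \<le> (1 + CARD('n)) * ?b w x"
        using elim by (intro mult_left_mono) auto
      then show ?case using rest(2)[of n x w] unfolding real_norm_def by linarith
    qed
    show "AE x in ?M. (\<lambda>n. ?rest w n x) \<longlonglongrightarrow> 0" using lim
    proof eventually_elim
      case (elim x)
      let ?V = "matrix_inv (gram I x)"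
      have "(\<lambda>n. ?rest w n x) \<longlonglongrightarrow> 0 * (norm (?V *v w))\<^sup>2 + 0 * (mat 1 \<bullet> ?V) * ?b w x +
          0 * ((R *v w) \<bullet> (?V *v w))"
        by (intro tendsto_intros e0 elim)
      then show ?case by simp
    qed
  qed measurable
  have "(\<lambda>n. k * E.expectation (?a w n) + E.expectation (?rest w n)) \<longlonglongrightarrow>
      k * E.expectation (?b w) + (\<integral>x. 0 \<partial>?M)"
    by (intro tendsto_intros conv1 conv2)
  then have "w \<bullet> (R *v w) = k * E.expectation (?b w)"
    unfolding identity by (simp add: LIMSEQ_const_iff)
  then show "E.expectation (?b w) = w \<bullet> (R *v w) / (real (card I) - real CARD('n) - 1)"
    unfolding k_def[symmetric] using k by simp
qed

end

section \<open>Conditional Gaussian laws\<close>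

text \<open>A random vector \<open>h\<close> whose joint law with \<open>g\<close> transforms under the translations of \<open>h\<close> as in
  the Cameron--Martin formula for the centred Gaussian with precision \<open>T g\<close> has this Gaussian as
  its conditional law given \<open>g\<close>.\<close>

locale quasi_invariant = prob_space M
  for M :: "'w measure" and h :: "'w \<Rightarrow> 'h::euclidean_space" and g :: "'w \<Rightarrow> 'g::euclidean_space"
    and T :: "'g \<Rightarrow> 'h \<Rightarrow> 'h" +
  assumes measurable_h [measurable]: "h \<in> borel_measurable M"
    and measurable_g [measurable]: "g \<in> borel_measurable M"
    and measurable_T: "(\<lambda>z. T (fst z) (snd z)) \<in> borel_measurable (borel \<Otimes>\<^sub>M borel)"
    and AE_positive_form: "AE x in M. positive_form (T (g x))"
    and quasi_invariance: "\<And>F t. F \<in> borel_measurable (borel \<Otimes>\<^sub>M borel) \<Longrightarrow> (\<integral>\<^sup>+x. F (h x, g x) \<partial>M) =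
      (\<integral>\<^sup>+x. F (h x + t, g x) * ennreal (exp (- (t \<bullet> T (g x) t) / 2 - t \<bullet> T (g x) (h x))) \<partial>M)"
begin

lemma measurable_T' [measurable (raw)]:
  assumes [measurable]: "a \<in> borel_measurable N" "b \<in> borel_measurable N"
  shows "(\<lambda>x. T (a x) (b x)) \<in> borel_measurable N"
  using measurable_compose[OF _ measurable_T, of "\<lambda>x. (a x, b x)" N] by simp

text \<open>Defined for every v, so that it is jointly measurable, whereas \<open>T v\<close> is a
  positive form only for almost all values v of g.\<close>

definition gauss :: "'g \<Rightarrow> 'h \<Rightarrow> ennreal" where
  "gauss v t = ennreal (exp (- (t \<bullet> T v t) / 2))"

lemma measurable_gauss [measurable (raw)]:
  assumes [measurable]: "a \<in> borel_measurable N" "b \<in> borel_measurable N"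
  shows "(\<lambda>x. gauss (a x) (b x)) \<in> borel_measurable N"
  unfolding gauss_def by measurable

text \<open>Quasi-invariance is used twice. Averaged over t against r, and after the substitution of
  t - h for t, it frees the argument of f from h. Used again at fixed t, it turns the factor r (t -
  h) into r (- h), freeing it from t. What is left is a factor R independent of f.\<close>

lemma conditional_law_unnormalized:
  obtains R where "R \<in> borel_measurable M"
    and "\<And>f. f \<in> borel_measurable (borel \<Otimes>\<^sub>M borel) \<Longrightarrow> (\<integral>\<^sup>+x. f (h x, g x) \<partial>M) =
      (\<integral>\<^sup>+x. R x * (\<integral>\<^sup>+t. f (t, g x) * gauss (g x) t \<partial>lborel) \<partial>M)"
proof
  \<comment> \<open>The only property that matters is that r is nonnegative with integral 1.\<close>
  define r :: "'h \<Rightarrow> ennreal" where "r = indicator (cbox 0 One)"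
  have [measurable]: "r \<in> borel_measurable borel" by (simp add: r_def)
  have r: "(\<integral>\<^sup>+t. r t \<partial>lborel) = 1"
    by (simp add: r_def emeasure_lborel_cbox_eq inner_sum_left inner_Basis if_distrib cong: if_cong)
  define k where "k x t = ennreal (exp (- (t \<bullet> T (g x) t) / 2 - t \<bullet> T (g x) (h x)))" for x t
  define e where "e = (\<lambda>(u, v). ennreal (exp ((u \<bullet> T v u) / 2)))"
  define R where "R x = e (h x, g x) * r (- h x)" for x
  have k [measurable]: "(\<lambda>x. k (a x) (b x)) \<in> borel_measurable N"
    if [measurable]: "a \<in> measurable N M" "b \<in> borel_measurable N" for a b and N :: "'z measure"
    unfolding k_def by measurable
  have [measurable]: "e \<in> borel_measurable (borel \<Otimes>\<^sub>M borel)" unfolding e_def by measurable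
  show "R \<in> borel_measurable M"
    unfolding R_def by measurable
  interpret pair_sigma_finite M "lborel :: 'h measure"
    by standard
  \<comment> \<open>k is the likelihood ratio of a translation and e the reciprocal of the Gaussian
    weight at h; both equations complete the square.\<close>
  have k_eq: "k x (t - h x) = gauss (g x) t * e (h x, g x)" and e_eq: "e (h x + t, g x) * k x t = e (h x, g x)"
    if "positive_form (T (g x))" for x t
  proof -
    interpret positive_form "T (g x)" by fact
    have sym: "u \<bullet> T (g x) v = v \<bullet> T (g x) u" for u v
      using selfadj[of u v] by (simp add: inner_commute)
    have "- ((t - h x) \<bullet> T (g x) (t - h x)) / 2 - (t - h x) \<bullet> T (g x) (h x) =
        - (t \<bullet> T (g x) t) / 2 + (h x \<bullet> T (g x) (h x)) / 2"
      by (simp add: linear_diff[OF lin] inner_diff_left inner_diff_right sym[of "h x" t] field_simps)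
    then show "k x (t - h x) = gauss (g x) t * e (h x, g x)"
      by (simp add: k_def gauss_def e_def flip: ennreal_mult exp_add)
    have "((h x + t) \<bullet> T (g x) (h x + t)) / 2 + (- (t \<bullet> T (g x) t) / 2 - t \<bullet> T (g x) (h x)) =
        (h x \<bullet> T (g x) (h x)) / 2"
      by (simp add: linear_add[OF lin] inner_add_left inner_add_right sym[of "h x" t] field_simps)
    then show "e (h x + t, g x) * k x t = e (h x, g x)"
      by (simp add: k_def e_def flip: ennreal_mult exp_add)
  qed
  fix f :: "'h \<times> 'g \<Rightarrow> ennreal"
  assume f [measurable]: "f \<in> borel_measurable (borel \<Otimes>\<^sub>M borel)"
  let ?A = "\<lambda>x t. r (t - h x) * f (t, g x) * (gauss (g x) t * e (h x, g x))"
  let ?B = "\<lambda>x t. R x * (f (t, g x) * gauss (g x) t)"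
  have "(\<integral>\<^sup>+x. f (h x, g x) \<partial>M) = (\<integral>\<^sup>+t. r t * (\<integral>\<^sup>+x. f (h x, g x) \<partial>M) \<partial>lborel)"
    by (simp add: nn_integral_multc r)
  also have "\<dots> = (\<integral>\<^sup>+t. (\<integral>\<^sup>+x. r t * (f (h x + t, g x) * k x t) \<partial>M) \<partial>lborel)"
  proof (rule nn_integral_cong)
    fix t
    have "(\<integral>\<^sup>+x. f (h x, g x) \<partial>M) = (\<integral>\<^sup>+x. f (h x + t, g x) * k x t \<partial>M)"
      unfolding k_def by (rule quasi_invariance) measurable
    then show "r t * (\<integral>\<^sup>+x. f (h x, g x) \<partial>M) = (\<integral>\<^sup>+x. r t * (f (h x + t, g x) * k x t) \<partial>M)"
      by (simp add: nn_integral_cmult)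
  qed
  also have "\<dots> = (\<integral>\<^sup>+x. (\<integral>\<^sup>+t. r t * (f (h x + t, g x) * k x t) \<partial>lborel) \<partial>M)"
    by (rule Fubini') measurable
  also have "\<dots> = (\<integral>\<^sup>+x. (\<integral>\<^sup>+t. ?A x t \<partial>lborel) \<partial>M)"
  proof (rule nn_integral_cong_AE, use AE_positive_form in eventually_elim)
    case (elim x)
    have "(\<integral>\<^sup>+t. r t * (f (h x + t, g x) * k x t) \<partial>lborel) =
        (\<integral>\<^sup>+t. r (t + - h x) * (f (h x + (t + - h x), g x) * k x (t + - h x)) \<partial>lborel)"
      by (rule nn_integral_translate[symmetric]) (simp add: k_def)
    then show ?case by (simp add: k_eq[OF elim] mult.assoc)
  qed
  also have "\<dots> = (\<integral>\<^sup>+t. (\<integral>\<^sup>+x. ?A x t \<partial>M) \<partial>lborel)" by (rule Fubini'[symmetric]) measurable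
  also have "\<dots> = (\<integral>\<^sup>+t. (\<integral>\<^sup>+x. ?B x t \<partial>M) \<partial>lborel)"
  proof (rule nn_integral_cong)
    fix t :: 'h
    have m: "(\<lambda>(u, v). r (t - u) * f (t, v) * (gauss v t * e (u, v))) \<in> borel_measurable (borel \<Otimes>\<^sub>M borel)"
      by measurable
    have "(\<integral>\<^sup>+x. ?A x t \<partial>M) =
        (\<integral>\<^sup>+x. r (t - (h x + t)) * f (t, g x) * (gauss (g x) t * e (h x + t, g x)) * k x t \<partial>M)"
      using quasi_invariance[OF m, of t] by (simp add: k_def)
    also have "\<dots> = (\<integral>\<^sup>+x. ?B x t \<partial>M)"
    proof (rule nn_integral_cong_AE, use AE_positive_form in eventually_elim)
      case (elim x)
      have "r (t - (h x + t)) * f (t, g x) * (gauss (g x) t * e (h x + t, g x)) * k x t =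
          r (- h x) * f (t, g x) * gauss (g x) t * (e (h x + t, g x) * k x t)"
        by (simp add: mult_ac)
      then show ?case unfolding e_eq[OF elim] by (simp add: R_def mult_ac)
    qed
    finally show "(\<integral>\<^sup>+x. ?A x t \<partial>M) = (\<integral>\<^sup>+x. ?B x t \<partial>M)" .
  qed
  also have "\<dots> = (\<integral>\<^sup>+x. (\<integral>\<^sup>+t. ?B x t \<partial>lborel) \<partial>M)" by (rule Fubini') (unfold R_def, measurable)
  also have "\<dots> = (\<integral>\<^sup>+x. R x * (\<integral>\<^sup>+t. f (t, g x) * gauss (g x) t \<partial>lborel) \<partial>M)"
    by (intro nn_integral_cong nn_integral_cmult) measurable
  finally show "(\<integral>\<^sup>+x. f (h x, g x) \<partial>M) = (\<integral>\<^sup>+x. R x * (\<integral>\<^sup>+t. f (t, g x) * gauss (g x) t \<partial>lborel) \<partial>M)" .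
qed

lemma gauss_eq_weight: "positive_form (T v) \<Longrightarrow> gauss v t = ennreal (positive_form.weight (T v) t)"
  by (simp add: gauss_def positive_form.weight_def)

lemma nn_integral_gauss:
  assumes "positive_form (T v)"
  shows "(\<integral>\<^sup>+t. gauss v t \<partial>lborel) = ennreal (positive_form.mass (T v))"
proof -
  interpret positive_form "T v" by fact
  show ?thesis unfolding mass_def gauss_eq_weight[OF assms]
    by (rule nn_integral_eq_integral[OF integrable_weight]) (simp add: weight_pos less_imp_le)
qed

text \<open>Apply the unnormalized formula to the normalized Gaussian mean of f, which is a function
  of g alone. The right-hand side is the same as for f, so the unknown factor R drops out.\<close>

theorem conditional_law:
  assumes [measurable]: "f \<in> borel_measurable (borel \<Otimes>\<^sub>M borel)"
  shows "(\<integral>\<^sup>+x. f (h x, g x) \<partial>M) =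
    (\<integral>\<^sup>+x. (\<integral>\<^sup>+t. f (t, g x) * gauss (g x) t \<partial>lborel) / (\<integral>\<^sup>+t. gauss (g x) t \<partial>lborel) \<partial>M)"
proof -
  obtain R where R: "\<And>f. f \<in> borel_measurable (borel \<Otimes>\<^sub>M borel) \<Longrightarrow> (\<integral>\<^sup>+x. f (h x, g x) \<partial>M) =
      (\<integral>\<^sup>+x. R x * (\<integral>\<^sup>+t. f (t, g x) * gauss (g x) t \<partial>lborel) \<partial>M)"
    using conditional_law_unnormalized by blast
  let ?J = "\<lambda>v. \<integral>\<^sup>+t. gauss v t \<partial>lborel"
  let ?f = "\<lambda>v. (\<integral>\<^sup>+t. f (t, v) * gauss v t \<partial>lborel) / ?J v"
  have "(\<lambda>z :: 'h \<times> 'g. ?f (snd z)) \<in> borel_measurable (borel \<Otimes>\<^sub>M borel)" by measurable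
  from R[OF this] have "(\<integral>\<^sup>+x. ?f (g x) \<partial>M) =
      (\<integral>\<^sup>+x. R x * (\<integral>\<^sup>+t. ?f (g x) * gauss (g x) t \<partial>lborel) \<partial>M)" by simp
  also have "\<dots> = (\<integral>\<^sup>+x. R x * (\<integral>\<^sup>+t. f (t, g x) * gauss (g x) t \<partial>lborel) \<partial>M)"
  proof (rule nn_integral_cong_AE, use AE_positive_form in eventually_elim)
    case (elim x)
    have J: "?J (g x) \<noteq> 0" "?J (g x) \<noteq> \<infinity>"
      unfolding nn_integral_gauss[OF elim] using positive_form.mass_pos[OF elim] by auto
    have "(\<integral>\<^sup>+t. ?f (g x) * gauss (g x) t \<partial>lborel) = ?f (g x) * ?J (g x)"
      by (simp add: nn_integral_cmult)
    also have "\<dots> = (\<integral>\<^sup>+t. f (t, g x) * gauss (g x) t \<partial>lborel)"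
      using J by (simp add: ennreal_divide_times ennreal_times_divide mult.commute[of "?J (g x)"]
          ennreal_mult_divide_eq)
    finally show ?case by simp
  qed
  also have "\<dots> = (\<integral>\<^sup>+x. f (h x, g x) \<partial>M)" by (rule R[symmetric]) measurable
  finally show ?thesis ..
qed

text \<open>The conditional probability is the chi-square one for almost every value of g, so
  averaging over g leaves it unchanged.\<close>

theorem prob_form_le: "prob {x \<in> space M. h x \<bullet> T (g x) (h x) \<le> r} = cdf (chi_square DIM('h)) r"
proof -
  let ?f = "\<lambda>z. indicator {..r} (fst z \<bullet> T (snd z) (fst z)) :: ennreal"
  have "emeasure M {x \<in> space M. h x \<bullet> T (g x) (h x) \<le> r} = (\<integral>\<^sup>+x. ?f (h x, g x) \<partial>M)"
  proof -
    have "(\<integral>\<^sup>+x. ?f (h x, g x) \<partial>M) = (\<integral>\<^sup>+x. indicator {x \<in> space M. h x \<bullet> T (g x) (h x) \<le> r} x \<partial>M)"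
      by (intro nn_integral_cong) (simp add: indicator_def)
    then show ?thesis by simp
  qed
  also have "\<dots> = (\<integral>\<^sup>+x. (\<integral>\<^sup>+t. ?f (t, g x) * gauss (g x) t \<partial>lborel) / (\<integral>\<^sup>+t. gauss (g x) t \<partial>lborel) \<partial>M)"
    by (rule conditional_law) measurable
  also have "\<dots> = (\<integral>\<^sup>+x. ennreal (cdf (chi_square DIM('h)) r) \<partial>M)"
  proof (rule nn_integral_cong_AE, use AE_positive_form in eventually_elim)
    case (elim x)
    interpret positive_form "T (g x)" by fact
    have "(\<integral>\<^sup>+t. ?f (t, g x) * gauss (g x) t \<partial>lborel) =
        (\<integral>\<^sup>+t. indicator {t. t \<bullet> T (g x) t \<le> r} t * ennreal (weight t) \<partial>lborel)"
      by (intro nn_integral_cong) (simp add: gauss_eq_weight[OF elim] indicator_def)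
    also have "\<dots> = ennreal mass * ennreal (cdf (chi_square DIM('h)) r)" by (rule chi_square_level)
    finally show ?case
      using mass_pos by (simp add: nn_integral_gauss[OF elim] ennreal_mult_divide_eq mult.commute[of "ennreal mass"])
  qed
  also have "\<dots> = ennreal (cdf (chi_square DIM('h)) r)" by (simp add: emeasure_space_1)
  finally show ?thesis by (simp add: emeasure_eq_measure cdf_def)
qed

text \<open>\<open>V x\<close> is the conditional covariance applied to v, given as a solution of an
  equation. Nonnegative integrals are used because the square integrability of
  \<open>h x \<bullet> v\<close> will be deduced from this formula.\<close>

theorem nn_second_moment:
  assumes "AE x in M. v = T (g x) (V x)"
  shows "(\<integral>\<^sup>+x. ennreal ((h x \<bullet> v)\<^sup>2) \<partial>M) = (\<integral>\<^sup>+x. ennreal (v \<bullet> V x) \<partial>M)"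
proof -
  let ?f = "\<lambda>z :: 'h \<times> 'g. ennreal ((fst z \<bullet> v)\<^sup>2)"
  have "?f \<in> borel_measurable (borel \<Otimes>\<^sub>M borel)" by measurable
  from conditional_law[OF this] have "(\<integral>\<^sup>+x. ?f (h x, g x) \<partial>M) =
      (\<integral>\<^sup>+x. (\<integral>\<^sup>+t. ?f (t, g x) * gauss (g x) t \<partial>lborel) / (\<integral>\<^sup>+t. gauss (g x) t \<partial>lborel) \<partial>M)" .
  also have "\<dots> = (\<integral>\<^sup>+x. ennreal (v \<bullet> V x) \<partial>M)"
  proof (rule nn_integral_cong_AE, use AE_positive_form assms in eventually_elim)
    case (elim x)
    interpret positive_form "T (g x)" by fact
    have "(\<integral>\<^sup>+t. ?f (t, g x) * gauss (g x) t \<partial>lborel) =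
        (\<integral>\<^sup>+t. ennreal ((t \<bullet> v) * (t \<bullet> T (g x) (V x)) * weight t) \<partial>lborel)"
      using weight_pos by (intro nn_integral_cong)
        (simp add: gauss_eq_weight[OF elim(1)] power2_eq_square less_imp_le flip: ennreal_mult elim(2))
    also have "\<dots> = ennreal (\<integral>t. (t \<bullet> v) * (t \<bullet> T (g x) (V x)) * weight t \<partial>lborel)"
      using weight_pos by (intro nn_integral_eq_integral integrable_second_moment)
        (simp_all add: less_imp_le flip: elim(2))
    also have "\<dots> = ennreal (v \<bullet> V x) * ennreal mass"
      unfolding second_moment using mass_pos by (intro ennreal_mult'') simp
    finally show ?case
      using mass_pos by (simp add: nn_integral_gauss[OF elim(1)] ennreal_mult_divide_eq)
  qed
  finally show ?thesis by simp
qed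

text \<open>The conditional law is symmetric under t to - t, so positive and negative part have the
  same integral.\<close>

theorem first_moment_zero:
  assumes int: "integrable M (\<lambda>x. h x \<bullet> v)"
  shows "expectation (\<lambda>x. h x \<bullet> v) = 0"
proof -
  have eq: "(\<integral>\<^sup>+t. ennreal (t \<bullet> v) * gauss u t \<partial>lborel) = (\<integral>\<^sup>+t. ennreal (t \<bullet> - v) * gauss u t \<partial>lborel)"
    if "positive_form (T u)" for u
  proof -
    interpret positive_form "T u" by fact
    have "gauss u (- t) = gauss u t" for t by (simp add: gauss_def linear_neg[OF lin])
    then show ?thesis
      using nn_integral_lborel_uminus[of "\<lambda>t. ennreal (t \<bullet> - v) * gauss u t"] by simp
  qed
  have "(\<lambda>z :: 'h \<times> 'g. ennreal (fst z \<bullet> u)) \<in> borel_measurable (borel \<Otimes>\<^sub>M borel)" for u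
    by measurable
  note c = conditional_law[OF this, unfolded fst_conv]
  have "(\<integral>\<^sup>+x. ennreal (h x \<bullet> v) \<partial>M) = (\<integral>\<^sup>+x. ennreal (h x \<bullet> - v) \<partial>M)"
    unfolding c using AE_positive_form by (intro nn_integral_cong_AE) (auto simp: eq elim!: eventually_mono)
  then show ?thesis using int by (simp add: real_lebesgue_integral_def)
qed

end

section \<open>The Cameron--Martin formula\<close>

text \<open>If the form vanishes at x, then every \<open>y i \<bullet> x\<close> vanishes, hence
  also \<open>gram I y *v x\<close>, which contradicts invertibility.\<close>

lemma pos_def_gram:
  fixes y :: "'i \<Rightarrow> real^'n"
  assumes "finite I" "invertible (gram I y)"
  shows "pos_def (gram I y)"
  unfolding pos_def_def
proof (intro conjI allI impI transpose_gram)
  fix x :: "real^'n" assume "x \<noteq> 0"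
  have "x \<bullet> (gram I y *v x) \<noteq> 0"
  proof
    assume "x \<bullet> (gram I y *v x) = 0"
    then have "(\<Sum>i\<in>I. (y i \<bullet> x)\<^sup>2) = 0" by (simp add: gram_inner power2_eq_square)
    then have "\<forall>i\<in>I. y i \<bullet> x = 0" using assms(1) by (subst (asm) sum_nonneg_eq_0_iff) auto
    then have "u \<bullet> (gram I y *v x) = 0" for u by (simp add: gram_inner)
    from this[of "gram I y *v x"] have "gram I y *v x = 0" by simp
    then have "matrix_inv (gram I y) *v (gram I y *v x) = 0" by simp
    with \<open>x \<noteq> 0\<close> show False
      by (simp add: matrix_vector_mul_assoc matrix_inv_left assms(2))
  qed
  moreover have "x \<bullet> (gram I y *v x) \<ge> 0" using psd_gram by (auto simp: psd_def)
  ultimately show "x \<bullet> (gram I y *v x) > 0" by simp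
qed

text \<open>Positivity follows by writing \<open>G\<close> as a second moment matrix.\<close>

lemma positive_form_matrix_mult:
  fixes P :: "real^'d^'d" and G :: "real^'l^'l"
  assumes P: "pos_def P" and G: "pos_def G"
  shows "positive_form (\<lambda>h. P ** h ** G)"
proof (rule positive_form.intro)
  show "linear (\<lambda>h. P ** h ** G)" by (rule linearI) (simp_all add: matrix_mult_simps)
  show "(P ** x ** G) \<bullet> y = x \<bullet> (P ** y ** G)" for x y
    using P G inner_matrix_mult_right[of "P ** x" G y] inner_matrix_mult_left[of P x "y ** G"]
    by (simp add: pos_def_def matrix_mul_assoc)
  fix h :: "real^'l^'d" assume "h \<noteq> 0"
  interpret P: positive_form "(*v) P" by (rule positive_form_matrix[OF P])
  interpret positive_form "(*v) (matrix_inv G)"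
    by (rule positive_form_matrix[OF pos_def_matrix_inv[OF G]])
  note inv = pos_def_invertible[OF G]
  have mom: "integrable lborel (\<lambda>x. (x \<bullet> u) * (x \<bullet> w) * weight x)"
    "(\<integral>x. (x \<bullet> u) * (x \<bullet> w) * weight x \<partial>lborel) = (u \<bullet> (G *v w)) * mass" for u w
    using integrable_second_moment[of u "G *v w"] second_moment[of u "G *v w"]
    by (simp_all add: matrix_vector_mul_assoc matrix_inv_left inv)
  obtain c where c: "c > 0" "\<And>x. c * (norm x)\<^sup>2 \<le> x \<bullet> (P *v x)"
    using P.coercive by blast
  obtain a where a: "h $ a \<noteq> 0"
    using \<open>h \<noteq> 0\<close> by (auto simp: vec_eq_iff)
  let ?f = "\<lambda>x. (h *v x) \<bullet> (P *v (h *v x))"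
  \<comment> \<open>For x Gaussian with covariance G, the mean of
    \<open>(h *v x) \<bullet> (P *v (h *v x))\<close> is \<open>h \<bullet> (P ** h ** G)\<close>.
    Expanding over the rows of h reduces this to second moments.\<close>
  have f: "?f x * weight x = (\<Sum>b\<in>UNIV. (x \<bullet> h $ b) * (x \<bullet> (P ** h) $ b) * weight x)" for x
    by (simp add: inner_vec_def[of "h *v x"] matrix_vector_mul_assoc matrix_vector_mul_component
        inner_commute[of x] sum_distrib_right)
  have int: "integrable lborel (\<lambda>x. ?f x * weight x)" unfolding f by (intro bochner_sum(1) mom)
  \<comment> \<open>Strictness comes from a nonzero row a: the integrand is at least c times the
    square of the coordinate a of \<open>h *v x\<close>, which has positive mean.\<close>
  have "0 < c * ((h $ a \<bullet> (G *v h $ a)) * mass)" using c(1) G a mass_pos by (simp add: pos_def_def)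
  also have "\<dots> = (\<integral>x. c * ((x \<bullet> h $ a) * (x \<bullet> h $ a) * weight x) \<partial>lborel)" by (simp add: mom)
  also have "\<dots> \<le> (\<integral>x. ?f x * weight x \<partial>lborel)"
  proof (rule integral_mono[OF integrable_mult_right[OF mom(1)] int])
    fix x :: "real^'l"
    have "\<bar>x \<bullet> h $ a\<bar> \<le> norm (h *v x)"
      using component_le_norm_cart[of "h *v x" a] by (simp add: matrix_vector_mul_component inner_commute)
    then have "(x \<bullet> h $ a) * (x \<bullet> h $ a) \<le> (norm (h *v x))\<^sup>2"
      using power_mono[of "\<bar>x \<bullet> h $ a\<bar>" "norm (h *v x)" 2] by (simp add: power2_eq_square)
    then have "c * ((x \<bullet> h $ a) * (x \<bullet> h $ a)) \<le> ?f x"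
      using c(1) by (intro order.trans[OF mult_left_mono c(2)]) auto
    then show "c * ((x \<bullet> h $ a) * (x \<bullet> h $ a) * weight x) \<le> ?f x * weight x"
      using weight_pos[of x] by (simp add: mult_right_mono flip: mult.assoc)
  qed
  also have "\<dots> = (\<Sum>b\<in>UNIV. (h $ b \<bullet> (G *v (P ** h) $ b)) * mass)"
    unfolding f by (simp add: bochner_sum(2) mom)
  also have "\<dots> = (h \<bullet> (P ** h ** G)) * mass"
  proof -
    have "(P ** h ** G) $ b = transpose G *v (P ** h) $ b" for b
      by (simp add: vec_eq_iff matrix_matrix_mult_def[of "P ** h"] matrix_vector_mult_def transpose_def mult.commute)
    then have "(P ** h ** G) $ b = G *v (P ** h) $ b" for b
      using G unfolding pos_def_def by metis
    then show ?thesis by (simp add: inner_vec_def[of h] sum_distrib_right)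
  qed
  finally show "h \<bullet> (P ** h ** G) > 0" using mass_pos by (simp add: zero_less_mult_iff)
qed

text \<open>The exponential factor is the ratio of the weights at \<open>x + t\<close> and
  x.\<close>

lemma (in gaussian) nn_integral_law_translate:
  fixes t :: "real^'n"
  assumes [measurable]: "f \<in> borel_measurable borel"
  shows "(\<integral>\<^sup>+x. f x \<partial>law) =
    (\<integral>\<^sup>+x. f (x + t) * ennreal (exp (- (t \<bullet> (R *v t)) / 2 - t \<bullet> (R *v x))) \<partial>law)"
proof -
  let ?k = "\<lambda>x. exp (- (t \<bullet> (R *v t)) / 2 - t \<bullet> (R *v x))"
  have "(\<integral>\<^sup>+x. f x \<partial>law) = (\<integral>\<^sup>+x. ennreal (weight x / mass) * f x \<partial>lborel)"
    unfolding law_eq by (rule nn_integral_density) auto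
  also have "\<dots> = (\<integral>\<^sup>+x. ennreal (weight (x + t) / mass) * f (x + t) \<partial>lborel)"
    by (rule nn_integral_translate[symmetric]) measurable
  also have "\<dots> = (\<integral>\<^sup>+x. ennreal (weight x / mass) * (f (x + t) * ennreal (?k x)) \<partial>lborel)"
  proof (rule nn_integral_cong)
    fix x :: "real^'n"
    have "weight (x + t) = weight x * ?k x"
      using selfadj[of x t] by (simp add: weight_def matrix_vector_right_distrib inner_add_left
          inner_add_right inner_commute field_simps flip: exp_add)
    then have "ennreal (weight (x + t) / mass) = ennreal (weight x / mass) * ennreal (?k x)"
      using weight_div_mass_nonneg by (simp flip: ennreal_mult)
    then show "ennreal (weight (x + t) / mass) * f (x + t) = ennreal (weight x / mass) *
        (f (x + t) * ennreal (?k x))"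
      by (simp add: mult_ac)
  qed
  also have "\<dots> = (\<integral>\<^sup>+x. f (x + t) * ennreal (?k x) \<partial>law)"
    unfolding law_eq by (rule nn_integral_density[symmetric]) auto
  finally show ?thesis .
qed

text \<open>It is applied to the pairs of noise and regressor; the error of the estimator is this
  matrix times the inverse of the Gram matrix.\<close>

definition cross :: "'i set \<Rightarrow> ('i \<Rightarrow> (real^'d) \<times> (real^'l)) \<Rightarrow> real^'l^'d" where
  "cross I x = (\<Sum>i\<in>I. outer (fst (x i)) (snd (x i)))"

locale gaussian_pair = E: gaussian \<Sigma> + V: gaussian \<Gamma>
  for \<Sigma> :: "real^'d^'d" and \<Gamma> :: "real^'l^'l"
begin

abbreviation P :: "real^'d^'d" where "P \<equiv> matrix_inv \<Sigma>"
abbreviation P' :: "real^'l^'l" where "P' \<equiv> matrix_inv \<Gamma>"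

definition pair_law :: "((real^'d) \<times> (real^'l)) measure" where
  "pair_law = E.law \<Otimes>\<^sub>M V.law"

lemma sets_pair_law [measurable_cong]: "sets pair_law = sets (borel \<Otimes>\<^sub>M borel)"
  unfolding pair_law_def by (rule sets_pair_measure_cong) auto

sublocale pair_law: prob_space pair_law
  unfolding pair_law_def by (intro prob_space_pair E.law.prob_space_axioms V.law.prob_space_axioms)

text \<open>The likelihood ratio of the translation of each noise vector e by \<open>h *v y\<close>.
  It depends on the sample only through c = \<open>cross\<close> and m = \<open>gram\<close>, and
  its exponent is affine in neither but linear in both jointly, hence multiplicative over the
  rows.\<close>

definition shift_density :: "real^'l^'d \<Rightarrow> real^'l^'d \<Rightarrow> real^'l^'l \<Rightarrow> ennreal" where
  "shift_density h c m = ennreal (exp (- (h \<bullet> (P ** h ** m)) / 2 - h \<bullet> (P ** c)))"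

lemma measurable_shift_density [measurable (raw)]:
  assumes [measurable]: "f \<in> borel_measurable M" "g \<in> borel_measurable M"
  shows "(\<lambda>x. shift_density h (f x) (g x)) \<in> borel_measurable M"
  unfolding shift_density_def by measurable

lemma shift_density_add:
  "shift_density h (c + c') (m + m') = shift_density h c m * shift_density h c' m'"
  unfolding shift_density_def
  by (simp add: matrix_mult_simps inner_add_right add_divide_distrib flip: ennreal_mult exp_add)

lemma shift_density_outer:
  "shift_density h (outer e v) (outer v v) =
    ennreal (exp (- ((h *v v) \<bullet> (P *v (h *v v))) / 2 - (h *v v) \<bullet> (P *v e)))"
  unfolding shift_density_def
  by (simp add: matrix_mult_outer inner_outer matrix_vector_mul_assoc)

lemma nn_integral_pair_law_translate:
  assumes [measurable]: "f \<in> borel_measurable (borel \<Otimes>\<^sub>M borel)"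
  shows "(\<integral>\<^sup>+z. f z \<partial>pair_law) = (\<integral>\<^sup>+z. f (fst z + h *v snd z, snd z) *
    shift_density h (outer (fst z) (snd z)) (outer (snd z) (snd z)) \<partial>pair_law)"
proof -
  interpret pair_sigma_finite E.law V.law by standard
  have [measurable]: "f \<in> borel_measurable (E.law \<Otimes>\<^sub>M V.law)" by measurable
  have "(\<integral>\<^sup>+z. f z \<partial>pair_law) = (\<integral>\<^sup>+v. (\<integral>\<^sup>+e. f (e, v) \<partial>E.law) \<partial>V.law)"
    unfolding pair_law_def by (rule nn_integral_snd[symmetric]) measurable
  also have "\<dots> = (\<integral>\<^sup>+v. (\<integral>\<^sup>+e. f (e + h *v v, v) *
      shift_density h (outer e v) (outer v v) \<partial>E.law) \<partial>V.law)"
    unfolding shift_density_outer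
    by (intro nn_integral_cong E.nn_integral_law_translate) measurable
  also have "\<dots> = (\<integral>\<^sup>+z. f (fst z + h *v snd z, snd z) *
      shift_density h (outer (fst z) (snd z)) (outer (snd z) (snd z)) \<partial>pair_law)"
    unfolding pair_law_def by (subst nn_integral_snd[symmetric]) auto
  finally show ?thesis .
qed

abbreviation pairs :: "'i set \<Rightarrow> ('i \<Rightarrow> (real^'d) \<times> (real^'l)) measure" where
  "pairs I \<equiv> PiM I (\<lambda>_. pair_law)"

lemma measurable_pair [measurable]: "i \<in> I \<Longrightarrow> (\<lambda>x. x i) \<in> measurable (pairs I) (borel \<Otimes>\<^sub>M borel)"
  using measurable_component_singleton[of i I "\<lambda>_. pair_law"]
  by (simp add: measurable_cong_sets[OF refl sets_pair_law])

lemma measurable_cross [measurable]: "cross I \<in> borel_measurable (pairs I)"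
  unfolding cross_def[abs_def]
  by (intro borel_measurable_sum borel_measurable_outer) measurable

lemma measurable_pair_gram [measurable]: "(\<lambda>x. gram I (\<lambda>i. snd (x i))) \<in> borel_measurable (pairs I)"
  by (intro measurable_gram) measurable

text \<open>Induction on the rows. Since \<open>outer (h *v v) v\<close> equals
  \<open>h ** outer v v\<close>, translating the noise shifts \<open>cross\<close> by h times the
  Gram matrix. F is generalized because the new row is absorbed into it before the induction
  hypothesis is applied.\<close>

theorem cameron_martin:
  fixes F :: "(real^'l^'d) \<times> (real^'l^'l) \<Rightarrow> ennreal"
  assumes "finite I" and "F \<in> borel_measurable (borel \<Otimes>\<^sub>M borel)"
  shows "(\<integral>\<^sup>+x. F (cross I x, gram I (\<lambda>i. snd (x i))) \<partial>pairs I) =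
    (\<integral>\<^sup>+x. F (cross I x + h ** gram I (\<lambda>i. snd (x i)), gram I (\<lambda>i. snd (x i))) *
      shift_density h (cross I x) (gram I (\<lambda>i. snd (x i))) \<partial>pairs I)"
  using assms
proof (induction I arbitrary: F rule: finite_induct)
  case empty
  have "shift_density h 0 0 = 1"
    by (simp add: shift_density_def bounded_bilinear.zero_right[OF bilinear_matrix_mult])
  then show ?case
    by (simp add: cross_def gram_def bounded_bilinear.zero_right[OF bilinear_matrix_mult])
next
  case (insert i I)
  note [measurable] = insert.prems
  interpret product_sigma_finite "\<lambda>_. pair_law" by standard
  interpret I: finite_product_sigma_finite "\<lambda>_. pair_law" I by standard (rule insert.hyps)
  interpret pair_sigma_finite "pairs I" pair_law by standard
  let ?M = "\<lambda>x. gram I (\<lambda>i. snd (x i))" and ?C = "cross I"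
  let ?M' = "\<lambda>x. gram (insert i I) (\<lambda>i. snd (x i))" and ?C' = "cross (insert i I)"
  have C: "?C' (x(i := z)) = outer (fst z) (snd z) + ?C x" for x z
    using insert.hyps by (auto simp: cross_def intro!: sum.cong)
  have M: "?M' (x(i := z)) = outer (snd z) (snd z) + ?M x" for x z
    using insert.hyps by (auto simp: gram_def intro!: sum.cong)
  let ?F = "\<lambda>c z x. F (outer (fst z) (snd z) + c, outer (snd z) (snd z) + ?M x)"
  let ?k = "\<lambda>x. shift_density h (?C x) (?M x)" and ?c = "\<lambda>x. ?C x + h ** ?M x"
  let ?F' = "\<lambda>x. F (?C' x + h ** ?M' x, ?M' x) * shift_density h (?C' x) (?M' x)"
  have "(\<integral>\<^sup>+x. F (?C' x, ?M' x) \<partial>pairs (insert i I)) = (\<integral>\<^sup>+z. (\<integral>\<^sup>+x. ?F (?C x) z x \<partial>pairs I) \<partial>pair_law)"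
    by (subst product_nn_integral_insert_rev[OF insert.hyps(1,2)]) (measurable, simp only: C M)
  also have "\<dots> = (\<integral>\<^sup>+z. (\<integral>\<^sup>+x. ?F (?c x) z x * ?k x \<partial>pairs I) \<partial>pair_law)"
  proof (rule nn_integral_cong)
    fix z :: "(real^'d) \<times> (real^'l)"
    have "(\<lambda>w. F (outer (fst z) (snd z) + fst w, outer (snd z) (snd z) + snd w))
        \<in> borel_measurable (borel \<Otimes>\<^sub>M borel)"
      by measurable
    from insert.IH[OF this] show "(\<integral>\<^sup>+x. ?F (?C x) z x \<partial>pairs I) = (\<integral>\<^sup>+x. ?F (?c x) z x * ?k x \<partial>pairs I)"
      by simp
  qed
  also have "\<dots> = (\<integral>\<^sup>+x. (\<integral>\<^sup>+z. ?F (?c x) z x * ?k x \<partial>pair_law) \<partial>pairs I)"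
    by (rule Fubini') measurable
  also have "\<dots> = (\<integral>\<^sup>+x. (\<integral>\<^sup>+z. ?F' (x(i := z)) \<partial>pair_law) \<partial>pairs I)"
  proof (rule nn_integral_cong)
    fix x :: "'a \<Rightarrow> (real^'d) \<times> (real^'l)"
    have o: "outer (e + h *v v) v + ?c x = outer e v + ?C x + h ** (outer v v + ?M x)" for e v
      by (simp add: matrix_mult_outer matrix_mult_simps(2)
          bounded_bilinear.add_left[OF bilinear_outer])
    have "(\<lambda>z. ?F (?c x) z x * ?k x) \<in> borel_measurable (borel \<Otimes>\<^sub>M borel)" by measurable
    from nn_integral_pair_law_translate[OF this, of h]
    show "(\<integral>\<^sup>+z. ?F (?c x) z x * ?k x \<partial>pair_law) = (\<integral>\<^sup>+z. ?F' (x(i := z)) \<partial>pair_law)"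
      unfolding C M o shift_density_add fst_conv snd_conv
      by (simp only: mult.assoc mult.commute[of "?k x"])
  qed
  also have "\<dots> = (\<integral>\<^sup>+x. ?F' x \<partial>pairs (insert i I))"
    using insert.hyps by (intro product_nn_integral_insert[symmetric]) measurable
  finally show ?case .
qed

end

section \<open>The regression error\<close>

locale regression = gaussian_pair \<Sigma> \<Gamma> + prob_space M
  for M :: "'w measure" and \<Sigma> :: "real^'d^'d" and \<Gamma> :: "real^'l^'l" +
  fixes e :: "nat \<Rightarrow> 'w \<Rightarrow> real^'d" and y :: "nat \<Rightarrow> 'w \<Rightarrow> real^'l"
  assumes indep: "indep_vars (\<lambda>_. borel) (\<lambda>i w. (e i w, y i w)) UNIV"
    and law: "\<And>i. distr M borel (\<lambda>w. (e i w, y i w)) = pair_law"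
begin

lemma measurable_e [measurable]: "e i \<in> borel_measurable M"
  and measurable_y [measurable]: "y i \<in> borel_measurable M"
proof -
  have "(\<lambda>w. (e i w, y i w)) \<in> measurable M (borel \<Otimes>\<^sub>M borel)"
    using indep unfolding indep_vars_def borel_prod by auto
  from measurable_compose[OF this measurable_fst] measurable_compose[OF this measurable_snd]
  show "e i \<in> borel_measurable M" "y i \<in> borel_measurable M" by simp_all
qed

lemma law_y: "distr M borel (y i) = V.law"
proof (rule measure_eqI)
  fix A assume "A \<in> sets (distr M borel (y i))"
  then have A [measurable]: "A \<in> sets borel" by simp
  have [measurable]: "UNIV \<times> A \<in> sets (borel :: ((real^'d) \<times> (real^'l)) measure)"
    by (subst borel_prod[symmetric]) auto
  have "emeasure (distr M borel (y i)) A = emeasure M (y i -` A \<inter> space M)"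
    by (simp add: emeasure_distr)
  also have "y i -` A \<inter> space M = (\<lambda>w. (e i w, y i w)) -` (UNIV \<times> A) \<inter> space M" by auto
  also have "emeasure M \<dots> = emeasure (distr M borel (\<lambda>w. (e i w, y i w))) (UNIV \<times> A)"
    by (subst emeasure_distr) (auto simp: borel_prod[symmetric])
  also have "\<dots> = emeasure E.law UNIV * emeasure V.law A"
    unfolding law pair_law_def by (rule V.law.emeasure_pair_measure_Times) auto
  finally show "emeasure (distr M borel (y i)) A = emeasure V.law A"
    using E.law.emeasure_space_1 by simp
qed simp

lemma distr_restrict_eq_PiM:
  assumes "indep_vars (\<lambda>_. borel) Z UNIV" "\<And>i. distr M borel (Z i) = D" "N > 0"
  shows "distr M (PiM {..<N} (\<lambda>_. borel)) (\<lambda>w. \<lambda>i\<in>{..<N}. Z i w) = PiM {..<N} (\<lambda>_. D)"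
proof -
  have rv: "random_variable borel (Z i)" for i using assms(1) unfolding indep_vars_def by simp
  have "indep_vars (\<lambda>_. borel) Z {..<N}" by (rule indep_vars_subset[OF assms(1)]) simp
  moreover have "{..<N} \<noteq> {}" using assms(3) by (auto simp: lessThan_empty_iff)
  ultimately show ?thesis
    using indep_vars_iff_distr_eq_PiM'[where I = "{..<N}" and M' = "\<lambda>_. borel" and X = Z] rv assms(2) by simp
qed

lemma distr_pairs:
  "N > 0 \<Longrightarrow> distr M (PiM {..<N} (\<lambda>_. borel)) (\<lambda>w. \<lambda>i\<in>{..<N}. (e i w, y i w)) = pairs {..<N}"
  by (rule distr_restrict_eq_PiM[OF indep law])

lemma indep_y: "indep_vars (\<lambda>_. borel) y UNIV"
proof -
  have "(snd :: (real^'d) \<times> (real^'l) \<Rightarrow> _) \<in> borel_measurable borel"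
    by (subst borel_prod[symmetric]) measurable
  from indep_vars_compose2[OF indep, where Y = "\<lambda>_. snd", OF this] show ?thesis by simp
qed

definition G :: "nat \<Rightarrow> 'w \<Rightarrow> real^'l^'l" where
  "G N w = gram {..<N} (\<lambda>i. y i w)"

text \<open>A default inverse enters where \<open>G N w\<close> is singular, which for N \<ge> L + 2
  is a null event.\<close>

definition H :: "nat \<Rightarrow> 'w \<Rightarrow> real^'l^'d" where
  "H N w = cross {..<N} (\<lambda>i. (e i w, y i w)) ** matrix_inv (G N w)"

lemma measurable_G [measurable]: "G N \<in> borel_measurable M"
  unfolding G_def[abs_def] by measurable

lemma measurable_H [measurable]: "H N \<in> borel_measurable M"
  unfolding H_def[abs_def] cross_def by measurable

lemma measurable_restrict_pair [measurable]:
  "(\<lambda>w. \<lambda>i\<in>{..<N}. (e i w, y i w)) \<in> measurable M (PiM {..<N} (\<lambda>_. borel))"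
  by (intro measurable_restrict) (auto simp: borel_prod[symmetric])

lemma distr_G:
  assumes "N > 0"
  shows "distr M borel (G N) = distr (V.sample {..<N}) borel (gram {..<N})"
proof -
  let ?Y = "\<lambda>w. \<lambda>i\<in>{..<N}. y i w"
  have Y: "?Y \<in> measurable M (PiM {..<N} (\<lambda>_. borel))" by (intro measurable_restrict) auto
  have g: "gram {..<N} \<in> borel_measurable (PiM {..<N} (\<lambda>_. borel :: (real^'l) measure))"
    by (intro measurable_gram) measurable
  have "gram {..<N} \<circ> ?Y = G N" by (auto simp: G_def gram_def intro!: sum.cong)
  then show ?thesis unfolding distr_restrict_eq_PiM[OF indep_y law_y assms, symmetric]
    by (simp add: distr_distr[OF g Y])
qed

context
  fixes N :: nat
  assumes N: "N \<ge> CARD('l) + 2"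
begin

lemma N_pos: "N > 0" using N by simp

lemma AE_invertible_G: "AE w in M. invertible (G N w)"
proof -
  have "AE W in distr M borel (G N). invertible W"
    unfolding distr_G[OF N_pos] using N borel_open[OF open_invertible]
    by (subst AE_distr_iff) (auto intro: V.AE_invertible_gram)
  from AE_distrD[OF measurable_G this] show ?thesis .
qed

lemma AE_pos_def_G: "AE w in M. pos_def (G N w)"
  using AE_invertible_G by eventually_elim (auto simp: G_def intro: pos_def_gram)

lemma inv_G_quadratic:
  shows "integrable M (\<lambda>w. u \<bullet> (matrix_inv (G N w) *v u))"
    and "expectation (\<lambda>w. u \<bullet> (matrix_inv (G N w) *v u)) =
      u \<bullet> (P' *v u) / (real N - real CARD('l) - 1)"
proof -
  let ?f = "\<lambda>W :: real^'l^'l. u \<bullet> (matrix_inv W *v u)"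
  have [measurable]: "?f \<in> borel_measurable borel" by measurable
  have "integrable (distr M borel (G N)) ?f"
    "integral\<^sup>L (distr M borel (G N)) ?f = u \<bullet> (P' *v u) / (real N - real CARD('l) - 1)"
    unfolding distr_G[OF N_pos] using N V.integrable_inv_gram[of "{..<N}" u] V.inv_gram_mean[of "{..<N}" u]
    by (simp_all add: integrable_distr_eq integral_distr)
  then show "integrable M (\<lambda>w. ?f (G N w))"
    "expectation (\<lambda>w. ?f (G N w)) = u \<bullet> (P' *v u) / (real N - real CARD('l) - 1)"
    by (simp_all add: integrable_distr_eq integral_distr)
qed

text \<open>Polarization: the entries of a symmetric matrix are combinations of its quadratic form
  at axis vectors and at sums of two of them. Symmetry of the inverse holds almost surely.\<close>

lemma inv_G_mean:
  shows "integrable M (\<lambda>w. matrix_inv (G N w) \<bullet> X)"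
    and "expectation (\<lambda>w. matrix_inv (G N w) \<bullet> X) = (P' \<bullet> X) / (real N - real CARD('l) - 1)"
proof -
  let ?k = "real N - real CARD('l) - 1"
  let ?W = "\<lambda>w. matrix_inv (G N w)"
  let ?a = "\<lambda>j. axis j (1::real) :: real^'l"
  let ?q = "\<lambda>j k W. ((?a j + ?a k) \<bullet> (W *v (?a j + ?a k)) - ?a j \<bullet> (W *v ?a j) - ?a k \<bullet> (W *v ?a k)) / 2"
  have q: "?q j k W = W $ j $ k" if "transpose W = W" for j k and W :: "real^'l^'l"
  proof -
    have "transpose W $ k $ j = W $ k $ j" using that by simp
    then show ?thesis
      by (simp add: matrix_vector_right_distrib inner_add_left inner_add_right axis_inner_mult transpose_def)
  qed
  have W: "AE w in M. ?q j k (?W w) = ?W w $ j $ k" for j k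
    using AE_pos_def_G by eventually_elim (rule q, use pos_def_matrix_inv in \<open>auto simp: pos_def_def\<close>)
  have ii: "integrable M (\<lambda>w. ?q j k (?W w))" for j k using inv_G_quadratic(1) by auto
  have i: "integrable M (\<lambda>w. ?W w $ j $ k)" for j k
    by (rule integrable_cong_AE_imp[OF ii[of j k]]) (use W in auto)
  have m: "expectation (\<lambda>w. ?W w $ j $ k) = P' $ j $ k / ?k" for j k
  proof -
    have "expectation (\<lambda>w. ?W w $ j $ k) = expectation (\<lambda>w. ?q j k (?W w))"
      by (rule integral_cong_AE[OF _ _ W, symmetric]) measurable
    also have "\<dots> = ?q j k P' / ?k"
      using inv_G_quadratic(1) by (simp add: inv_G_quadratic(2) diff_divide_distrib mult.commute)
    also have "?q j k P' = P' $ j $ k"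
      using pos_def_matrix_inv[OF V.pos_def] by (intro q) (simp add: pos_def_def)
    finally show ?thesis .
  qed
  have X: "W \<bullet> X = (\<Sum>j\<in>UNIV. \<Sum>k\<in>UNIV. W $ j $ k * X $ j $ k)" for W by (simp add: inner_vec_def)
  show "integrable M (\<lambda>w. ?W w \<bullet> X)"
    unfolding X by (intro bochner_sum(1) integrable_mult_left i)
  have "expectation (\<lambda>w. ?W w \<bullet> X) = (\<Sum>j\<in>UNIV. \<Sum>k\<in>UNIV. P' $ j $ k / ?k * X $ j $ k)"
    unfolding X by (simp add: bochner_sum i m)
  then show "expectation (\<lambda>w. ?W w \<bullet> X) = (P' \<bullet> X) / ?k"
    unfolding X by (simp add: sum_divide_distrib)
qed

lemma nn_integral_cross_gram:
  assumes [measurable]: "F \<in> borel_measurable (borel \<Otimes>\<^sub>M borel)"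
  shows "(\<integral>\<^sup>+w. F (cross {..<N} (\<lambda>i. (e i w, y i w)), G N w) \<partial>M) =
    (\<integral>\<^sup>+x. F (cross {..<N} x, gram {..<N} (\<lambda>i. snd (x i))) \<partial>pairs {..<N})"
proof -
  let ?f = "\<lambda>x. F (cross {..<N} x, gram {..<N} (\<lambda>i. snd (x i)))"
  have "?f \<in> borel_measurable (pairs {..<N})" by measurable
  also have "sets (pairs {..<N}) = sets (PiM {..<N} (\<lambda>_. borel))"
    by (intro sets_PiM_cong refl, unfold sets_pair_law borel_prod) simp
  then have "borel_measurable (pairs {..<N}) = (borel_measurable (PiM {..<N} (\<lambda>_. borel)) :: (_ \<Rightarrow> ennreal) set)"
    by (intro measurable_cong_sets) auto
  finally have meas: "?f \<in> borel_measurable (PiM {..<N} (\<lambda>_. borel))" .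
  have "cross {..<N} (\<lambda>i\<in>{..<N}. (e i w, y i w)) = cross {..<N} (\<lambda>i. (e i w, y i w))"
    "gram {..<N} (\<lambda>j. snd ((\<lambda>i\<in>{..<N}. (e i w, y i w)) j)) = G N w" for w
    unfolding cross_def gram_def G_def by (auto intro!: sum.cong)
  then show ?thesis unfolding distr_pairs[OF N_pos, symmetric]
    by (subst nn_integral_distr[OF measurable_restrict_pair]) (use meas in simp_all)
qed

text \<open>Multiplied by the inverse of G, the shift of \<open>cross\<close> by
  \<open>h ** G\<close> becomes the shift of H by h. In the likelihood ratio \<open>cross\<close> is
  replaced by \<open>H ** G\<close>, which leaves the form of the Gaussian with precision
  \<open>\<lambda>h. P ** h ** G\<close>.\<close>

lemma quasi_invariant_H: "quasi_invariant M (H N) (G N) (\<lambda>g h. P ** h ** g)"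
proof
  show "H N \<in> borel_measurable M" "G N \<in> borel_measurable M" by measurable
  show "(\<lambda>z. P ** snd z ** fst z) \<in> borel_measurable (borel \<Otimes>\<^sub>M borel)" by measurable
  show "AE w in M. positive_form (\<lambda>h. P ** h ** G N w)"
    using AE_pos_def_G by eventually_elim (simp add: positive_form_matrix_mult pos_def_matrix_inv E.pos_def)
  fix F :: "(real^'l^'d) \<times> (real^'l^'l) \<Rightarrow> ennreal" and h :: "real^'l^'d"
  assume [measurable]: "F \<in> borel_measurable (borel \<Otimes>\<^sub>M borel)"
  let ?C = "\<lambda>w. cross {..<N} (\<lambda>i. (e i w, y i w))"
  define F1 where "F1 = (\<lambda>z. F (fst z ** matrix_inv (snd z), snd z))"
  define F2 where "F2 = (\<lambda>z. F1 (fst z + h ** snd z, snd z) * shift_density h (fst z) (snd z))"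
  have F1: "F1 \<in> borel_measurable (borel \<Otimes>\<^sub>M borel)"
    unfolding F1_def by measurable
  then have F2: "F2 \<in> borel_measurable (borel \<Otimes>\<^sub>M borel)"
    unfolding F2_def by measurable
  have "(\<integral>\<^sup>+w. F (H N w, G N w) \<partial>M) = (\<integral>\<^sup>+w. F1 (?C w, G N w) \<partial>M)" by (simp add: F1_def H_def)
  also have "\<dots> = (\<integral>\<^sup>+w. F2 (?C w, G N w) \<partial>M)"
    unfolding nn_integral_cross_gram[OF F1] nn_integral_cross_gram[OF F2]
    unfolding F2_def fst_conv snd_conv by (rule cameron_martin[OF _ F1]) simp
  also have "\<dots> = (\<integral>\<^sup>+w. F (H N w + h, G N w) *
      ennreal (exp (- (h \<bullet> (P ** h ** G N w)) / 2 - h \<bullet> (P ** H N w ** G N w))) \<partial>M)"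
  proof (rule nn_integral_cong_AE, use AE_invertible_G in eventually_elim)
    case (elim w)
    have "(?C w + h ** G N w) ** matrix_inv (G N w) = H N w + h"
      using elim by (simp add: H_def matrix_mult_simps matrix_inv_right flip: matrix_mul_assoc)
    moreover have "?C w = H N w ** G N w"
      using elim by (simp add: H_def matrix_inv_left flip: matrix_mul_assoc)
    ultimately show ?case
      unfolding F2_def F1_def by (simp add: shift_density_def matrix_mul_assoc)
  qed
  finally show "(\<integral>\<^sup>+w. F (H N w, G N w) \<partial>M) = (\<integral>\<^sup>+w. F (H N w + h, G N w) *
      ennreal (exp (- (h \<bullet> (P ** h ** G N w)) / 2 - h \<bullet> (P ** H N w ** G N w))) \<partial>M)" .
qed

end

end

section \<open>Moments of the error and convergence in probability\<close>

lemma norm_matrix_square: "(norm (A :: real^'m^'n))\<^sup>2 = (\<Sum>i\<in>UNIV. \<Sum>j\<in>UNIV. (A $ i $ j)\<^sup>2)"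
  unfolding power2_norm_eq_inner by (simp add: inner_vec_def power2_eq_square)

text \<open>Chebyshev's inequality. Integrability is asked for only eventually, since the second
  moments of \<open>H N\<close> are available only from N = L + 2 on.\<close>

lemma (in prob_space) prob_norm_ge_tendsto_0:
  fixes Z :: "nat \<Rightarrow> 'a \<Rightarrow> 'b::euclidean_space"
  assumes [measurable]: "\<And>n. Z n \<in> borel_measurable M"
    and int: "\<forall>\<^sub>F n in sequentially. integrable M (\<lambda>w. (norm (Z n w))\<^sup>2)"
    and lim: "(\<lambda>n. expectation (\<lambda>w. (norm (Z n w))\<^sup>2)) \<longlonglongrightarrow> 0"
    and d: "d > 0"
  shows "(\<lambda>n. prob {w \<in> space M. d \<le> norm (Z n w)}) \<longlonglongrightarrow> 0"
proof (rule tendsto_sandwich[OF _ _ tendsto_const])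
  show "\<forall>\<^sub>F n in sequentially. 0 \<le> prob {w \<in> space M. d \<le> norm (Z n w)}" by simp
  show "\<forall>\<^sub>F n in sequentially. prob {w \<in> space M. d \<le> norm (Z n w)} \<le>
      expectation (\<lambda>w. (norm (Z n w))\<^sup>2) / d\<^sup>2"
    using int
  proof eventually_elim
    case (elim n)
    have "{w \<in> space M. d \<le> norm (Z n w)} = {w \<in> space M. d\<^sup>2 \<le> (norm (Z n w))\<^sup>2}"
      using d by (auto simp: power2_le_iff_abs_le)
    then show ?case using integral_Markov_inequality_measure[OF elim, of "{}" "d\<^sup>2"] d by simp
  qed
  show "(\<lambda>n. expectation (\<lambda>w. (norm (Z n w))\<^sup>2) / d\<^sup>2) \<longlonglongrightarrow> 0"
    using tendsto_divide[OF lim tendsto_const, of "d\<^sup>2"] d by simp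
qed

context regression
begin

context
  fixes N :: nat
  assumes N: "N \<ge> CARD('l) + 2"
begin

interpretation H: quasi_invariant M "H N" "G N" "\<lambda>g h. P ** h ** g"
  by (rule quasi_invariant_H[OF N])

lemma prob_quadratic_form_le:
  "prob {w \<in> space M. H N w \<bullet> (P ** H N w ** G N w) \<le> r} = cdf (chi_square (CARD('d) * CARD('l))) r"
  using H.prob_form_le by simp

text \<open>Given G, the covariance operator of H maps v to
  \<open>\<Sigma> ** v ** matrix_inv G\<close>, the inverse of the precision. Its expectation is
  linear in the inverse of G and so is known from \<open>inv_G_mean\<close>.\<close>

lemma second_moment_H:
  shows "integrable M (\<lambda>w. (H N w \<bullet> v)\<^sup>2)"
    and "expectation (\<lambda>w. (H N w \<bullet> v)\<^sup>2) = v \<bullet> (\<Sigma> ** v ** P') / (real N - real CARD('l) - 1)"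
proof -
  let ?k = "real N - real CARD('l) - 1"
  let ?V = "\<lambda>g. \<Sigma> ** v ** matrix_inv g"
  have eq: "v \<bullet> ?V g = matrix_inv g \<bullet> (transpose (\<Sigma> ** v) ** v)" for g
    using inner_matrix_mult_left[of "\<Sigma> ** v" "matrix_inv g" v] by (simp add: inner_commute)
  have "AE w in M. v = P ** ?V (G N w) ** G N w"
    using AE_invertible_G[OF N]
  proof eventually_elim
    case (elim w)
    have "P ** ?V (G N w) ** G N w = (P ** \<Sigma>) ** v ** (matrix_inv (G N w) ** G N w)"
      by (simp only: matrix_mul_assoc)
    then show ?case using elim by (simp add: matrix_inv_left pos_def_invertible[OF E.pos_def])
  qed
  from H.nn_second_moment[OF this]
  have nn: "(\<integral>\<^sup>+w. ennreal ((H N w \<bullet> v)\<^sup>2) \<partial>M) = (\<integral>\<^sup>+w. ennreal (v \<bullet> ?V (G N w)) \<partial>M)" .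
  have pos: "AE w in M. 0 \<le> v \<bullet> ?V (G N w)"
    using AE_pos_def_G[OF N]
  proof eventually_elim
    case (elim w)
    interpret positive_form "\<lambda>h. \<Sigma> ** h ** matrix_inv (G N w)"
      by (rule positive_form_matrix_mult[OF E.pos_def pos_def_matrix_inv[OF elim]])
    show ?case by (rule form_nonneg)
  qed
  have int: "integrable M (\<lambda>w. v \<bullet> ?V (G N w))" unfolding eq by (rule inv_G_mean(1)[OF N])
  have "(\<integral>\<^sup>+w. ennreal (v \<bullet> ?V (G N w)) \<partial>M) = ennreal (expectation (\<lambda>w. v \<bullet> ?V (G N w)))"
    by (rule nn_integral_eq_integral[OF int pos])
  also have "expectation (\<lambda>w. v \<bullet> ?V (G N w)) = v \<bullet> ?V \<Gamma> / ?k"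
    unfolding eq by (rule inv_G_mean(2)[OF N])
  finally have nn': "(\<integral>\<^sup>+w. ennreal ((H N w \<bullet> v)\<^sup>2) \<partial>M) = ennreal (v \<bullet> ?V \<Gamma> / ?k)" using nn by simp
  interpret positive_form "\<lambda>h. \<Sigma> ** h ** P'"
    by (rule positive_form_matrix_mult[OF E.pos_def pos_def_matrix_inv[OF V.pos_def]])
  have k: "v \<bullet> ?V \<Gamma> / ?k \<ge> 0"
    using N by (intro divide_nonneg_nonneg form_nonneg) auto
  show "integrable M (\<lambda>w. (H N w \<bullet> v)\<^sup>2)" by (rule integrableI_nonneg) (auto simp: nn')
  show "expectation (\<lambda>w. (H N w \<bullet> v)\<^sup>2) = v \<bullet> ?V \<Gamma> / ?k"
    by (subst integral_eq_nn_integral) (auto simp: nn' k)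
qed

text \<open>Polarization of \<open>second_moment_H\<close>.\<close>

lemma covariance_H:
  shows "integrable M (\<lambda>w. (H N w \<bullet> u) * (H N w \<bullet> v))"
    and "expectation (\<lambda>w. (H N w \<bullet> u) * (H N w \<bullet> v)) =
      u \<bullet> (\<Sigma> ** v ** P') / (real N - real CARD('l) - 1)"
proof -
  let ?k = "real N - real CARD('l) - 1"
  interpret positive_form "\<lambda>h. \<Sigma> ** h ** P'"
    by (rule positive_form_matrix_mult[OF E.pos_def pos_def_matrix_inv[OF V.pos_def]])
  have eq: "(h \<bullet> u) * (h \<bullet> v) = ((h \<bullet> (u + v))\<^sup>2 - (h \<bullet> (u - v))\<^sup>2) / 4" for h
    by (simp add: inner_add_right inner_diff_right power2_eq_square algebra_simps)
  show "integrable M (\<lambda>w. (H N w \<bullet> u) * (H N w \<bullet> v))" unfolding eq using second_moment_H(1) by auto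
  have "expectation (\<lambda>w. (H N w \<bullet> u) * (H N w \<bullet> v)) =
      ((u + v) \<bullet> (\<Sigma> ** (u + v) ** P') / ?k - (u - v) \<bullet> (\<Sigma> ** (u - v) ** P') / ?k) / 4"
    unfolding eq using second_moment_H(1) by (simp add: second_moment_H(2))
  also have "\<dots> = u \<bullet> (\<Sigma> ** v ** P') / ?k"
  proof -
    have "(u + v) \<bullet> (\<Sigma> ** (u + v) ** P') - (u - v) \<bullet> (\<Sigma> ** (u - v) ** P') =
        4 * (u \<bullet> (\<Sigma> ** v ** P'))"
      using selfadj[of v u] by (simp add: linear_add[OF lin] linear_diff[OF lin] inner_add_left
          inner_add_right inner_diff_left inner_diff_right inner_commute)
    moreover have "4 * c / k / 4 = c / k" for c k :: real by simp
    ultimately show ?thesis by (simp only: diff_divide_distrib[symmetric])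
  qed
  finally show "expectation (\<lambda>w. (H N w \<bullet> u) * (H N w \<bullet> v)) = u \<bullet> (\<Sigma> ** v ** P') / ?k" .
qed

lemma integrable_H: "integrable M (\<lambda>w. H N w \<bullet> v)"
  by (rule square_integrable_imp_integrable[OF _ second_moment_H(1)]) measurable

lemma mean_H: "expectation (\<lambda>w. H N w \<bullet> v) = 0"
  by (rule H.first_moment_zero[OF integrable_H])

end

lemma H_tendsto_0_in_prob:
  assumes "d > 0"
  shows "(\<lambda>N. prob {w \<in> space M. d \<le> norm (H N w)}) \<longlonglongrightarrow> 0"
proof (rule prob_norm_ge_tendsto_0[OF measurable_H _ _ assms])
  let ?b = "Basis :: (real^'l^'d) set"
  have n: "(norm h)\<^sup>2 = (\<Sum>b\<in>?b. (h \<bullet> b)\<^sup>2)" for h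
    unfolding power2_norm_eq_inner by (subst euclidean_inner) (simp add: power2_eq_square)
  have ev: "\<forall>\<^sub>F N in sequentially. N \<ge> CARD('l) + 2" by (rule eventually_ge_at_top)
  then show "\<forall>\<^sub>F N in sequentially. integrable M (\<lambda>w. (norm (H N w))\<^sup>2)"
    unfolding n by eventually_elim (intro bochner_sum(1) second_moment_H)
  let ?c = "\<Sum>b\<in>?b. b \<bullet> (\<Sigma> ** b ** P')"
  have "\<forall>\<^sub>F N in sequentially. ?c / (real N - real CARD('l) - 1) = expectation (\<lambda>w. (norm (H N w))\<^sup>2)"
    using ev unfolding n
    by eventually_elim (simp add: bochner_sum(2) second_moment_H sum_divide_distrib)
  moreover have "(\<lambda>N. ?c / (real N - real CARD('l) - 1)) \<longlonglongrightarrow> 0"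
  proof (rule tendsto_divide_0[OF tendsto_const], rule filterlim_at_top_imp_at_infinity)
    have "filterlim (\<lambda>N. - (real CARD('l) + 1) + real N) at_top sequentially"
      by (rule filterlim_tendsto_add_at_top[OF tendsto_const filterlim_real_sequentially])
    then show "filterlim (\<lambda>N. real N - real CARD('l) - 1) at_top sequentially"
      by (simp add: algebra_simps)
  qed
  ultimately show "(\<lambda>N. expectation (\<lambda>w. (norm (H N w))\<^sup>2)) \<longlonglongrightarrow> 0"
    by (rule Lim_transform_eventually[rotated])
qed

lemma law_y_transfer:
  fixes f :: "real^'l \<Rightarrow> real"
  assumes [measurable]: "f \<in> borel_measurable borel"
  shows "integrable M (\<lambda>w. f (y i w)) \<longleftrightarrow> integrable V.law f"
    and "expectation (\<lambda>w. f (y i w)) = (\<integral>v. f v \<partial>V.law)"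
  unfolding law_y[of i, symmetric] by (simp_all add: integrable_distr_eq integral_distr)

text \<open>Chebyshev for each entry. The variables \<open>Z j k i\<close> are centred and
  independent over the rows i, so the mixed products have mean 0 and the squared sum has mean N
  times a constant; the division by N^2 leaves a multiple of 1 / N.\<close>

lemma G_law_of_large_numbers:
  assumes "d > 0"
  shows "(\<lambda>N. prob {w \<in> space M. d \<le> norm (G N w /\<^sub>R real N - \<Gamma>)}) \<longlonglongrightarrow> 0"
proof (rule prob_norm_ge_tendsto_0[OF _ _ _ assms])
  define f where "f j k = (\<lambda>v :: real^'l. v $ j * v $ k - \<Gamma> $ j $ k)" for j k
  define Z where "Z j k i w = f j k (y i w)" for j k i w
  define s where "s j k = (\<integral>v. (f j k v)\<^sup>2 \<partial>V.law)" for j k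
  have [measurable]: "f j k \<in> borel_measurable borel" for j k unfolding f_def by measurable
  have f_int: "integrable V.law (\<lambda>v. (f j k v)\<^sup>2)" for j k
  proof (rule V.integrable_law_bound)
    fix v
    have "\<bar>v $ j * v $ k\<bar> \<le> norm v * norm v"
      unfolding abs_mult by (intro mult_mono component_le_norm_cart) auto
    then have "\<bar>f j k v\<bar> \<le> (norm v)\<^sup>2 + \<bar>\<Gamma> $ j $ k\<bar>" unfolding f_def power2_eq_square by linarith
    also have "\<dots> \<le> (1 + \<bar>\<Gamma> $ j $ k\<bar>) * (1 + (norm v)\<^sup>2)" by (simp add: algebra_simps)
    finally show "\<bar>(f j k v)\<^sup>2\<bar> \<le> (1 + \<bar>\<Gamma> $ j $ k\<bar>)\<^sup>2 * (1 + (norm v)\<^sup>2)\<^sup>2"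
      using power_mono[of "\<bar>f j k v\<bar>" _ 2] by (simp flip: power_mult_distrib)
  qed measurable
  have f_int1: "integrable V.law (f j k)" for j k
    by (rule V.law.square_integrable_imp_integrable[OF _ f_int]) measurable
  have int1: "integrable M (Z j k i)" "integrable M (\<lambda>w. (Z j k i w)\<^sup>2)" for j k i
    using f_int f_int1 law_y_transfer(1)[of "f j k" i] law_y_transfer(1)[of "\<lambda>v. (f j k v)\<^sup>2" i]
    by (simp_all add: Z_def[abs_def])
  have "integrable V.law (\<lambda>v. v $ j * v $ k)" for j k
    using Bochner_Integration.integrable_add[OF f_int1[of j k] V.law.integrable_const[of "\<Gamma> $ j $ k"]]
    by (simp add: f_def)
  then have mean: "expectation (Z j k i) = 0" for j k i using law_y_transfer(2)[of "f j k" i]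
    by (simp add: Z_def[abs_def] f_def V.law_second_moment V.law.prob_space[unfolded V.space_law])
  have var: "expectation (\<lambda>w. (Z j k i w)\<^sup>2) = s j k" for j k i
    unfolding s_def Z_def by (rule law_y_transfer(2)) measurable
  have "indep_vars (\<lambda>_. borel) (Z j k) UNIV" for j k
    unfolding Z_def[abs_def] by (rule indep_vars_compose2[OF indep_y]) measurable
  then have indep: "indep_vars (\<lambda>_. borel) (Z j k) I" for j k I by (rule indep_vars_subset) simp
  have prods: "integrable M (\<lambda>w. Z j k i w * Z j k i' w)"
    "expectation (\<lambda>w. Z j k i w * Z j k i' w) = (if i = i' then s j k else 0)" for j k i i'
    using int1[of j k] var[of j k i] mean[of j k]
      indep_vars_integrable[of "{i, i'}" "Z j k", OF _ indep]
      indep_vars_lebesgue_integral[of "{i, i'}" "Z j k", OF _ indep]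
    by (cases "i = i'"; auto simp: power2_eq_square)+
  have sq: "(\<Sum>i<N. Z j k i w)\<^sup>2 = (\<Sum>i<N. \<Sum>i'<N. Z j k i w * Z j k i' w)" for j k N w
    by (simp add: power2_eq_square sum_product)
  have int2: "integrable M (\<lambda>w. (\<Sum>i<N. Z j k i w)\<^sup>2)" for j k N
    unfolding sq by (intro bochner_sum(1) prods)
  have var2: "expectation (\<lambda>w. (\<Sum>i<N. Z j k i w)\<^sup>2) = real N * s j k" for j k N
    unfolding sq by (simp add: bochner_sum prods
        if_distrib cong: if_cong)
  have entry: "(G N w /\<^sub>R real N - \<Gamma>) $ j $ k = (\<Sum>i<N. Z j k i w) / real N" if "N > 0" for N w j k
    using that by (simp add: G_def gram_def outer_def Z_def f_def sum_subtractf field_simps)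
  have norm: "(norm (G N w /\<^sub>R real N - \<Gamma>))\<^sup>2 = (\<Sum>j\<in>UNIV. \<Sum>k\<in>UNIV. (\<Sum>i<N. Z j k i w)\<^sup>2 / (real N)\<^sup>2)"
    if "N > 0" for N w
    unfolding norm_matrix_square entry[OF that] by (simp add: power_divide)
  show "(\<lambda>w. G n w /\<^sub>R real n - \<Gamma>) \<in> borel_measurable M" for n by measurable
  have ev: "\<forall>\<^sub>F N in sequentially. N > (0::nat)" by (rule eventually_gt_at_top)
  then show "\<forall>\<^sub>F n in sequentially. integrable M (\<lambda>w. (norm (G n w /\<^sub>R real n - \<Gamma>))\<^sup>2)"
  proof eventually_elim
    case (elim n)
    then show ?case unfolding norm[OF elim] by (intro bochner_sum(1) integrable_divide int2)
  qed
  let ?c = "\<Sum>j\<in>UNIV. \<Sum>k\<in>UNIV. s j k"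
  have "\<forall>\<^sub>F n in sequentially. ?c / real n = expectation (\<lambda>w. (norm (G n w /\<^sub>R real n - \<Gamma>))\<^sup>2)"
    using ev
  proof eventually_elim
    case (elim n)
    have "real n * s j k / (real n)\<^sup>2 = s j k / real n" for j k
      using elim by (simp add: power2_eq_square)
    then show ?case unfolding norm[OF elim]
      by (simp add: bochner_sum int2 var2
          sum_divide_distrib)
  qed
  moreover have "(\<lambda>n. ?c / real n) \<longlonglongrightarrow> 0" by (rule lim_const_over_n)
  ultimately show "(\<lambda>n. expectation (\<lambda>w. (norm (G n w /\<^sub>R real n - \<Gamma>))\<^sup>2)) \<longlonglongrightarrow> 0"
    by (rule Lim_transform_eventually[rotated])
qed

end

section \<open>The delta method\<close>

lemma kron_nth: "(X \<otimes>\<^sub>k Y) $ p $ q = X $ fst p $ fst q * Y $ snd p $ snd q"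
  by (simp add: kron_def)

lemma commutation_mult_nth:
  "((commutation :: real^('d::finite \<times> 'l::finite)^('l \<times> 'd)) ** C) $ p $ q = C $ (snd p, fst p) $ q"
proof -
  have "((commutation :: real^('d \<times> 'l)^('l \<times> 'd)) ** C) $ p $ q =
      (\<Sum>k\<in>UNIV. if k = (snd p, fst p) then C $ k $ q else 0)"
    unfolding matrix_matrix_mult_def commutation_def by (auto intro!: sum.cong simp: prod_eq_iff)
  then show ?thesis by simp
qed

text \<open>The two occurrences have different types: the inverse is the commutation matrix with the
  two dimensions exchanged.\<close>

lemma matrix_inv_commutation:
  "matrix_inv (commutation :: real^('d::finite \<times> 'l::finite)^('l \<times> 'd)) = commutation"
proof (rule matrix_inv_eqI)
  show "(commutation :: real^('d \<times> 'l)^('l \<times> 'd)) ** commutation = mat 1"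
    "(commutation :: real^('l \<times> 'd)^('d \<times> 'l)) ** commutation = mat 1"
    by (auto simp: vec_eq_iff commutation_mult_nth) (auto simp: commutation_def mat_def prod_eq_iff)
qed

section \<open>The differential of \<open>A_star\<close> and the covariance it induces\<close>

locale inverse_regression = gaussian_pair \<Sigma> \<Gamma>
  for \<Sigma> :: "real^'d^'d" and \<Gamma> :: "real^'l^'l" +
  fixes A :: "real^'l^'d"
begin

abbreviation S :: "real^'l^'l" where "S \<equiv> Sigma_star \<Gamma> \<Sigma> A"
abbreviation B :: "real^'d^'l" where "B \<equiv> A_star \<Gamma> \<Sigma> A"
text \<open>By the Woodbury identity this is the inverse of
  \<open>\<Sigma> + A ** \<Gamma> ** transpose A\<close>, the precision matrix of the marginal law
  of X. It gathers the first two terms of the differential into one.\<close>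

definition Q :: "real^'d^'d" where "Q = P - P ** A ** B"

lemma transpose_P: "transpose P = P" and transpose_inv_\<Gamma>: "transpose P' = P'"
  using pos_def_matrix_inv[OF E.pos_def] pos_def_matrix_inv[OF V.pos_def] by (simp_all add: pos_def_def)

lemma P_\<Sigma>: "P ** \<Sigma> = mat 1" and \<Sigma>_P: "\<Sigma> ** P = mat 1"
  by (simp_all add: matrix_inv_left matrix_inv_right pos_def_invertible E.pos_def)

lemma pos_def_precision: "pos_def (P' + transpose A' ** P ** A')"
  unfolding pos_def_def
proof (intro conjI allI impI)
  show "transpose (P' + transpose A' ** P ** A') = P' + transpose A' ** P ** A'"
    by (simp add: linear_add[OF linear_transpose] transpose_inv_\<Gamma>
        matrix_transpose_mul transpose_P matrix_mul_assoc)
  fix x :: "real^'l" assume "x \<noteq> 0"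
  have "x \<bullet> ((transpose A' ** P ** A') *v x) = (A' *v x) \<bullet> (P *v (A' *v x))"
    by (simp add: inner_matrix_vector_mult flip: matrix_vector_mul_assoc)
  then show "0 < x \<bullet> ((P' + transpose A' ** P ** A') *v x)"
    using V.pos[OF \<open>x \<noteq> 0\<close>] E.form_nonneg[of "A' *v x"]
    by (simp add: matrix_vector_mult_add_rdistrib inner_add_right)
qed

lemma transpose_S: "transpose S = S"
  using pos_def_matrix_inv[OF pos_def_precision] by (simp add: Sigma_star_def pos_def_def)

lemma S_mult: "S ** transpose A ** P ** A = mat 1 - S ** P'"
proof -
  have "S ** (P' + transpose A ** P ** A) = mat 1"
    unfolding Sigma_star_def by (rule matrix_inv_left[OF pos_def_invertible[OF pos_def_precision]])
  then show ?thesis by (simp add: matrix_mult_simps matrix_mul_assoc algebra_simps)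
qed

lemma B_eq: "B = S ** transpose A ** P" by (simp add: A_star_def)

lemma transpose_B: "transpose B = P ** A ** S"
  by (simp add: B_eq matrix_transpose_mul transpose_P transpose_S matrix_mul_assoc)

lemma PAB: "P ** A ** B = transpose B ** transpose A ** P"
  by (simp add: transpose_B) (simp add: B_eq matrix_mul_assoc)

lemma transpose_Q: "transpose Q = Q"
proof -
  have "transpose (P ** A ** B) = P ** A ** B"
    by (simp add: matrix_transpose_mul transpose_P matrix_mul_assoc PAB)
  then show ?thesis by (simp add: Q_def linear_diff[OF linear_transpose] transpose_P)
qed

text \<open>Follows from \<open>S ** transpose A ** P ** A = mat 1 - S ** P'\<close>. It relates the
  factors of the cross terms of the covariance to each other when V is a multiple of
  \<open>P'\<close>.\<close>

lemma B_\<Sigma>_Q: "B ** \<Sigma> ** Q = S ** P' ** B"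
proof -
  have "B ** \<Sigma> ** Q = S ** transpose A ** (P ** \<Sigma>) ** Q" by (simp add: B_eq matrix_mul_assoc)
  also have "\<dots> = B - (S ** transpose A ** P ** A) ** B"
    by (simp add: P_\<Sigma> Q_def matrix_mult_simps matrix_mul_assoc B_eq)
  also have "\<dots> = S ** P' ** B" by (simp add: S_mult matrix_mult_simps)
  finally show ?thesis .
qed

lemma Q_\<Sigma>_Q: "Q ** \<Sigma> ** Q = P + transpose B ** transpose A ** P ** A ** B - 2 *\<^sub>R (P ** A ** B)"
proof -
  have "Q ** \<Sigma> ** Q = (P - transpose B ** transpose A ** P) ** \<Sigma> ** (P - P ** A ** B)"
    by (simp add: Q_def PAB)
  also have "\<dots> = (P ** \<Sigma>) ** P - (P ** \<Sigma>) ** P ** A ** B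
      - transpose B ** transpose A ** (P ** \<Sigma>) ** P
      + transpose B ** transpose A ** (P ** \<Sigma>) ** P ** A ** B"
    by (simp add: matrix_mult_simps matrix_mul_assoc)
  also have "\<dots> = P + transpose B ** transpose A ** P ** A ** B - 2 *\<^sub>R (P ** A ** B)"
    by (simp add: P_\<Sigma> PAB[symmetric] scaleR_2)
  finally show ?thesis .
qed

lemma Q_\<Sigma>_B: "Q ** \<Sigma> ** transpose B = transpose B - transpose B ** transpose A ** transpose B"
proof -
  have "Q ** \<Sigma> ** transpose B = (P ** \<Sigma>) ** transpose B - transpose B ** transpose A ** (P ** \<Sigma>) ** transpose B"
    by (simp add: Q_def PAB matrix_mult_simps matrix_mul_assoc)
  then show ?thesis by (simp add: P_\<Sigma>)
qed

text \<open>The gradient of the coordinate p of the vectorized differential with respect to the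
  Frobenius inner product. In p the column index comes first, as in
  \<open>vectorize\<close>.\<close>

definition K :: "'d \<times> 'l \<Rightarrow> real^'l^'d" where
  "K p = outer (Q *v axis (fst p) 1) (S *v axis (snd p) 1) -
    outer (transpose B *v axis (snd p) 1) (B *v axis (fst p) 1)"

lemma D_A_star_eq: "D_A_star \<Gamma> \<Sigma> A H = S ** transpose H ** Q - B ** H ** B"
  by (simp add: D_A_star_def Q_def matrix_mult_simps matrix_mul_assoc)

lemma vectorize_D_A_star: "vectorize (D_A_star \<Gamma> \<Sigma> A H) $ p = H \<bullet> K p"
proof -
  obtain b a where p: "p = (b, a)" by (cases p)
  have n: "X $ a $ b = (X *v axis b 1) \<bullet> axis a 1" for X :: "real^'d^'l"
    using axis_inner_mult[of a X b] by (simp add: inner_commute)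
  have m: "((X ** Y ** Z) *v x) \<bullet> z = (Y *v (Z *v x)) \<bullet> (transpose X *v z)"
    for X :: "real^'x^'a" and Y :: "real^'y^'x" and Z :: "real^'z^'y" and x z
    by (simp only: inner_matrix_vector_mult[of X, symmetric] matrix_vector_mul_assoc matrix_mul_assoc)
  have 1: "((S ** transpose H ** Q) *v axis b 1) \<bullet> axis a 1 =
      H \<bullet> outer (Q *v axis b 1) (S *v axis a 1)"
    by (simp only: m inner_outer inner_matrix_vector_mult[of "transpose H"] transpose_transpose
        transpose_S) (rule inner_commute)
  have 2: "((B ** H ** B) *v axis b 1) \<bullet> axis a 1 = H \<bullet> outer (transpose B *v axis a 1) (B *v axis b 1)"
    by (simp only: m inner_outer)
  show ?thesis by (simp add: vectorize_def p D_A_star_eq K_def inner_diff_right n 1 2)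
qed

text \<open>On rank-one matrices the form factors into a product of two scalar forms. As K is a
  difference of two such matrices, four products of entries appear, the last two being the cross
  terms.\<close>

lemma K_form:
  assumes V: "transpose W = W"
  shows "K (b, a) \<bullet> (\<Sigma> ** K (b', a') ** W) =
    (Q ** \<Sigma> ** Q) $ b $ b' * (S ** W ** S) $ a $ a' + (B ** \<Sigma> ** transpose B) $ a $ a' * (transpose B ** W ** B) $ b $ b'
    - (Q ** \<Sigma> ** transpose B) $ b $ a' * (S ** W ** B) $ a $ b'
    - (B ** \<Sigma> ** Q) $ a $ b' * (transpose B ** W ** S) $ b $ a'"
proof -
  have o: "outer u v \<bullet> (\<Sigma> ** outer u' v' ** W) = (u \<bullet> (\<Sigma> *v u')) * (v \<bullet> (W *v v'))" for u u' v v'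
    by (simp add: matrix_mult_outer outer_matrix_mult V inner_outer outer_matrix_vector_mult
        inner_commute mult.commute)
  have n: "(X *v axis i 1) \<bullet> (C *v (Y *v axis j 1)) = (transpose X ** C ** Y) $ i $ j"
    for X :: "real^'x^'c" and C :: "real^'c^'c" and Y :: "real^'y^'c" and i j
    by (simp only: inner_matrix_vector_mult matrix_vector_mul_assoc matrix_mul_assoc axis_inner_mult)
  show ?thesis
    unfolding K_def fst_conv snd_conv inner_diff_left matrix_mult_simps inner_diff_right o n
      transpose_Q transpose_S transpose_transpose
    by (simp add: algebra_simps)
qed

text \<open>With \<open>W = c *\<^sub>R P'\<close> and R = \<open>S ** P' ** B\<close>, both cross
  terms of \<open>K_form\<close> are c times the same product of an entry of
  \<open>transpose R\<close> and an entry of R. This is the origin of the factor 2.\<close>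

lemma K_form_eq_Theta_formula:
  "K p \<bullet> (\<Sigma> ** K q ** (c *\<^sub>R P')) = Theta_formula (c *\<^sub>R P') \<Gamma> \<Sigma> A $ p $ q"
proof -
  obtain b a b' a' where p: "p = (b, a)" and q: "q = (b', a')" by (cases p, cases q)
  define W where "W = c *\<^sub>R P'"
  have W: "transpose W = W" by (simp add: W_def transpose_scalar transpose_inv_\<Gamma>)
  let ?R = "S ** P' ** B"
  have SWB: "S ** W ** B = c *\<^sub>R ?R" by (simp add: W_def matrix_mult_simps)
  have BWS: "transpose B ** W ** S = c *\<^sub>R transpose ?R"
    by (simp add: W_def matrix_mult_simps matrix_transpose_mul transpose_S transpose_inv_\<Gamma> matrix_mul_assoc)
  have Q\<Sigma>B: "transpose B - transpose B ** transpose A ** transpose B = transpose ?R"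
    unfolding Q_\<Sigma>_B[symmetric] B_\<Sigma>_Q[symmetric] using E.pos_def
    by (simp add: matrix_transpose_mul transpose_Q matrix_mul_assoc pos_def_def)
  \<comment> \<open>The commutation matrix swaps the components of the summation index, so the sum
    over pairs splits into a product of two matrix entries.\<close>
  have cross: "(((mat 1 \<otimes>\<^sub>k (S ** W)) - ((transpose B ** transpose A) \<otimes>\<^sub>k (S ** W)))
      ** matrix_inv commutation ** (B \<otimes>\<^sub>k transpose B)) $ p $ q = transpose ?R $ b $ a' * (S ** W ** B) $ a $ b'"
    (is "(?X ** _ ** ?Y) $ p $ q = _")
  proof -
    have "(?X ** matrix_inv commutation ** ?Y) $ p $ q = (?X ** (commutation ** ?Y)) $ p $ q"
      by (simp add: matrix_inv_commutation matrix_mul_assoc)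
    also have "\<dots> = (\<Sum>k\<in>UNIV. ?X $ p $ k * ?Y $ (snd k, fst k) $ q)"
      by (simp add: matrix_matrix_mult_def[of ?X] commutation_mult_nth)
    also have "\<dots> = (\<Sum>(d, l)\<in>UNIV \<times> UNIV.
        ((mat 1 - transpose B ** transpose A) $ b $ d * transpose B $ d $ a') * ((S ** W) $ a $ l * B $ l $ b'))"
      by (intro sum.cong) (auto simp: kron_nth p q algebra_simps)
    also have "\<dots> = (\<Sum>d\<in>UNIV. (mat 1 - transpose B ** transpose A) $ b $ d * transpose B $ d $ a') *
        (\<Sum>l\<in>UNIV. (S ** W) $ a $ l * B $ l $ b')"
      by (simp only: sum_product sum.cartesian_product)
    also have "\<dots> = ((mat 1 - transpose B ** transpose A) ** transpose B) $ b $ a' * (S ** W ** B) $ a $ b'"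
      by (simp add: matrix_matrix_mult_def[of _ "transpose B"] matrix_matrix_mult_def[of "S ** W"])
    finally show ?thesis by (simp add: matrix_mult_simps Q\<Sigma>B)
  qed
  have "K p \<bullet> (\<Sigma> ** K q ** W) = Theta_formula W \<Gamma> \<Sigma> A $ p $ q"
    unfolding p q K_form[OF W] Theta_formula_def Let_def
    by (simp add: cross[unfolded p q] kron_nth Q_\<Sigma>_Q Q_\<Sigma>_B Q\<Sigma>B B_\<Sigma>_Q SWB BWS)
  then show ?thesis by (simp add: W_def)
qed

lemma has_derivative_A_star: "(A_star \<Gamma> \<Sigma> has_derivative D_A_star \<Gamma> \<Sigma> A) (at A)"
proof -
  note mult = bounded_bilinear.FDERIV[OF bilinear_matrix_mult]
  note left = bounded_linear.has_derivative[OF bounded_bilinear.bounded_linear_left[OF bilinear_matrix_mult]]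
  have t: "(transpose has_derivative transpose) (at A)"
    by (rule bounded_linear_imp_has_derivative[OF bounded_linear_transpose])
  let ?D = "\<lambda>h. 0 + (transpose A ** P ** h + transpose h ** P ** A)"
  have X: "((\<lambda>A'. P' + transpose A' ** P ** A') has_derivative (\<lambda>h. ?D h)) (at A)"
    by (intro has_derivative_add has_derivative_const mult left t has_derivative_ident)
  have S: "(Sigma_star \<Gamma> \<Sigma> has_derivative (\<lambda>h. - (S ** ?D h ** S))) (at A)"
    using has_derivative_compose[OF X has_derivative_matrix_inv[OF pos_def_invertible[OF pos_def_precision]]]
    unfolding Sigma_star_def[abs_def] .
  have "((\<lambda>A'. Sigma_star \<Gamma> \<Sigma> A' ** transpose A' ** P) has_derivative
      (\<lambda>h. (S ** transpose h + - (S ** ?D h ** S) ** transpose A) ** P)) (at A)"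
    by (intro left mult S t)
  also have "(\<lambda>h. (S ** transpose h + - (S ** ?D h ** S) ** transpose A) ** P) = D_A_star \<Gamma> \<Sigma> A"
    by (rule ext) (simp add: D_A_star_def B_eq matrix_mult_simps matrix_mul_assoc algebra_simps)
  finally show ?thesis
    unfolding A_star_def[abs_def] .
qed

text \<open>The part of \<open>Theta\<close> that does not depend on N: for N \<ge> L + 2 the
  covariance is \<open>\<Theta>\<close> divided by N - L - 1.\<close>

definition \<Theta> :: "real^('d \<times> 'l)^('d \<times> 'l)" where
  "\<Theta> = (\<chi> p q. K p \<bullet> (\<Sigma> ** K q ** P'))"

lemma linear_vec_D: "linear (\<lambda>h. vectorize (D_A_star \<Gamma> \<Sigma> A h))"
  by (rule linearI) (simp_all add: vec_eq_iff vectorize_D_A_star inner_add_left)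

text \<open>The factorization D C D^T, where D is the vectorized differential, C maps h to
  \<open>\<Sigma> ** h ** P'\<close>, and the adjoint of D maps w to the combination of the
  \<open>K q\<close> with coefficients \<open>w $ q\<close>.\<close>

lemma \<Theta>_mult: "\<Theta> *v w = vectorize (D_A_star \<Gamma> \<Sigma> A (\<Sigma> ** (\<Sum>q\<in>UNIV. w $ q *\<^sub>R K q) ** P'))"
proof -
  interpret F: positive_form "\<lambda>h. \<Sigma> ** h ** P'"
    by (rule positive_form_matrix_mult[OF E.pos_def pos_def_matrix_inv[OF V.pos_def]])
  show ?thesis unfolding linear_sum[OF F.lin] linear_cmul[OF F.lin]
    by (simp add: vec_eq_iff vectorize_D_A_star matrix_vector_mult_def \<Theta>_def inner_sum_left
        inner_commute[of "K _"] mult.commute)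
qed

text \<open>The factorization in \<open>\<Theta>_mult\<close> makes D surjective, and equality of
  dimensions makes it injective. The preimage of \<open>D h\<close> under \<open>\<Theta>\<close> is
  then a vector whose image under the adjoint is \<open>P ** h ** \<Gamma>\<close>.\<close>

lemma quadratic_form_\<Theta>:
  assumes "invertible \<Theta>"
  shows "vectorize (D_A_star \<Gamma> \<Sigma> A h) \<bullet> (matrix_inv \<Theta> *v vectorize (D_A_star \<Gamma> \<Sigma> A h)) = h \<bullet> (P ** h ** \<Gamma>)"
proof -
  let ?G = "\<lambda>h. vectorize (D_A_star \<Gamma> \<Sigma> A h)"
  have \<Theta>_inv: "\<Theta> *v (matrix_inv \<Theta> *v w) = w" for w
    by (simp add: matrix_vector_mul_assoc matrix_inv_right assms)
  have surj: "surj ?G" unfolding surj_def using \<Theta>_inv[symmetric] unfolding \<Theta>_mult by metis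
  have inj: "inj ?G" by (rule linear_surjective_imp_injective[OF linear_vec_D surj]) simp
  define x where "x = matrix_inv \<Theta> *v ?G h"
  define u where "u = (\<Sum>q\<in>UNIV. x $ q *\<^sub>R K q)"
  have "?G (\<Sigma> ** u ** P') = ?G h" using \<Theta>_inv[of "?G h"] by (simp add: u_def x_def \<Theta>_mult)
  then have "\<Sigma> ** u ** P' = h" using injD[OF inj] by blast
  then have "P ** h ** \<Gamma> = P ** (\<Sigma> ** u ** P') ** \<Gamma>" by simp
  also have "\<dots> = (P ** \<Sigma>) ** u ** (P' ** \<Gamma>)" by (simp only: matrix_mul_assoc)
  also have "\<dots> = u" by (simp add: P_\<Sigma> matrix_inv_left pos_def_invertible V.pos_def)
  finally have u: "P ** h ** \<Gamma> = u" .
  have "?G h \<bullet> x = h \<bullet> u"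
    by (simp add: inner_vec_def[of "vectorize _"] vectorize_D_A_star u_def inner_sum_right mult.commute)
  then show ?thesis by (simp add: x_def u)
qed

end

lemma linear_vectorize: "linear (vectorize :: real^'c^'r \<Rightarrow> _)"
  by (rule linearI) (simp_all add: vectorize_def vec_eq_iff)

lemma measurable_vectorize [measurable]: "vectorize \<in> borel_measurable (borel :: (real^'c^'r) measure)"
  by (intro borel_measurable_continuous_onI linear_continuous_on
      linear_vectorize[unfolded linear_conv_bounded_linear])

context inverse_regression
begin

text \<open>The statistic of the region as a function of the value of \<open>A_hat\<close>, without
  the factor N - L - 1 that the inverse of \<open>Theta\<close> contributes.\<close>

definition \<beta> :: "real^'l^'d \<Rightarrow> real" where
  "\<beta> A' = (let w = vectorize (B - A_star \<Gamma> \<Sigma> A') in w \<bullet> (matrix_inv \<Theta> *v w))"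

text \<open>The statistic of the confidence region and the pivot \<open>h \<bullet> (P ** h ** g)\<close>, whose law is
  exactly chi-square, have a ratio close to 1 once \<open>h\<close> is small and \<open>g / N\<close> is close to \<open>\<Gamma>\<close>.\<close>

lemma statistic_pivot_ratio:
  assumes \<Theta>: "invertible \<Theta>" and s: "0 < s" "s < 1"
  obtains d N0 where "d > 0"
    and "\<And>h g N. norm h < d \<Longrightarrow> norm (g /\<^sub>R real N - \<Gamma>) < d \<Longrightarrow> N \<ge> N0 \<Longrightarrow>
      (real N - real CARD('l) - 1) * \<beta> (A + h) \<in>
        {(1 - s) * (h \<bullet> (P ** h ** g))..(1 + s) * (h \<bullet> (P ** h ** g))}"
proof -
  let ?G = "\<lambda>h. vectorize (D_A_star \<Gamma> \<Sigma> A h)" and ?B = "matrix_inv \<Theta>"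
  let ?q = "\<lambda>h. h \<bullet> (P ** h ** \<Gamma>)"
  interpret F: positive_form "\<lambda>h. P ** h ** \<Gamma>"
    by (rule positive_form_matrix_mult[OF pos_def_matrix_inv[OF E.pos_def] V.pos_def])
  obtain c where c: "c > 0" "\<And>h. c * (norm h)\<^sup>2 \<le> ?q h"
    using F.coercive by blast
  obtain KB where KB: "KB > 0" "\<And>w. norm (?B *v w) \<le> norm w * KB"
    using bounded_linear.pos_bounded[OF matrix_vector_mul_bounded_linear] by blast
  have KB': "\<bar>v \<bullet> (?B *v w)\<bar> \<le> KB * (norm v * norm w)" for v w
    using order.trans[OF Cauchy_Schwarz_ineq2 mult_left_mono[OF KB(2)]] by (simp add: mult_ac)
  obtain KG where KG: "KG > 0" "\<And>h. norm (?G h) \<le> norm h * KG"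
    using bounded_linear.pos_bounded[OF linear_vec_D[unfolded linear_conv_bounded_linear]] by blast
  have "bounded_bilinear (\<lambda>(h :: real^'l^'d) (E :: real^'l^'l). P ** h ** E)"
    by (rule bounded_bilinear.comp1[OF bilinear_matrix_mult
        bounded_bilinear.bounded_linear_right[OF bilinear_matrix_mult]])
  then obtain KP where KP: "KP > 0"
    "\<And>(h :: real^'l^'d) (E :: real^'l^'l). norm (P ** h ** E) \<le> norm h * norm E * KP"
    using bounded_bilinear.pos_bounded by blast
  have KP': "\<bar>h \<bullet> (P ** h ** E)\<bar> \<le> KP * norm E * (norm h)\<^sup>2" for h :: "real^'l^'d" and E
    using order.trans[OF Cauchy_Schwarz_ineq2 mult_left_mono[OF KP(2)]]
    by (simp add: power2_eq_square mult_ac)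
  have scale: "b * min d (c * s / 4 / b) \<le> c * s / 4" if "b > 0" for b d
    using that mult_left_mono[OF min.cobounded2, of b d "c * s / 4 / b"] by simp
  have q: "c * s / 4 * (norm h)\<^sup>2 \<le> s / 4 * ?q h" for h
    using mult_left_mono[OF c(2)[of h], of "s / 4"] s(1) by (simp add: mult_ac)
  \<comment> \<open>t is the tolerance of the linearization. It makes the error of the quadratic
    form, at most \<open>KB * (2 * KG + 1) * t\<close> times the squared norm of h, at most s / 4 of
    the form itself; \<open>t \<le> 1\<close> bounds the remainder by \<open>norm h\<close>.\<close>
  define t where "t = min 1 (c * s / 4 / (KB * (2 * KG + 1)))"
  have t: "t > 0" "t \<le> 1" "KB * (2 * KG + 1) * t \<le> c * s / 4"
    using scale[of "KB * (2 * KG + 1)" 1] c(1) s(1) KB(1) KG(1) by (simp_all add: t_def)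
  obtain d1 where d1: "d1 > 0" "\<And>A'. norm (A' - A) < d1 \<Longrightarrow>
      norm (vectorize (A_star \<Gamma> \<Sigma> A') - vectorize B - ?G (A' - A)) \<le> t * norm (A' - A)"
    using bounded_linear.has_derivative[OF linear_vectorize[unfolded linear_conv_bounded_linear] has_derivative_A_star]
      t(1) unfolding has_derivative_at_alt by blast
  \<comment> \<open>The second entry of the minimum makes the replacement of g / N by \<Gamma> cost
    at most s / 4 of the form.\<close>
  define d where "d = min d1 (c * s / 4 / KP)"
  have d: "d > 0" "d \<le> d1" "KP * d \<le> c * s / 4"
    using scale[OF KP(1), of d1] d1(1) c(1) s(1) KP(1) by (simp_all add: d_def)
  \<comment> \<open>Chosen so that (N - L - 1) / N is at least 1 - s / 4; the added 1 keeps N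
    positive.\<close>
  define N0 where "N0 = nat \<lceil>4 * (real CARD('l) + 1) / s\<rceil> + 1"
  have main: "\<bar>\<beta> (A + h) - ?q h\<bar> \<le> s / 4 * ?q h" if h: "norm h < d" for h
  proof -
    define r where "r = vectorize (A_star \<Gamma> \<Sigma> (A + h)) - vectorize B - ?G h"
    have r: "norm r \<le> t * norm h" using d1(2)[of "A + h"] h d(2) by (simp add: r_def)
    have w: "vectorize (B - A_star \<Gamma> \<Sigma> (A + h)) = - (?G h + r)"
      by (simp add: r_def linear_diff[OF linear_vectorize])
    have "\<beta> (A + h) = (?G h + r) \<bullet> (?B *v (?G h + r))" unfolding \<beta>_def Let_def w
      by (simp add: linear_neg[OF matrix_vector_mul_linear] del: minus_add_distrib)
    then have "\<beta> (A + h) - ?q h = ?G h \<bullet> (?B *v r) + r \<bullet> (?B *v ?G h) + r \<bullet> (?B *v r)"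
      unfolding quadratic_form_\<Theta>[OF \<Theta>, symmetric]
      by (simp add: matrix_vector_right_distrib inner_add_left inner_add_right)
    also have "\<bar>\<dots>\<bar> \<le> KB * (norm (?G h) * norm r) + KB * (norm r * norm (?G h)) + KB * (norm r * norm r)"
      using KB'[of "?G h" r] KB'[of r "?G h"] KB'[of r r] by linarith
    also have "\<dots> = KB * ((2 * norm (?G h) + norm r) * norm r)" by (simp add: algebra_simps)
    also have "\<dots> \<le> KB * ((2 * (norm h * KG) + norm h) * (t * norm h))"
    proof -
      have "norm r \<le> norm h" using mult_right_mono[OF t(2), of "norm h"] r by simp
      then have "2 * norm (?G h) + norm r \<le> 2 * (norm h * KG) + norm h"
        using KG(2)[of h] by simp
      then show ?thesis
        using KB(1) KG(1) r by (intro mult_left_mono mult_mono) auto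
    qed
    also have "\<dots> = (KB * (2 * KG + 1) * t) * (norm h)\<^sup>2"
      by (simp add: power2_eq_square algebra_simps)
    also have "\<dots> \<le> (c * s / 4) * (norm h)\<^sup>2" by (intro mult_right_mono t) auto
    also note q
    finally show ?thesis .
  qed
  show thesis
  proof (rule that[OF d(1), of N0])
    fix h :: "real^'l^'d" and g :: "real^'l^'l" and N assume h: "norm h < d" and g: "norm (g /\<^sub>R real N - \<Gamma>) < d" and N: "N \<ge> N0"
    define b q u where "b = \<beta> (A + h)" and "q = ?q h" and "u = (h \<bullet> (P ** h ** g)) / real N"
    define n where "n = (real N - real CARD('l) - 1) / real N"
    have N_pos: "real N > 0" using N by (simp add: N0_def)
    have q0: "q \<ge> 0" unfolding q_def by (rule F.form_nonneg)
    have "u - q = h \<bullet> (P ** h ** (g /\<^sub>R real N - \<Gamma>))"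
      by (simp add: u_def q_def matrix_mult_simps inner_diff_right divide_inverse mult.commute)
    then have "\<bar>u - q\<bar> \<le> KP * norm (g /\<^sub>R real N - \<Gamma>) * (norm h)\<^sup>2"
      using KP' by simp
    also have "\<dots> \<le> KP * d * (norm h)\<^sup>2" using g KP by (intro mult_right_mono mult_left_mono) auto
    also have "\<dots> \<le> (c * s / 4) * (norm h)\<^sup>2" by (intro mult_right_mono d) auto
    also note q
    finally have u: "\<bar>u - q\<bar> \<le> s / 4 * q" unfolding q_def .
    have b: "\<bar>b - q\<bar> \<le> s / 4 * q" using main[OF h] by (simp add: b_def q_def)
    have "4 * (real CARD('l) + 1) / s \<le> real N"
      using N unfolding N0_def by linarith
    then have "4 * (real CARD('l) + 1) \<le> real N * s" using s(1) by (simp add: pos_divide_le_eq)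
    then have n: "1 - s / 4 \<le> n" "n \<le> 1"
      using N_pos by (simp_all add: n_def field_simps)
    have e: "(1 - s / 4) * q = q - s / 4 * q" "(1 + s / 4) * q = q + s / 4 * q"
      by (simp_all only: left_diff_distrib distrib_right mult_1)
    have bq: "(1 - s / 4) * q \<le> b" "b \<le> (1 + s / 4) * q"
      and uq: "(1 - s / 4) * q \<le> u" "u \<le> (1 + s / 4) * q"
      unfolding e using b u by linarith+
    have b0: "b \<ge> 0" using q0 s by (intro order.trans[OF _ bq(1)] mult_nonneg_nonneg) auto
    \<comment> \<open>For 0 < s < 1 the relative errors s / 4 in b, u and n compound to at most
      s.\<close>
    have "n * b \<le> 1 * b" by (intro mult_right_mono n b0)
    also have "\<dots> \<le> (1 + s / 4) * q" using bq by simp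
    also have "\<dots> \<le> ((1 + s) * (1 - s / 4)) * q"
      using mult_right_mono[of s 1 s] s by (intro mult_right_mono q0) (simp add: field_simps)
    also have "\<dots> \<le> (1 + s) * u" unfolding mult.assoc using s uq by (intro mult_left_mono) auto
    finally have up: "n * b \<le> (1 + s) * u" .
    have "(1 - s) * u \<le> ((1 - s) * (1 + s / 4)) * q"
      unfolding mult.assoc using s uq by (intro mult_left_mono) auto
    also have "\<dots> \<le> ((1 - s / 4) * (1 - s / 4)) * q"
      using s by (intro mult_right_mono q0) (simp add: algebra_simps)
    also have "\<dots> \<le> n * b" unfolding mult.assoc using n bq q0 s b0 by (intro mult_mono) auto
    finally have low: "(1 - s) * u \<le> n * b" .
    have "h \<bullet> (P ** h ** g) = real N * u" "(real N - real CARD('l) - 1) * \<beta> (A + h) = real N * (n * b)"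
      using N_pos by (simp_all add: u_def n_def b_def)
    then show "(real N - real CARD('l) - 1) * \<beta> (A + h) \<in>
        {(1 - s) * (h \<bullet> (P ** h ** g))..(1 + s) * (h \<bullet> (P ** h ** g))}"
      using mult_left_mono[OF low, of "real N"] mult_left_mono[OF up, of "real N"] N_pos
      by (simp add: mult.left_commute)
  qed
qed

end

section \<open>The estimator and the coverage of the region\<close>

locale regression_estimator = inverse_regression \<Sigma> \<Gamma> A + regression M \<Sigma> \<Gamma> e y
  for M :: "'w measure" and \<Sigma> :: "real^'d^'d" and \<Gamma> :: "real^'l^'l" and A :: "real^'l^'d"
    and e :: "nat \<Rightarrow> 'w \<Rightarrow> real^'d" and y :: "nat \<Rightarrow> 'w \<Rightarrow> real^'l" +
  fixes X :: "nat \<Rightarrow> 'w \<Rightarrow> real^'d"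
  assumes e_eq: "\<And>i w. e i w = X i w - A *v y i w"
begin

lemma A_hat_eq:
  assumes "invertible (G N w)"
  shows "A_hat X y N w = A + H N w"
proof -
  have "(\<Sum>i<N. outer (X i w) (y i w)) = A ** G N w + cross {..<N} (\<lambda>i. (e i w, y i w))"
    by (simp add: cross_def e_eq G_def gram_def
        bounded_bilinear.sum_right[OF bilinear_matrix_mult] matrix_mult_outer
        bounded_bilinear.diff_left[OF bilinear_outer] sum_subtractf)
  then have "A_hat X y N w = (A ** G N w + cross {..<N} (\<lambda>i. (e i w, y i w))) ** matrix_inv (G N w)"
    by (simp add: A_hat_def G_def gram_def)
  also have "\<dots> = A ** (G N w ** matrix_inv (G N w)) + H N w"
    by (simp add: matrix_mult_simps H_def matrix_mul_assoc)
  finally show ?thesis by (simp add: matrix_inv_right assms)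
qed

lemma measurable_X [measurable]: "X i \<in> borel_measurable M"
proof -
  have "(\<lambda>w. e i w + A *v y i w) \<in> borel_measurable M" by measurable
  then show ?thesis by (simp add: e_eq)
qed

lemma measurable_A_hat [measurable]: "A_hat X y N \<in> borel_measurable M"
  unfolding A_hat_def[abs_def] by measurable

lemma measurable_A_hat_star [measurable]: "A_hat_star \<Gamma> \<Sigma> X y N \<in> borel_measurable M"
  unfolding A_hat_star_def[abs_def] A_star_def Sigma_star_def by measurable

text \<open>Almost surely \<open>A_hat\<close> minus A is \<open>H\<close>, whose mean is 0, so the
  covariances of the coordinates are the mixed moments of \<open>H\<close> against the gradients
  K.\<close>

lemma Theta_eq:
  assumes N: "N \<ge> CARD('l) + 2"
  shows "Theta M \<Gamma> \<Sigma> A X y N = (1 / (real N - real CARD('l) - 1)) *\<^sub>R \<Theta>"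
proof -
  define Z where "Z = (\<lambda>p w. vectorize (D_A_star \<Gamma> \<Sigma> A (A_hat X y N w - A)) $ p)"
  have Z_eq: "Z p = (\<lambda>w. (A_hat X y N w - A) \<bullet> K p)" for p by (simp add: Z_def vectorize_D_A_star)
  have [measurable]: "Z p \<in> borel_measurable M" for p
    unfolding Z_eq by measurable
  have AE: "AE w in M. Z p w = H N w \<bullet> K p" for p
    using AE_invertible_G[OF N] by eventually_elim (simp add: Z_eq A_hat_eq)
  have mean: "expectation (Z p) = 0" for p
  proof -
    have "expectation (Z p) = expectation (\<lambda>w. H N w \<bullet> K p)"
      by (rule integral_cong_AE[OF _ _ AE]) measurable
    then show ?thesis by (simp add: mean_H[OF N])
  qed
  have "Theta M \<Gamma> \<Sigma> A X y N $ p $ q = K p \<bullet> (\<Sigma> ** K q ** P') / (real N - real CARD('l) - 1)" for p q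
  proof -
    have "Theta M \<Gamma> \<Sigma> A X y N $ p $ q = expectation (\<lambda>w. (Z p w - expectation (Z p)) * (Z q w - expectation (Z q)))"
      by (simp add: Theta_def covariance_matrix_def Z_def)
    also have "\<dots> = expectation (\<lambda>w. (H N w \<bullet> K p) * (H N w \<bullet> K q))" unfolding mean
    proof (rule integral_cong_AE)
      show "AE w in M. (Z p w - 0) * (Z q w - 0) = (H N w \<bullet> K p) * (H N w \<bullet> K q)"
        using AE[of p] AE[of q] by eventually_elim simp
    qed measurable
    finally show ?thesis by (simp only: covariance_H(2)[OF N])
  qed
  then show ?thesis by (simp add: vec_eq_iff \<Theta>_def)
qed

lemma Theta_eq_formula:
  assumes N: "N \<ge> CARD('l) + 2"
  shows "Theta M \<Gamma> \<Sigma> A X y N = Theta_formula ((1 / (real N - real CARD('l) - 1)) *\<^sub>R P') \<Gamma> \<Sigma> A"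
  unfolding vec_eq_iff K_form_eq_Theta_formula[symmetric] Theta_eq[OF N]
  by (simp add: \<Theta>_def matrix_mult_simps)

text \<open>Up to an event of small probability, T \<le> q is squeezed between U \<le> q / (1 + s)
  and U \<le> q / (1 - s), where the pivot U has the chi-square distribution function F exactly.
  Continuity of F at q closes the gap.\<close>

lemma confidence_region_coverage:
  assumes level: "0 < \<alpha>" "\<alpha> < 1"
    and Theta_inv: "\<forall>\<^sub>F N in sequentially. invertible (Theta M \<Gamma> \<Sigma> A X y N)"
  shows "(\<lambda>N. prob {w \<in> space M. B \<in> confidence_region M \<Gamma> \<Sigma> A X y \<alpha> N w}) \<longlonglongrightarrow> 1 - \<alpha>"
proof -
  let ?k = "CARD('d) * CARD('l)"
  let ?n = "\<lambda>N. real N - real CARD('l) - 1"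
  define F where "F = cdf (chi_square ?k)"
  define q where "q = quantile (chi_square ?k) (1 - \<alpha>)"
  have k: "?k > 0" by simp
  have F_cont: "isCont F t" for t
    unfolding F_def by (rule isCont_cdf_chi_square[OF k])
  have Fq: "F q = 1 - \<alpha>"
    unfolding F_def q_def
    by (rule cdf_quantile[OF real_distribution_chi_square[OF k] isCont_cdf_chi_square[OF k]]) (use level in auto)
  have ev: "\<forall>\<^sub>F N in sequentially. N \<ge> CARD('l) + 2" by (rule eventually_ge_at_top)
  \<comment> \<open>A single large N suffices, since \<open>Theta\<close> is then a positive
    multiple of \<open>\<Theta>\<close>.\<close>
  have \<Theta>: "invertible \<Theta>"
  proof -
    obtain N where N: "N \<ge> CARD('l) + 2" "invertible (Theta M \<Gamma> \<Sigma> A X y N)"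
      using eventually_conj[OF ev Theta_inv] eventually_happens'[OF sequentially_bot] by blast
    have "\<Theta> ** ((1 / ?n N) *\<^sub>R matrix_inv (Theta M \<Gamma> \<Sigma> A X y N)) = mat 1"
      using matrix_inv_right[OF N(2)] unfolding Theta_eq[OF N(1)] by (simp add: matrix_mult_simps)
    then show ?thesis by (rule invertibleI)
  qed
  define T where "T = (\<lambda>N w. ?n N * \<beta> (A_hat X y N w))"
  let ?T = "\<lambda>N. {w \<in> space M. T N w \<le> q}"
  define U where "U = (\<lambda>N w. H N w \<bullet> (P ** H N w ** G N w))"
  have [measurable]: "T N \<in> borel_measurable M" "U N \<in> borel_measurable M" for N
    unfolding T_def U_def \<beta>_def Let_def A_hat_star_def[symmetric] by measurable
  have region: "{w \<in> space M. B \<in> confidence_region M \<Gamma> \<Sigma> A X y \<alpha> N w} = ?T N"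
    if N: "N \<ge> CARD('l) + 2" for N
  proof -
    have n: "?n N > 0" using N by linarith
    have "matrix_inv (Theta M \<Gamma> \<Sigma> A X y N) = ?n N *\<^sub>R matrix_inv \<Theta>"
      using n matrix_inv_scaleR[OF \<Theta>, of "1 / ?n N"] unfolding Theta_eq[OF N] by simp
    then show ?thesis
      by (simp add: confidence_region_def T_def \<beta>_def A_hat_star_def Let_def q_def flip: scaleR_matrix_vector_assoc)
  qed
  have U: "prob {w \<in> space M. U N w \<le> r} = F r" if "N \<ge> CARD('l) + 2" for N r
    unfolding U_def F_def by (rule prob_quadratic_form_le[OF that])
  have "(\<lambda>N. prob (?T N)) \<longlonglongrightarrow> 1 - \<alpha>"
  proof (rule LIMSEQ_I)
    fix r :: real assume r: "r > 0"
    have "((\<lambda>t. F (q / (1 - t))) \<longlongrightarrow> F (q / (1 - 0))) (at_right 0)"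
      "((\<lambda>t. F (q / (1 + t))) \<longlongrightarrow> F (q / (1 + 0))) (at_right 0)"
      by (intro isCont_tendsto_compose[OF F_cont] tendsto_intros; simp)+
    then have "\<forall>\<^sub>F t in at_right 0. dist (F (q / (1 - t))) (F q) < r / 2"
      "\<forall>\<^sub>F t in at_right 0. dist (F (q / (1 + t))) (F q) < r / 2"
      using r by (auto dest: tendstoD[where e = "r / 2"])
    moreover have "\<forall>\<^sub>F t in at_right 0. t > (0::real) \<and> t < 1"
      by (auto simp: eventually_at_right_field intro: exI[of _ 1])
    ultimately have "\<forall>\<^sub>F t in at_right 0. dist (F (q / (1 - t))) (F q) < r / 2 \<and>
        dist (F (q / (1 + t))) (F q) < r / 2 \<and> t > 0 \<and> t < 1"
      by eventually_elim auto
    then obtain s where s: "dist (F (q / (1 - s))) (F q) < r / 2"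
        "dist (F (q / (1 + s))) (F q) < r / 2" "0 < s" "s < 1"
      using eventually_happens'[OF trivial_limit_at_right_real] by blast
    obtain d N0 where d: "d > 0"
      and ratio: "\<And>h g N. norm h < d \<Longrightarrow> norm (g /\<^sub>R real N - \<Gamma>) < d \<Longrightarrow> N \<ge> N0 \<Longrightarrow>
        ?n N * \<beta> (A + h) \<in> {(1 - s) * (h \<bullet> (P ** h ** g))..(1 + s) * (h \<bullet> (P ** h ** g))}"
      using statistic_pivot_ratio[OF \<Theta> s(3,4)] by blast
    let ?B1 = "\<lambda>N. {w \<in> space M. d \<le> norm (H N w)}"
    let ?B2 = "\<lambda>N. {w \<in> space M. d \<le> norm (G N w /\<^sub>R real N - \<Gamma>)}"
    have "(\<lambda>N. prob (?B1 N) + prob (?B2 N)) \<longlonglongrightarrow> 0 + 0"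
      by (intro tendsto_add H_tendsto_0_in_prob G_law_of_large_numbers d)
    then have "\<forall>\<^sub>F N in sequentially. prob (?B1 N) + prob (?B2 N) < r / 2"
      using r by (intro order_tendstoD(2)) auto
    with ev eventually_ge_at_top[of N0]
    have "\<forall>\<^sub>F N in sequentially. norm (prob (?T N) - (1 - \<alpha>)) < r"
    proof eventually_elim
      case (elim N)
      \<comment> \<open>Outside \<open>?B1 N\<close> and \<open>?B2 N\<close>, of total probability
        below r / 2, the ratio bound holds almost surely. The claim is used for the pair T, U and
        for the pair U, T; the divisions by 1 - s and 1 + s are valid for either sign of q.\<close>
      have le: "prob {w \<in> space M. f w \<le> a} < prob {w \<in> space M. f' w \<le> a'} + r / 2"
        if [measurable]: "f \<in> borel_measurable M" "f' \<in> borel_measurable M"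
          and imp: "\<And>w. T N w \<in> {(1 - s) * U N w..(1 + s) * U N w} \<Longrightarrow> f w \<le> a \<Longrightarrow> f' w \<le> a'" for f f' :: "'w \<Rightarrow> real" and a a'
      proof -
        let ?C = "{w \<in> space M. f' w \<le> a'}"
        have "AE w in M. w \<in> {w \<in> space M. f w \<le> a} \<longrightarrow> w \<in> ?C \<union> ?B1 N \<union> ?B2 N"
          using AE_invertible_G[OF elim(1)]
        proof eventually_elim
          fix w assume "invertible (G N w)"
          from imp[of w] ratio[OF _ _ elim(2), of "H N w" "G N w"]
          show "w \<in> {w \<in> space M. f w \<le> a} \<longrightarrow> w \<in> ?C \<union> ?B1 N \<union> ?B2 N"
            unfolding T_def U_def A_hat_eq[OF \<open>invertible (G N w)\<close>] by (auto simp del: atLeastAtMost_iff simp: not_le intro: leI)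
        qed
        then have "prob {w \<in> space M. f w \<le> a} \<le> prob (?C \<union> ?B1 N \<union> ?B2 N)"
          by (rule finite_measure_mono_AE) measurable
        also have "\<dots> \<le> prob (?C \<union> ?B1 N) + prob (?B2 N)" by (rule measure_Un_le) measurable
        also have "prob (?C \<union> ?B1 N) \<le> prob ?C + prob (?B1 N)" by (rule measure_Un_le) measurable
        finally show ?thesis using elim(3) by linarith
      qed
      have "prob (?T N) < prob {w \<in> space M. U N w \<le> q / (1 - s)} + r / 2"
        by (rule le) (use s(4) in \<open>auto simp: pos_le_divide_eq mult.commute\<close>)
      moreover have "prob {w \<in> space M. U N w \<le> q / (1 + s)} < prob (?T N) + r / 2"
        by (rule le) (use s(3) in \<open>auto simp: pos_le_divide_eq mult.commute\<close>)
      ultimately show ?case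
        using s(1,2) unfolding U[OF elim(1)] dist_real_def Fq real_norm_def by linarith
    qed
    then show "\<exists>n0. \<forall>N\<ge>n0. norm (prob (?T N) - (1 - \<alpha>)) < r" by (simp add: eventually_sequentially)
  qed
  moreover have "\<forall>\<^sub>F N in sequentially. prob (?T N) =
      prob {w \<in> space M. B \<in> confidence_region M \<Gamma> \<Sigma> A X y \<alpha> N w}"
    using ev by eventually_elim (simp only: region)
  ultimately show ?thesis by (rule Lim_transform_eventually)
qed

end

section \<open>From the model to the regression locales\<close>

lemma gaussianI:
  assumes "prob_space M" "pos_def S" "distributed M lborel Z (\<lambda>x. ennreal (mvn_density 0 S x))"
  shows "gaussian S"
proof (rule gaussian.intro)
  show "pos_def S" by fact
  interpret prob_space M by fact
  have "prob_space (distr M lborel Z)"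
    using assms(3) by (intro prob_space_distr) (simp add: distributed_def)
  then show "prob_space (density lborel (\<lambda>x. ennreal (mvn_density 0 S x)))"
    using distributed_distr_eq_density[OF assms(3)] by simp
qed

text \<open>The pairs of noise and regressor are images of the observations under one fixed
  continuous map, so they remain independent over i. Independence within a pair, tested on
  rectangles, makes their law the product \<open>pair_law\<close>.\<close>

lemma regression_estimator_linear_gaussian_model:
  fixes A :: "real^'l^'d"
  assumes "linear_gaussian_model M \<Gamma> \<Sigma> A X Y"
  shows "regression_estimator M \<Sigma> \<Gamma> A (\<lambda>i w. X i w - A *v Y i w) Y X"
proof -
  let ?e = "\<lambda>i w. X i w - A *v Y i w"
  from assms have M: "prob_space M" and \<Gamma>: "pos_def \<Gamma>" and \<Sigma>: "pos_def \<Sigma>"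
    and indep: "prob_space.indep_vars M (\<lambda>_. borel) (\<lambda>i w. (X i w, Y i w)) UNIV"
    and Y: "\<And>i. distributed M lborel (Y i) (\<lambda>y. ennreal (mvn_density 0 \<Gamma> y))"
    and e: "\<And>i. distributed M lborel (?e i) (\<lambda>e. ennreal (mvn_density 0 \<Sigma> e))"
    and ind: "\<And>i. independent_vectors M (?e i) (Y i)"
    unfolding linear_gaussian_model_def by auto
  interpret prob_space M by fact
  interpret E: gaussian \<Sigma> by (rule gaussianI[OF M \<Sigma> e])
  interpret V: gaussian \<Gamma> by (rule gaussianI[OF M \<Gamma> Y])
  interpret gaussian_pair \<Sigma> \<Gamma> ..
  have [measurable]: "Y i \<in> borel_measurable M" "?e i \<in> borel_measurable M" for i
    using Y[of i] e[of i] by (simp_all add: distributed_def)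
  have distr: "distr M borel (Y i) = V.law" "distr M borel (?e i) = E.law" for i
    using distributed_distr_eq_density[OF Y[of i]] distributed_distr_eq_density[OF e[of i]]
    by (simp_all add: V.law_def E.law_def cong: distr_cong)
  show ?thesis
  proof (unfold_locales, goal_cases)
    case 1
    have "(\<lambda>z. (fst z - A *v snd z, snd z)) \<in> borel_measurable (borel :: ((real^'d) \<times> (real^'l)) measure)"
      by (intro borel_measurable_continuous_onI continuous_intros)
    from indep_vars_compose2[OF indep, where Y = "\<lambda>_ z. (fst z - A *v snd z, snd z)", OF this]
    show ?case by simp
  next
    case (2 i)
    have "pair_law = distr M borel (\<lambda>w. (?e i w, Y i w))" unfolding pair_law_def
    proof (rule pair_measure_eqI)
      show "sigma_finite_measure E.law" "sigma_finite_measure V.law" by standard+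
      show "sets (E.law \<Otimes>\<^sub>M V.law) = sets (distr M borel (\<lambda>w. (?e i w, Y i w)))"
        using sets_pair_law unfolding pair_law_def borel_prod sets_distr .
      fix C D assume "C \<in> sets E.law" "D \<in> sets V.law"
      then have [measurable]: "C \<in> sets borel" "D \<in> sets borel" by simp_all
      have CD: "C \<times> D \<in> sets borel" by (subst borel_prod[symmetric]) auto
      have em: "(\<lambda>w. (?e i w, Y i w)) \<in> borel_measurable M"
        by (subst borel_prod[symmetric]) measurable
      have "prob (?e i -` C \<inter> space M \<inter> (Y i -` D \<inter> space M)) =
          prob (?e i -` C \<inter> space M) * prob (Y i -` D \<inter> space M)"
        using ind[of i] unfolding independent_vectors_def
        by (rule indep_setD) (auto simp: in_vimage_algebra)
      then have "emeasure M (?e i -` C \<inter> space M) * emeasure M (Y i -` D \<inter> space M) =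
          emeasure M (?e i -` C \<inter> space M \<inter> (Y i -` D \<inter> space M))"
        by (simp add: emeasure_eq_measure ennreal_mult)
      also have "?e i -` C \<inter> space M \<inter> (Y i -` D \<inter> space M) =
          (\<lambda>w. (?e i w, Y i w)) -` (C \<times> D) \<inter> space M" by auto
      finally show "emeasure E.law C * emeasure V.law D =
          emeasure (distr M borel (\<lambda>w. (?e i w, Y i w))) (C \<times> D)"
        unfolding distr[symmetric, of i] by (simp add: emeasure_distr[OF em CD] emeasure_distr)
    qed
    then show ?case ..
  qed simp
qed

theorem theorem4:
  fixes M :: "'w measure"
    and X :: "nat \<Rightarrow> 'w \<Rightarrow> real^'d"
    and Y :: "nat \<Rightarrow> 'w \<Rightarrow> real^'l"
    and A :: "real^'l^'d"
    and \<Gamma> :: "real^'l^'l"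
    and \<Sigma> :: "real^'d^'d"
    and \<alpha> :: real
  assumes model: "linear_gaussian_model M \<Gamma> \<Sigma> A X Y"
    and diag: "\<And>i j. i \<noteq> j \<Longrightarrow> \<Sigma> $ i $ j = 0"
    and level: "0 < \<alpha>" "\<alpha> < 1"
    and Theta_inv: "\<forall>\<^sub>F N in sequentially. invertible (Theta M \<Gamma> \<Sigma> A X Y N)"
  shows "(\<forall>N \<ge> CARD('l) + 2. Theta M \<Gamma> \<Sigma> A X Y N =
            Theta_formula ((1 / (real N - real CARD('l) - 1)) *\<^sub>R matrix_inv \<Gamma>) \<Gamma> \<Sigma> A) \<and>
         (\<lambda>N. measure M {\<omega> \<in> space M.
            A_star \<Gamma> \<Sigma> A \<in> confidence_region M \<Gamma> \<Sigma> A X Y \<alpha> N \<omega>}) \<longlonglongrightarrow> 1 - \<alpha>"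
proof -
  interpret regression_estimator M \<Sigma> \<Gamma> A "\<lambda>i \<omega>. X i \<omega> - A *v Y i \<omega>" Y X
    by (rule regression_estimator_linear_gaussian_model[OF model])
  show ?thesis
    using Theta_eq_formula confidence_region_coverage[OF level Theta_inv] by blast
qed

end
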